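(* Let $\mathcal{P}:\mathbb{R}/2\pi\mathbb{Z}\to[0,+\infty)$ be a continuous function that is positive on an interval of length greater than $\pi$, let $A>0$, and let $\Omega=\{(u,v)\in\mathbb{R}^2:\sqrt{u^2+v^2}\,\mathcal{P}(\operatorname{Arg}(u+iv))\le1\}$. Consider the two problems: (I) minimize $\mathcal{F}(B)=\int_{\partial B}\mathcal{P}(\theta_\xi)\,d\xi$ in the class of convex bodies $B\subset\mathbb{R}^2$ of area $A$; (II) minimize $\int_0^1\mu_\Omega(\dot y,-\dot x)\,dt$ over closed Lipschitz curves $(x,y):[0,1]\to\mathbb{R}^2$ satisfying $\frac12\int_0^1(x\dot y-y\dot x)\,dt=A$. Then the optimal bodies in both problems coincide (the optimal curves of (II) being the boundaries of the optimal bodies of (I)), and they are similar to the polar set $(\operatorname{conv}\Omega)^\circ$ of the convex hull of $\Omega$, with similarity ratio proportional to $\sqrt{A}$ (that is, equal to $c\sqrt{A}$ with $c>0$ depending only on $\mathcal{P}$).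
   Context: A convex body is a compact convex set in $\mathbb{R}^2$. For a regular point $\xi\in\partial B$ (almost every boundary point), $(\cos\theta_\xi,\sin\theta_\xi)$ is the outward unit normal, and $d\xi$ is the length element. For $R>0$, $\operatorname{Arg}(Re^{i\theta})=\theta\in\mathbb{R}/2\pi\mathbb{Z}$. $\mu_\Omega(w)=\inf\{\lambda>0: w\in\lambda\Omega\}$ is the Minkowski function of the (star-shaped, possibly nonconvex or unbounded) set $\Omega$. The polar set of $C\subset\mathbb{R}^2$ is $C^\circ=\{p:\langle p,w\rangle\le1\ \forall w\in C\}$. Curves are considered up to reparametrization. *)

theory Defs
  imports "HOL-Analysis.Analysis"
begin

text \<open>
  The plane is \<^typ>\<open>complex\<close>, a Euclidean space whose inner product, norm and Lebesgue
  measure are those of pairs \<open>(u, v)\<close> of reals.  A function on the circle of angles is a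
  \<open>2\<pi>\<close>-periodic function on the reals.
\<close>

definition Omega :: "(real \<Rightarrow> real) \<Rightarrow> complex set" where
  "Omega P = {w. norm w * P (Arg w) \<le> 1}"

definition minkowski :: "complex set \<Rightarrow> complex \<Rightarrow> real" where
  "minkowski S w = Inf {r. r > 0 \<and> w \<in> (\<lambda>z. r *\<^sub>R z) ` S}"

definition polar_set :: "complex set \<Rightarrow> complex set" where
  "polar_set C = {p. \<forall>w\<in>C. p \<bullet> w \<le> 1}"

definition convex_body :: "complex set \<Rightarrow> bool" where
  "convex_body B \<longleftrightarrow> compact B \<and> convex B"

text \<open>At a regular boundary point there is exactly one unit normal; at the remaining
  points the value is unspecified.\<close>

definition outward_normal :: "complex set \<Rightarrow> complex \<Rightarrow> complex" where
  "outward_normal B \<xi> = (THE n. norm n = 1 \<and> (\<forall>x\<in>B. (x - \<xi>) \<bullet> n \<le> 0))"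

definition closed_lipschitz_curve :: "(real \<Rightarrow> complex) \<Rightarrow> bool" where
  "closed_lipschitz_curve \<gamma> \<longleftrightarrow> (\<exists>L. L-lipschitz_on {0..1} \<gamma>) \<and> \<gamma> 0 = \<gamma> 1"

text \<open>Lipschitz curves are differentiable only almost everywhere; where they are not,
  \<^const>\<open>vector_derivative\<close> is unspecified, which does not affect any of the integrals below.\<close>

definition line_integral :: "(complex \<Rightarrow> real) \<Rightarrow> (real \<Rightarrow> complex) \<Rightarrow> real" where
  "line_integral f \<gamma> = integral {0..1} (\<lambda>t. f (\<gamma> t) * norm (vector_derivative \<gamma> (at t)))"

definition simple_boundary_loop :: "(real \<Rightarrow> complex) \<Rightarrow> complex set \<Rightarrow> bool" where
  "simple_boundary_loop \<gamma> B \<longleftrightarrow>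
     closed_lipschitz_curve \<gamma> \<and> simple_path \<gamma> \<and> path_image \<gamma> = frontier B"

text \<open>Integration against the length element of the boundary. The boundary of a convex body
  of positive area is the image of a simple closed Lipschitz curve, and the line integral
  with respect to arc length is the same for all such curves.\<close>

definition boundary_integral :: "(complex \<Rightarrow> real) \<Rightarrow> complex set \<Rightarrow> real" where
  "boundary_integral f B = line_integral f (SOME \<gamma>. simple_boundary_loop \<gamma> B)"

definition body_energy :: "(real \<Rightarrow> real) \<Rightarrow> complex set \<Rightarrow> real" where
  "body_energy P B = boundary_integral (\<lambda>\<xi>. P (Arg (outward_normal B \<xi>))) B"

definition optimal_body :: "(real \<Rightarrow> real) \<Rightarrow> real \<Rightarrow> complex set \<Rightarrow> bool" where
  "optimal_body P A B \<longleftrightarrow>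
     convex_body B \<and> measure lebesgue B = A \<and>
     (\<forall>B'. convex_body B' \<and> measure lebesgue B' = A \<longrightarrow> body_energy P B \<le> body_energy P B')"

definition signed_area :: "(real \<Rightarrow> complex) \<Rightarrow> real" where
  "signed_area \<gamma> = 1 / 2 * integral {0..1} (\<lambda>t.
     Re (\<gamma> t) * Im (vector_derivative \<gamma> (at t)) - Im (\<gamma> t) * Re (vector_derivative \<gamma> (at t)))"

definition curve_energy :: "complex set \<Rightarrow> (real \<Rightarrow> complex) \<Rightarrow> real" where
  "curve_energy S \<gamma> = integral {0..1} (\<lambda>t. minkowski S
     (Complex (Im (vector_derivative \<gamma> (at t))) (- Re (vector_derivative \<gamma> (at t)))))"

definition optimal_curve :: "(real \<Rightarrow> real) \<Rightarrow> real \<Rightarrow> (real \<Rightarrow> complex) \<Rightarrow> bool" where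
  "optimal_curve P A \<gamma> \<longleftrightarrow>
     closed_lipschitz_curve \<gamma> \<and> signed_area \<gamma> = A \<and>
     (\<forall>\<gamma>'. closed_lipschitz_curve \<gamma>' \<and> signed_area \<gamma>' = A \<longrightarrow>
        curve_energy (Omega P) \<gamma> \<le> curve_energy (Omega P) \<gamma>')"

text \<open>A reparametrization may stop (so it is only weakly monotone) but not go backwards;
  it fixes the end points, a change of base point being absorbed in the choice of the loop.\<close>

definition reparametrization_of :: "(real \<Rightarrow> complex) \<Rightarrow> (real \<Rightarrow> complex) \<Rightarrow> bool" where
  "reparametrization_of \<gamma> \<beta> \<longleftrightarrow>
     (\<exists>\<phi>::real \<Rightarrow> real. continuous_on {0..1} \<phi> \<and> mono_on {0..1} \<phi> \<and> \<phi> 0 = 0 \<and> \<phi> 1 = 1 \<and>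
        (\<forall>t\<in>{0..1}. \<gamma> t = \<beta> (\<phi> t)))"

text \<open>\<open>\<gamma>\<close> runs once counterclockwise (positive signed area) along the boundary of \<open>B\<close>, and
  \<open>B\<close> is the closed region enclosed by it.  Convexity of \<open>B\<close> is not required; the condition on
  the inside is there because \<open>B\<close> and its boundary curve have the same frontier.\<close>

definition boundary_curve :: "(real \<Rightarrow> complex) \<Rightarrow> complex set \<Rightarrow> bool" where
  "boundary_curve \<gamma> B \<longleftrightarrow>
     closed_lipschitz_curve \<gamma> \<and> 0 < signed_area \<gamma> \<and>
     (\<exists>\<beta>. simple_boundary_loop \<beta> B \<and> reparametrization_of \<gamma> \<beta>) \<and>
     B = frontier B \<union> inside (frontier B)"

end

theory Submission
  imports Defs
begin

text \<open>
  Write \<open>tension w = norm w * P (Arg w)\<close>, which is the Minkowski function of \<open>\<Omega>\<close>.  The polar set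
  of \<open>conv \<Omega>\<close> is the Wulff shape \<open>W = {x. \<forall>w. x \<bullet> w \<le> tension w}\<close>; it is compact and convex, it has
  interior points because \<open>P\<close> vanishes only inside an open half plane of directions, and its
  support function \<open>h\<close> satisfies \<open>h \<le> tension\<close>.  Along a curve \<open>\<gamma>\<close> with velocity \<open>v\<close> the vector
  \<open>u = - \<i> * v\<close> is the velocity turned clockwise, that is, the outward normal times the speed if
  \<open>\<gamma>\<close> is the counterclockwise boundary of a body.  So both problems minimize
  \<open>\<integral> tension u\<close>, and \<open>E = \<integral> h u\<close> is a lower bound.

  The inequality \<open>E\<^sup>2 \<ge> 4 |W| A\<close> for every closed Lipschitz curve of signed area \<open>A > 0\<close>
  (\<open>isoperimetric_inequality\<close>) is proved by E. Schmidt's method.  Rescale so that \<open>\<gamma>\<close> and \<open>W\<close>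
  have the same projection to the real axis.  Replace the point \<open>\<gamma> t\<close> by the point \<open>F t\<close> of
  the boundary of \<open>W\<close> with the same real part, on the lower boundary of \<open>W\<close> between the times at
  which \<open>\<gamma>\<close> is leftmost and rightmost, and on the upper boundary otherwise.  Since \<open>F t \<in> W\<close>,
  \<open>h u \<ge> F \<bullet> u\<close>, and the integral of \<open>F \<bullet> u\<close> is \<open>A + |W|\<close> whatever the shape of \<open>\<gamma>\<close>.

  If equality holds, \<open>E\<^sup>2 - 4 |W| A\<close> is minimal at \<open>\<gamma>\<close>.  As \<open>E\<close> is convex and \<open>A\<close> quadratic,
  moving from \<open>\<gamma>\<close> towards another closed curve \<open>\<eta>\<close> gives a linear inequality for \<open>\<eta>\<close>
  (\<open>isoperimetric_first_variation\<close>).  Curves \<open>\<eta>\<close> that move only near three given times turn it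
  into a condition on three points of \<open>\<gamma>\<close>, and by Helly's theorem these conditions mean that
  \<open>\<gamma>\<close> lies in a translate \<open>K\<close> of a multiple of \<open>W\<close> that has area \<open>A\<close>
  (\<open>isoperimetric_equality_inscribed\<close>).  Then \<open>\<gamma> \<bullet> u\<close> equals the support function of \<open>K\<close> at
  \<open>u\<close> for almost all times, so \<open>\<gamma>\<close> runs along the boundary of \<open>K\<close>, its angle seen from an
  interior point never decreases, and by its area it goes around exactly once
  (\<open>tangential_curve_winds_once\<close>).

  Conversely, a curve that winds once around a convex body \<open>B\<close> has signed area \<open>|B|\<close>
  (\<open>winds_once_area\<close>) and almost everywhere the unique normal \<open>u\<close> (\<open>winds_once_normal\<close>), so the
  energy of \<open>B\<close> is that of its boundary curve.  At each boundary point of \<open>W\<close> some normal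
  is a direction with \<open>h = tension\<close> (\<open>wulff_contact\<close>), so copies of \<open>W\<close> attain the lower bound.

  All this needs that Lipschitz functions are differentiable almost everywhere and satisfy the
  fundamental theorem of calculus (\<open>lipschitz_ftc\<close>).  A density comes from Radon-Nikodym, and
  Vitali coverings show that it is the derivative.
\<close>

section \<open>Differentiability of Lipschitz functions almost everywhere\<close>

text \<open>Inside an open set \<open>U\<close> that is hardly larger than \<open>S\<close>, disjoint intervals of the given kind
  cover almost all of \<open>S\<close> (Vitali), so the outer measure of \<open>S\<close> is at most \<open>e\<close> times the measure
  of \<open>U\<close>, hence at most \<open>e\<close> times itself.  The argument works with outer measure because the sets
  of points at which difference quotients misbehave are not known to be measurable.\<close>

lemma negligible_if_sparse_intervals:
  fixes S A :: "real set"
  assumes A: "A \<in> sets lebesgue" and SA: "S \<subseteq> A" and e: "e < 1"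
    and cov: "\<And>x r. x \<in> S \<Longrightarrow> 0 < r \<Longrightarrow>
      \<exists>a d. 0 < d \<and> d < r \<and> x \<in> cball a d \<and> measure lebesgue (A \<inter> cball a d) \<le> e * (2 * d)"
  shows "negligible S"
proof -
  have bdd: "negligible S" if bS: "bounded S" and SA: "S \<subseteq> A"
    and cov: "\<And>x r. x \<in> S \<Longrightarrow> 0 < r \<Longrightarrow>
      \<exists>a d. 0 < d \<and> d < r \<and> x \<in> cball a d \<and> measure lebesgue (A \<inter> cball a d) \<le> e * (2 * d)" for S
  proof (cases "S = {}")
    case False
    then obtain x where "x \<in> S" by blast
    from cov[OF this, of 1] obtain a d where "0 < d" "measure lebesgue (A \<inter> cball a d) \<le> e * (2 * d)"
      by auto
    then have "0 \<le> e * (2 * d)" using measure_nonneg order_trans by blast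
    with \<open>0 < d\<close> have e0: "0 \<le> e" by (simp add: zero_le_mult_iff)
    let ?m = "measure lebesgue"
    define X where "X = {?m T | T. T \<in> lmeasurable \<and> S \<subseteq> T}"
    obtain a0 b0 where "S \<subseteq> cbox a0 b0" using bS bounded_subset_cbox_symmetric by blast
    then have Xne: "X \<noteq> {}" unfolding X_def by (auto intro: exI[of _ "cbox a0 b0"])
    have Xb: "bdd_below X" unfolding X_def by (auto intro!: bdd_belowI[of _ 0])
    define m where "m = Inf X"
    have m0: "0 \<le> m" unfolding m_def by (rule cInf_greatest[OF Xne]) (auto simp: X_def)
    have mle: "m \<le> ?m T" if "T \<in> lmeasurable" "S \<subseteq> T" for T
      unfolding m_def by (rule cInf_lower[OF _ Xb]) (use that in \<open>auto simp: X_def\<close>)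
    have step: "m \<le> e * ?m U" if "open U" "U \<in> lmeasurable" "S \<subseteq> U" for U
    proof -
      define K where "K = {(a,d). 0 < d \<and> cball a d \<subseteq> U \<and> ?m (A \<inter> cball a d) \<le> e * (2 * d)}"
      obtain C where C: "countable C" "C \<subseteq> K"
        and pw: "pairwise (\<lambda>i j. disjnt (cball (fst i) (snd i)) (cball (fst j) (snd j))) C"
        and neg: "negligible (S - (\<Union>i \<in> C. cball (fst i) (snd i)))"
      proof (rule Vitali_covering_theorem_cballs[of K snd S fst])
        show "0 < snd i" if "i \<in> K" for i using that by (auto simp: K_def)
        fix x d :: real assume x: "x \<in> S" and d: "0 < d"
        with \<open>open U\<close> obtain k where k: "0 < k" "ball x k \<subseteq> U"
          using \<open>S \<subseteq> U\<close> by (meson openE subsetD)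
        obtain a r where r: "0 < r" "r < min d (k/2)" "x \<in> cball a r" "?m (A \<inter> cball a r) \<le> e * (2 * r)"
          using cov[OF x, of "min d (k/2)"] d k by auto
        have "cball a r \<subseteq> ball x k"
        proof
          fix z assume "z \<in> cball a r"
          with r show "z \<in> ball x k" by (auto simp: dist_real_def)
        qed
        then show "\<exists>i. i \<in> K \<and> x \<in> cball (fst i) (snd i) \<and> snd i < d"
          using r k by (intro exI[of _ "(a,r)"]) (auto simp: K_def)
      qed
      have Um: "A \<inter> cball (fst i) (snd i) \<in> lmeasurable" for i
        by (metis A fmeasurable_Int_fmeasurable inf_commute lmeasurable_cball)
      have lee: "?m (\<Union>i\<in>I. A \<inter> cball (fst i) (snd i)) \<le> e * ?m U" if I: "I \<subseteq> C" "finite I" for I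
      proof -
        have "?m (\<Union>i\<in>I. A \<inter> cball (fst i) (snd i)) \<le> (\<Sum>i\<in>I. ?m (A \<inter> cball (fst i) (snd i)))"
          using that Um by (blast intro: measure_UNION_le)
        also have "\<dots> \<le> (\<Sum>i\<in>I. e * ?m (cball (fst i) (snd i)))"
        proof (rule sum_mono)
          fix i assume "i \<in> I"
          then have "i \<in> K" using I C by blast
          then show "?m (A \<inter> cball (fst i) (snd i)) \<le> e * ?m (cball (fst i) (snd i))"
            by (auto simp: K_def cball_eq_atLeastAtMost split: prod.splits)
        qed
        also have "\<dots> = e * (\<Sum>i\<in>I. ?m (cball (fst i) (snd i)))" by (simp add: sum_distrib_left)
        also have "(\<Sum>i\<in>I. ?m (cball (fst i) (snd i))) = ?m (\<Union>i\<in>I. cball (fst i) (snd i))"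
          by (subst measure_UNION') (use that pw in \<open>auto elim: pairwise_mono\<close>)
        also have "e * \<dots> \<le> e * ?m U"
        proof (rule mult_left_mono[OF _ e0], rule measure_mono_fmeasurable)
          show "(\<Union>i\<in>I. cball (fst i) (snd i)) \<subseteq> U" using I C by (force simp: K_def)
        qed (use \<open>U \<in> lmeasurable\<close> \<open>finite I\<close> in auto)
        finally show ?thesis .
      qed
      have UN: "(\<Union>i\<in>C. A \<inter> cball (fst i) (snd i)) \<in> lmeasurable"
               "?m (\<Union>i\<in>C. A \<inter> cball (fst i) (snd i)) \<le> e * ?m U"
        using fmeasurable_UN_bound[OF C(1) Um lee] measure_UN_bound[OF C(1) Um lee] by blast+
      let ?T = "(S - (\<Union>i \<in> C. cball (fst i) (snd i))) \<union> (\<Union>i\<in>C. A \<inter> cball (fst i) (snd i))"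
      have "?T \<in> lmeasurable" using UN neg by (simp add: fmeasurable.Un negligible_imp_measurable)
      moreover have "S \<subseteq> ?T" using SA by auto
      ultimately have "m \<le> ?m ?T" by (rule mle)
      also have "?m ?T = ?m (\<Union>i\<in>C. A \<inter> cball (fst i) (snd i))"
      proof (rule measure_negligible_symdiff[OF UN(1)])
        show "negligible (((\<Union>i\<in>C. A \<inter> cball (fst i) (snd i)) - ?T) \<union> (?T - (\<Union>i\<in>C. A \<inter> cball (fst i) (snd i))))"
          by (rule negligible_subset[OF neg]) blast
      qed
      finally show ?thesis using UN(2) by linarith
    qed
    have "m \<le> e * m + \<eta>" if "0 < \<eta>" for \<eta>
    proof -
      obtain T where T: "T \<in> lmeasurable" "S \<subseteq> T" "?m T < m + \<eta>/2"
      proof -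
        have "\<exists>y\<in>X. y < m + \<eta>/2"
          using cInf_lessD[OF Xne, of "m + \<eta>/2"] \<open>0 < \<eta>\<close> unfolding m_def by auto
        then show ?thesis using that by (auto simp: X_def)
      qed
      obtain U where U0: "open U" "T \<subseteq> U" "U - T \<in> lmeasurable" "emeasure lebesgue (U - T) < ennreal (\<eta>/2)"
        using sets_lebesgue_outer_open[of T "\<eta>/2"] T(1) \<open>0 < \<eta>\<close> by (metis fmeasurableD half_gt_zero)
      then have "?m (U - T) < \<eta>/2"
        using \<open>0 < \<eta>\<close> by (simp add: emeasure_eq_measure2 ennreal_less_iff)
      moreover have Ueq: "U = T \<union> (U - T)" using U0 by blast
      then have "U \<in> lmeasurable" using T(1) U0(3) by (metis fmeasurable.Un)
      moreover have "?m U \<le> ?m T + ?m (U - T)"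
        using Ueq T(1) U0(3) by (metis fmeasurableD measure_Un_le)
      ultimately have U: "open U" "T \<subseteq> U" "U \<in> lmeasurable" "?m U < ?m T + \<eta>/2"
        using U0 by auto
      have "m \<le> e * ?m U" using step U T by auto
      also have "\<dots> \<le> e * (m + \<eta>)" using U T e0 by (intro mult_left_mono) auto
      also have "\<dots> \<le> e * m + \<eta>" using e that mult_right_mono[of e 1 \<eta>] by (simp add: algebra_simps)
      finally show ?thesis .
    qed
    then have "m \<le> e * m" by (rule field_le_epsilon)
    then have "m = 0" using mult_strict_right_mono[OF e, of m] m0 by linarith
    show ?thesis unfolding negligible_outer_le
    proof (intro allI impI)
      fix \<eta> :: real assume "0 < \<eta>"
      then have "\<exists>y\<in>X. y < m + \<eta>"
        using cInf_lessD[OF Xne, of "m + \<eta>"] unfolding m_def by auto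
      then show "\<exists>T. S \<subseteq> T \<and> T \<in> lmeasurable \<and> ?m T \<le> \<eta>"
        using \<open>m = 0\<close> unfolding X_def by (auto intro: less_imp_le)
    qed
  qed auto
  have neg: "negligible (S \<inter> ball 0 (real n))" for n :: nat
  proof (rule bdd)
    show "bounded (S \<inter> ball 0 (real n))" by (simp add: bounded_Int)
    show "S \<inter> ball 0 (real n) \<subseteq> A" using SA by blast
    show "\<exists>a d. 0 < d \<and> d < r \<and> x \<in> cball a d \<and> measure lebesgue (A \<inter> cball a d) \<le> e * (2 * d)"
      if "x \<in> S \<inter> ball 0 (real n)" "0 < r" for x r
      using cov[of x r] that by simp
  qed
  have "negligible (\<Union>n::nat. S \<inter> ball 0 (real n))"
    by (intro negligible_countable_Union) (use neg in auto)
  moreover have "S \<subseteq> (\<Union>n::nat. S \<inter> ball 0 (real n))"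
  proof
    fix x assume "x \<in> S"
    moreover obtain n :: nat where "\<bar>x\<bar> < real n" using reals_Archimedean2 by blast
    ultimately show "x \<in> (\<Union>n::nat. S \<inter> ball 0 (real n))" by auto
  qed
  ultimately show ?thesis by (rule negligible_subset)
qed

text \<open>The measure that assigns to a set the length of its image under \<open>F\<close> is the distribution of the
  inverse of \<open>F\<close>.  It is absolutely continuous because Lipschitz maps preserve null sets, so
  Radon-Nikodym provides a density.\<close>

lemma bilipschitz_density:
  fixes F :: "real \<Rightarrow> real"
  assumes c: "0 < c" and lower: "\<And>x y. x \<le> y \<Longrightarrow> c * (y - x) \<le> F y - F x"
    and upper: "\<And>x y. x \<le> y \<Longrightarrow> F y - F x \<le> C * (y - x)"
  obtains g :: "real \<Rightarrow> ennreal" where "g \<in> borel_measurable borel"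
    "\<And>x y. x \<le> y \<Longrightarrow> emeasure (density lborel g) {x<..<y} = ennreal (F y - F x)"
proof -
  have mono: "F x < F y \<longleftrightarrow> x < y" for x y
    using lower[of x y] lower[of y x] c by (smt (verit) mult_pos_pos)
  have C0: "0 \<le> C" using lower[of 0 1] upper[of 0 1] c by auto
  have lipF: "\<bar>F x - F y\<bar> \<le> C * \<bar>x - y\<bar>" for x y
    using lower[of x y] lower[of y x] upper[of x y] upper[of y x] mono[of x y] mono[of y x]
    by (cases "x \<le> y") (auto simp: abs_if)
  have "C-lipschitz_on UNIV F" using lipF C0 by (auto simp: lipschitz_on_def dist_real_def)
  then have contF: "continuous_on UNIV F" by (rule lipschitz_on_continuous_on)
  have surj: "surj F"
  proof -
    have "\<exists>x. F x = y" for y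
    proof -
      define R where "R = \<bar>y - F 0\<bar> / c"
      have R: "0 \<le> R" "c * R = \<bar>y - F 0\<bar>" using c by (auto simp: R_def)
      have "F (-R) \<le> y" "y \<le> F R"
        using lower[of "-R" 0] lower[of 0 R] R by (auto simp: abs_if split: if_splits)
      then show ?thesis using IVT'[of F "-R" y R] continuous_on_subset[OF contF subset_UNIV] R by auto
    qed
    then show ?thesis by (metis surjI)
  qed
  have inj: "inj F" using mono by (metis injI less_irrefl linorder_neqE)
  define H where "H = inv F"
  have HF: "H (F x) = x" "F (H y) = y" for x y
    using inj surj by (auto simp: H_def surj_f_inv_f)
  have monoH: "H x < H y \<longleftrightarrow> x < y" for x y using mono[of "H x" "H y"] HF by simp
  have vim: "H -` B = F ` B" for B
  proof (intro equalityI subsetI)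
    fix y assume "y \<in> H -` B" then show "y \<in> F ` B" using HF(2)[of y] by (metis image_eqI vimageE)
  qed (auto simp: HF)
  have Hm: "H \<in> borel_measurable borel"
    by (rule borel_measurable_mono) (use monoH in \<open>auto simp: mono_def le_less_linear not_less[symmetric]\<close>)
  define \<mu> where "\<mu> = distr lborel borel H"
  have em: "emeasure \<mu> B = emeasure lborel (F ` B)" if "B \<in> sets borel" for B
    using that Hm by (simp add: \<mu>_def emeasure_distr vim)
  have ac: "absolutely_continuous lborel \<mu>"
    unfolding absolutely_continuous_def
  proof
    fix B :: "real set" assume B: "B \<in> null_sets lborel"
    then have "negligible B" using negligible_iff_null_sets null_sets_completionI by blast
    then have "negligible (F ` B)"
    proof (rule negligible_locally_Lipschitz_image[rotated])
      fix x show "\<exists>T Ba. open T \<and> x \<in> T \<and> (\<forall>y\<in>B \<inter> T. norm (F y - F x) \<le> Ba * norm (y - x))"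
        using lipF by (intro exI[of _ UNIV] exI[of _ C]) auto
    qed simp
    moreover have Bb: "B \<in> sets borel" using B by auto
    moreover have "F ` B \<in> sets borel"
      using measurable_sets[OF Hm, of B] Bb vim by auto
    ultimately show "B \<in> null_sets \<mu>"
      using em[OF Bb] by (simp add: null_sets_def \<mu>_def negligible_iff_null_sets emeasure_completion)
  qed
  have "density lborel (RN_deriv lborel \<mu>) = \<mu>"
    by (rule sigma_finite_measure.density_RN_deriv[OF _ ac]) (auto simp: \<mu>_def sigma_finite_lborel)
  moreover have "emeasure \<mu> {x<..<y} = ennreal (F y - F x)" if "x \<le> y" for x y
  proof -
    have "F ` {x<..<y} = {F x<..<F y}" 
    proof (intro equalityI subsetI)
      fix z assume z: "z \<in> {F x<..<F y}"
      then have "H z \<in> {x<..<y}" using mono[of x "H z"] mono[of "H z" y] HF by simp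
      then show "z \<in> F ` {x<..<y}" using HF(2)[of z] by (metis image_eqI)
    qed (auto simp: mono)
    then show ?thesis using em[of "{x<..<y}"] mono[of x y] that by (cases "x = y") auto
  qed
  ultimately show ?thesis
    by (intro that[of "RN_deriv lborel \<mu>"]) auto
qed

text \<open>A multiple of the identity makes both \<open>f\<close> and \<open>- f\<close> bi-Lipschitz and increasing.  The two
  densities add up to a constant, which bounds each of them.\<close>

lemma lipschitz_density:
  fixes f :: "real \<Rightarrow> real"
  assumes lip: "L-lipschitz_on UNIV f"
  obtains g M where "g \<in> borel_measurable borel" "\<And>x. \<bar>g x\<bar> \<le> M"
    "\<And>x y. x \<le> y \<Longrightarrow> (g has_integral (f y - f x)) {x..y}"
proof -
  define K where "K = L + 1"
  have L: "0 \<le> L" using lip by (simp add: lipschitz_on_def)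
  have lipf: "\<bar>f y - f x\<bar> \<le> L * (y - x)" if "x \<le> y" for x y
    using lipschitz_onD[OF lip, of x y] that by (auto simp: dist_real_def abs_minus_commute)
  have est: "L * (y - x) \<le> K * (y - x)" if "x \<le> y" for x y
    using that by (simp add: K_def mult_right_mono)
  obtain g1 where g1: "g1 \<in> borel_measurable borel"
    "\<And>x y. x \<le> y \<Longrightarrow> emeasure (density lborel g1) {x<..<y} = ennreal ((f y + 2 * K * y) - (f x + 2 * K * x))"
  proof (rule bilipschitz_density[of K "\<lambda>x. f x + 2 * K * x" "3 * K"])
    fix x y :: real assume "x \<le> y"
    then show "K * (y - x) \<le> f y + 2 * K * y - (f x + 2 * K * x)" "f y + 2 * K * y - (f x + 2 * K * x) \<le> 3 * K * (y - x)"
      using lipf[of x y] est[of x y] by (auto simp: algebra_simps abs_le_iff)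
  qed (use L in \<open>auto simp: K_def\<close>)
  obtain g2 where g2: "g2 \<in> borel_measurable borel"
    "\<And>x y. x \<le> y \<Longrightarrow> emeasure (density lborel g2) {x<..<y} = ennreal ((2 * K * y - f y) - (2 * K * x - f x))"
  proof (rule bilipschitz_density[of K "\<lambda>x. 2 * K * x - f x" "3 * K"])
    fix x y :: real assume "x \<le> y"
    then show "K * (y - x) \<le> (2 * K * y - f y) - (2 * K * x - f x)" "(2 * K * y - f y) - (2 * K * x - f x) \<le> 3 * K * (y - x)"
      using lipf[of x y] est[of x y] by (auto simp: algebra_simps abs_le_iff)
  qed (use L in \<open>auto simp: K_def\<close>)
  note [measurable] = g1(1) g2(1)
  have K: "0 < K" using L by (simp add: K_def)
  define G where "G x = (g1 x + g2 x) * ennreal (1 / (4 * K))" for x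
  have Gm[measurable]: "G \<in> borel_measurable borel" unfolding G_def by measurable
  have "lborel = density lborel G"
  proof (rule lborel_eqI)
    fix l u :: real assume "\<And>b. b \<in> Basis \<Longrightarrow> l \<bullet> b \<le> u \<bullet> b"
    then have lu: "l \<le> u" by simp
    have "emeasure (density lborel G) {l<..<u} = (\<integral>\<^sup>+x. (g1 x * indicator {l<..<u} x + g2 x * indicator {l<..<u} x) * ennreal (1 / (4 * K)) \<partial>lborel)"
      by (subst emeasure_density) (auto simp: G_def intro!: nn_integral_cong split: split_indicator)
    also have "\<dots> = (emeasure (density lborel g1) {l<..<u} + emeasure (density lborel g2) {l<..<u}) * ennreal (1 / (4 * K))"
      by (subst nn_integral_multc) (auto simp: nn_integral_add emeasure_density)
    also have "emeasure (density lborel g1) {l<..<u} + emeasure (density lborel g2) {l<..<u} = ennreal (4 * K * (u - l))"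
    proof -
      have "0 \<le> f u + 2 * K * u - (f l + 2 * K * l)" "0 \<le> (2 * K * u - f u) - (2 * K * l - f l)"
        using lipf[OF lu] est[OF lu] K lu mult_nonneg_nonneg[of K "u - l"] by (auto simp: abs_le_iff algebra_simps)
      then show ?thesis using lu by (simp add: g1(2) g2(2) ennreal_plus[symmetric] algebra_simps del: ennreal_plus)
    qed
    also have "\<dots> * ennreal (1 / (4 * K)) = ennreal (u - l)"
      using K lu by (simp add: ennreal_mult[symmetric])
    finally show "emeasure (density lborel G) (box l u) = (\<Prod>b\<in>Basis. (u - l) \<bullet> b)"
      by (simp add: box_real)
  qed simp
  then have "density lborel (\<lambda>_. 1) = density lborel G" by (simp add: density_1)
  then have "AE x in lborel. 1 = G x"
    by (subst (asm) sigma_finite_measure.density_unique_iff[OF sigma_finite_lborel]) auto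
  then have AEg: "AE x in lborel. g1 x \<le> ennreal (4 * K)"
  proof eventually_elim
    case (elim x)
    show "g1 x \<le> ennreal (4 * K)"
    proof -
      have "g1 x \<le> (g1 x + g2 x) * (ennreal (1 / (4 * K)) * ennreal (4 * K))"
        using K by (simp add: ennreal_mult[symmetric])
      also have "\<dots> = G x * ennreal (4 * K)" unfolding G_def by (simp add: mult.assoc)
      finally show ?thesis using elim by simp
    qed
  qed
  define g0 where "g0 x = enn2real (min (g1 x) (ennreal (4 * K)))" for x
  define g where "g x = g0 x - 2 * K" for x
  have g0: "0 \<le> g0 x" "g0 x \<le> 4 * K" for x
    using K by (auto simp: g0_def intro!: enn2real_leI)
  have g0e: "ennreal (g0 x) = min (g1 x) (ennreal (4 * K))" for x
    unfolding g0_def by (rule ennreal_enn2real) (auto simp: min_less_iff_disj)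
  have [measurable]: "g0 \<in> borel_measurable borel" unfolding g0_def by measurable
  show ?thesis
  proof (rule that[of g "2 * K"])
    show "g \<in> borel_measurable borel" unfolding g_def by measurable
    show "\<bar>g x\<bar> \<le> 2 * K" for x using g0[of x] by (auto simp: g_def)
    fix x y :: real assume xy: "x \<le> y"
    let ?d = "f y + 2 * K * y - (f x + 2 * K * x)"
    have d0: "0 \<le> ?d"
        using lipf[OF xy] est[OF xy] K xy mult_nonneg_nonneg[of K "y - x"] by (auto simp: abs_le_iff algebra_simps)
    have "(\<integral>\<^sup>+t. ennreal (indicator {x<..<y} t * g0 t) \<partial>lborel) = (\<integral>\<^sup>+t. g1 t * indicator {x<..<y} t \<partial>lborel)"
      by (rule nn_integral_cong_AE) (use AEg in eventually_elim, auto simp: g0e min_def split: split_indicator)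
    also have "\<dots> = ennreal ?d" using g1(2)[OF xy] by (simp add: emeasure_density)
    finally have "((\<lambda>t. indicator {x<..<y} t * g0 t) has_integral ?d) UNIV"
      using g0 d0 by (intro nn_integral_has_integral) auto
    then have "((\<lambda>t. if t \<in> {x<..<y} then g0 t else 0) has_integral ?d) UNIV"
      by (rule has_integral_eq[rotated]) auto
    then have "(g0 has_integral ?d) {x<..<y}" by (simp only: has_integral_restrict_UNIV)
    then have "(g0 has_integral ?d) {x..y}"
      by (metis box_real has_integral_open_interval)
    moreover have "((\<lambda>t. 2 * K) has_integral (2 * K * (y - x))) {x..y}"
      using has_integral_const_real[of "2 * K" x y] xy by (simp add: mult.commute)
    ultimately have "(g has_integral (?d - 2 * K * (y - x))) {x..y}"
      unfolding g_def by (rule has_integral_diff)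
    then show "(g has_integral (f y - f x)) {x..y}" by (simp add: algebra_simps)
  qed
qed

text \<open>If a difference quotient of \<open>f\<close> over an interval exceeds \<open>q\<close>, then \<open>g\<close> exceeds \<open>p\<close> on a fixed
  proportion of that interval, because \<open>g\<close> is bounded.  So the set where \<open>g \<le> p\<close> is sparse in
  arbitrarily short intervals at each of the points considered.\<close>

lemma negligible_upper_derivate_exceeds:
  fixes f g :: "real \<Rightarrow> real"
  assumes g: "g \<in> borel_measurable borel" and bd: "\<And>x. \<bar>g x\<bar> \<le> M"
    and fg: "\<And>x y. x \<le> y \<Longrightarrow> (g has_integral (f y - f x)) {x..y}" and pq: "p < q"
  shows "negligible {x. g x \<le> p \<and> (\<forall>r>0. \<exists>y. y \<noteq> x \<and> \<bar>y - x\<bar> < r \<and> q < (f y - f x) / (y - x))}" (is "negligible ?S")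
proof -
  define B where "B = max M (q + 1)"
  have B: "p < B" "q < B" "\<And>x. g x \<le> B" using bd pq by (auto simp: B_def abs_le_iff le_max_iff_disj)
  define A where "A = {x. g x \<le> p}"
  have Ab: "A \<in> sets borel" unfolding A_def using g by measurable
  show ?thesis
  proof (rule negligible_if_sparse_intervals[of A _ "(B - q) / (B - p)"])
    show "A \<in> sets lebesgue" using Ab by simp
    show "?S \<subseteq> A" by (auto simp: A_def)
    show "(B - q) / (B - p) < 1" using B pq by (simp add: field_simps)
    fix x r :: real assume x: "x \<in> ?S" and r: "0 < r"
    then obtain y where y: "y \<noteq> x" "\<bar>y - x\<bar> < r" "q < (f y - f x) / (y - x)" by blast
    define l u where "l = min x y" and "u = max x y"
    have lu: "l < u" "q < (f u - f l) / (u - l)" "u - l = \<bar>y - x\<bar>"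
      using y by (auto simp: l_def u_def min_def max_def divide_simps algebra_simps split: if_splits)
    define d where "d = (u - l) / 2"
    have cb: "cball ((l + u) / 2) d = {l..u}" by (simp add: cball_eq_atLeastAtMost d_def field_simps)
    have mA: "A \<inter> {l..u} \<in> lmeasurable" using Ab
      by (metis fmeasurable_Int_fmeasurable inf_commute lmeasurable_interval(1) lmeasurable_cbox cbox_interval sets_completionI_sets sets_lborel)
    have "((\<lambda>t. B - (B - p) * indicator (A \<inter> {l..u}) t) has_integral (B * (u - l) - (B - p) * measure lebesgue (A \<inter> {l..u}))) {l..u}"
    proof (intro has_integral_diff has_integral_mult_right)
      show "((\<lambda>t. B) has_integral B * (u - l)) {l..u}"
        using has_integral_const_real[of B l u] lu by (simp add: mult.commute)
      have "(indicat_real (A \<inter> {l..u}) has_integral measure lebesgue (A \<inter> {l..u})) UNIV"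
        using mA by (simp add: lmeasurable_iff_has_integral)
      then have "((\<lambda>t. if t \<in> {l..u} then indicat_real (A \<inter> {l..u}) t else 0) has_integral measure lebesgue (A \<inter> {l..u})) UNIV"
        by (rule has_integral_eq[rotated]) (auto split: split_indicator)
      then show "(indicat_real (A \<inter> {l..u}) has_integral measure lebesgue (A \<inter> {l..u})) {l..u}"
        by (simp only: has_integral_restrict_UNIV)
    qed
    then have "f u - f l \<le> B * (u - l) - (B - p) * measure lebesgue (A \<inter> {l..u})"
    proof (rule has_integral_le[OF fg[of l u], rotated])
      fix t assume "t \<in> {l..u}"
      then show "g t \<le> B - (B - p) * indicator (A \<inter> {l..u}) t"
        using B by (auto simp: A_def split: split_indicator)
    qed (use lu in auto)
    moreover have "q * (u - l) < f u - f l" using lu by (simp add: field_simps)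
    ultimately have "(B - p) * measure lebesgue (A \<inter> {l..u}) \<le> (B - q) * (u - l)"
      by (simp add: algebra_simps)
    then have "measure lebesgue (A \<inter> cball ((l + u) / 2) d) \<le> (B - q) / (B - p) * (2 * d)"
      using B unfolding cb by (simp add: d_def field_simps)
    moreover have "x \<in> cball ((l + u) / 2) d" unfolding cb by (auto simp: l_def u_def)
    moreover have "0 < d" "d < r" using lu y by (auto simp: d_def)
    ultimately show "\<exists>a d. 0 < d \<and> d < r \<and> x \<in> cball a d \<and> measure lebesgue (A \<inter> cball a d) \<le> (B - q) / (B - p) * (2 * d)"
      by blast
  qed
qed

text \<open>The preceding lemma for \<open>f\<close> and for \<open>- f\<close> bounds the upper and lower derivates by \<open>g\<close>, off
  countably many null sets indexed by pairs of rational numbers.\<close>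

lemma indefinite_integral_ae_derivative:
  fixes f g :: "real \<Rightarrow> real"
  assumes g: "g \<in> borel_measurable borel" and bd: "\<And>x. \<bar>g x\<bar> \<le> M"
    and fg: "\<And>x y. x \<le> y \<Longrightarrow> (g has_integral (f y - f x)) {x..y}"
  shows "negligible {x. \<not> (f has_real_derivative g x) (at x)}"
proof -
  define S where "S g f p q = {x::real. g x \<le> p \<and> (\<forall>r>0. \<exists>y. y \<noteq> x \<and> \<bar>y - x\<bar> < r \<and> q < (f y - f x) / (y - x))}"
    for g f :: "real \<Rightarrow> real" and p q :: real
  let ?N = "\<Union>(p,q)\<in>{(p,q). p \<in> \<rat> \<and> q \<in> \<rat> \<and> p < q}. S g f p q \<union> S (\<lambda>x. - g x) (\<lambda>x. - f x) p q"
  have nS: "negligible (S g f p q)" if "p < q" for p q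
    unfolding S_def by (rule negligible_upper_derivate_exceeds[OF g bd fg that])
  have nS': "negligible (S (\<lambda>x. - g x) (\<lambda>x. - f x) p q)" if "p < q" for p q
    unfolding S_def
  proof (rule negligible_upper_derivate_exceeds[OF _ _ _ that])
    show "((\<lambda>x. - g x) has_integral - f y - - f x) {x..y}" if "x \<le> y" for x y
      using has_integral_neg[OF fg[OF that]] by simp
  qed (use g bd in auto)
  have "countable {(p,q). p \<in> \<rat> \<and> q \<in> \<rat> \<and> p < (q::real)}"
    by (rule countable_subset[of _ "\<rat> \<times> \<rat>"]) (auto intro: countable_rat)
  then have "negligible ?N"
    using nS nS' by (intro negligible_countable_Union countable_image) auto
  moreover have "{x. \<not> (f has_real_derivative g x) (at x)} \<subseteq> ?N"
  proof (rule subsetI, rule ccontr)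
    fix x assume x: "x \<in> {x. \<not> (f has_real_derivative g x) (at x)}" and xN: "x \<notin> ?N"
    have one: "\<exists>r>0. \<forall>y. y \<noteq> x \<and> \<bar>y - x\<bar> < r \<longrightarrow> (f' y - f' x) / (y - x) < g' x + e"
      if e: "0 < e" and no: "\<And>p q. p \<in> \<rat> \<Longrightarrow> q \<in> \<rat> \<Longrightarrow> p < q \<Longrightarrow> x \<notin> S g' f' p q" for e and f' g' :: "real \<Rightarrow> real"
    proof -
      obtain p where p: "p \<in> \<rat>" "g' x < p" "p < g' x + e" using Rats_dense_in_real[of "g' x" "g' x + e"] e by auto
      obtain q where q: "q \<in> \<rat>" "p < q" "q < g' x + e" using Rats_dense_in_real[of p "g' x + e"] p by auto
      have "x \<notin> S g' f' p q" by (rule no) (use p q in auto)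
      then obtain r where "0 < r" "\<And>y. y \<noteq> x \<Longrightarrow> \<bar>y - x\<bar> < r \<Longrightarrow> (f' y - f' x) / (y - x) \<le> q"
        unfolding S_def using p by (auto simp: not_less) (metis not_less)
      then show ?thesis using q by (intro exI[of _ r]) (auto intro: le_less_trans)
    qed
    have "(f has_real_derivative g x) (at x)"
      unfolding has_field_derivative_iff tendsto_iff dist_real_def
    proof (intro allI impI)
      fix e :: real assume e: "0 < e"
      obtain r1 where r1: "0 < r1" "\<forall>y. y \<noteq> x \<and> \<bar>y - x\<bar> < r1 \<longrightarrow> (f y - f x) / (y - x) < g x + e"
        using one[OF e, of g f] xN by auto
      obtain r2 where r2: "0 < r2" "\<forall>y. y \<noteq> x \<and> \<bar>y - x\<bar> < r2 \<longrightarrow> (- f y - - f x) / (y - x) < - g x + e"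
        using one[OF e, of "\<lambda>x. - g x" "\<lambda>x. - f x"] xN by auto
      show "\<forall>\<^sub>F y in at x. \<bar>(f y - f x) / (y - x) - g x\<bar> < e"
        unfolding eventually_at dist_real_def
      proof (intro exI[of _ "min r1 r2"] conjI ballI impI)
        fix y assume y: "y \<noteq> x \<and> \<bar>y - x\<bar> < min r1 r2"
        have "(- f y - - f x) / (y - x) = - ((f y - f x) / (y - x))" by (simp add: minus_divide_left)
        then show "\<bar>(f y - f x) / (y - x) - g x\<bar> < e"
          using r1 r2 y by (smt (verit))
      qed (use r1 r2 in auto)
    qed
    with x show False by simp
  qed
  ultimately show ?thesis by (rule negligible_subset)
qed

lemma lipschitz_interval_density:
  fixes f :: "real \<Rightarrow> real"
  assumes lip: "L-lipschitz_on {a..b} f" and ab: "a \<le> b"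
  obtains g M where "g \<in> borel_measurable borel" "\<And>x. \<bar>g x\<bar> \<le> M"
    "\<And>x y. a \<le> x \<Longrightarrow> x \<le> y \<Longrightarrow> y \<le> b \<Longrightarrow> (g has_integral (f y - f x)) {x..y}"
    "negligible {x\<in>{a<..<b}. \<not> (f has_real_derivative g x) (at x)}"
proof -
  define F where "F x = f (max a (min b x))" for x
  have F_eq: "F x = f x" if "x \<in> {a..b}" for x using that by (auto simp: F_def)
  have "L-lipschitz_on UNIV F"
  proof (rule lipschitz_onI)
    fix x y :: real
    have "dist (F x) (F y) \<le> L * dist (max a (min b x)) (max a (min b y))"
      unfolding F_def using ab by (intro lipschitz_onD[OF lip]) auto
    also have "\<dots> \<le> L * dist x y"
      using lip by (intro mult_left_mono) (auto simp: dist_real_def lipschitz_on_def)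
    finally show "dist (F x) (F y) \<le> L * dist x y" .
  qed (use lip in \<open>auto simp: lipschitz_on_def\<close>)
  then obtain g M where g: "g \<in> borel_measurable borel" "\<And>x. \<bar>g x\<bar> \<le> M"
    "\<And>x y. x \<le> y \<Longrightarrow> (g has_integral (F y - F x)) {x..y}"
    by (rule lipschitz_density) blast
  show ?thesis
  proof (rule that[of g M])
    fix x y assume "a \<le> x" "x \<le> y" "y \<le> b"
    then show "(g has_integral (f y - f x)) {x..y}" using g(3)[of x y] F_eq by auto
  next
    show "negligible {x\<in>{a<..<b}. \<not> (f has_real_derivative g x) (at x)}"
    proof (rule negligible_subset[OF indefinite_integral_ae_derivative[OF g]], safe)
      fix x assume x: "x \<in> {a<..<b}" "\<not> (f has_real_derivative g x) (at x)" "(F has_real_derivative g x) (at x)"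
      have "(f has_real_derivative g x) (at x)"
        by (rule DERIV_cong_ev[THEN iffD1, OF refl _ refl x(3)])
           (use x(1) F_eq in \<open>auto intro!: eventually_nhds_in_open[of "{a<..<b}", THEN eventually_mono]\<close>)
      with x show False by simp
    qed
  qed (use g in auto)
qed

text \<open>Any function that is the derivative almost everywhere agrees with the density almost
  everywhere, so it may be integrated in its place.\<close>

lemma lipschitz_ftc:
  fixes f f' :: "real \<Rightarrow> real"
  assumes lip: "L-lipschitz_on {a..b} f"
    and N: "negligible N" "\<And>t. t \<in> {a<..<b} - N \<Longrightarrow> (f has_real_derivative f' t) (at t)"
    and st: "a \<le> s" "s \<le> t" "t \<le> b"
  shows "(f' has_integral (f t - f s)) {s..t}"
proof -
  have ab: "a \<le> b" using st by auto
  obtain g M where g: "\<And>x y. a \<le> x \<Longrightarrow> x \<le> y \<Longrightarrow> y \<le> b \<Longrightarrow> (g has_integral (f y - f x)) {x..y}"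
    and neg: "negligible {x\<in>{a<..<b}. \<not> (f has_real_derivative g x) (at x)}"
    using lipschitz_interval_density[OF lip ab] by metis
  show ?thesis
  proof (rule has_integral_spike[OF _ _ g[OF st]])
    show "negligible (N \<union> {x\<in>{a<..<b}. \<not> (f has_real_derivative g x) (at x)} \<union> {a,b})"
      using N(1) neg by (simp add: negligible_Un)
    fix x assume x: "x \<in> {s..t} - (N \<union> {x\<in>{a<..<b}. \<not> (f has_real_derivative g x) (at x)} \<union> {a,b})"
    with st have "x \<in> {a<..<b}" by auto
    with x N(2)[of x] show "f' x = g x" using DERIV_unique by blast
  qed
qed

section \<open>Velocities of Lipschitz curves\<close>

definition cross2 :: "complex \<Rightarrow> complex \<Rightarrow> real" where
  "cross2 z w = Re z * Im w - Im z * Re w"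

text \<open>The key to both functionals: the area form is an inner product with the velocity turned
  clockwise, and this is the vector at which support functions are evaluated.\<close>

lemma cross2_inner: "x \<bullet> (- \<i> * w) = cross2 x w"
  by (simp add: cross2_def inner_complex_def)

lemma bounded_bilinear_cross2: "bounded_bilinear cross2"
proof -
  have "bounded_bilinear (\<lambda>x w. x \<bullet> (- \<i> * w))"
    by (intro bounded_bilinear.comp[OF bounded_bilinear_inner] bounded_linear_ident bounded_linear_mult_right)
  then show ?thesis by (simp only: cross2_inner)
qed

interpretation cross2: bounded_bilinear cross2 by (rule bounded_bilinear_cross2)

lemma cross2_self [simp]: "cross2 z z = 0" by (simp add: cross2_def)

lemma cross2_commute: "cross2 z w = - cross2 w z" by (simp add: cross2_def)

text \<open>A curve is treated together with a bounded Borel function that is its derivative almost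
  everywhere.  Unlike \<^const>\<open>vector_derivative\<close>, which is arbitrary where the curve is not
  differentiable, such a function can be added, scaled and cut off along with the curve.\<close>

definition has_velocity :: "(real \<Rightarrow> complex) \<Rightarrow> (real \<Rightarrow> complex) \<Rightarrow> bool" where
  "has_velocity \<gamma> v \<longleftrightarrow> (\<exists>L. L-lipschitz_on {0..1} \<gamma>) \<and> v \<in> borel_measurable borel \<and> bounded (range v)
     \<and> negligible {t\<in>{0<..<1}. \<not> (\<gamma> has_vector_derivative v t) (at t)}"

lemma has_velocityD:
  assumes "has_velocity \<gamma> v"
  shows "\<exists>L. L-lipschitz_on {0..1} \<gamma>" "v \<in> borel_measurable borel" "bounded (range v)"
    "negligible {t\<in>{0<..<1}. \<not> (\<gamma> has_vector_derivative v t) (at t)}" "continuous_on {0..1} \<gamma>"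
  using assms lipschitz_on_continuous_on by (auto simp: has_velocity_def)

lemma lipschitz_on_compose_bounded_linear:
  assumes f: "bounded_linear f" and lip: "L-lipschitz_on X g"
  shows "\<exists>C. C-lipschitz_on X (\<lambda>x. f (g x))"
proof -
  obtain K where K: "K-lipschitz_on (g ` X) f" using bounded_linear.lipschitz_boundE[OF f] by blast
  show ?thesis using lipschitz_on_compose2[OF lip K] by blast
qed

lemma lipschitz_has_velocity:
  assumes "L-lipschitz_on {0..1} \<gamma>"
  shows "\<exists>v. has_velocity \<gamma> v"
proof -
  obtain C1 C2 where C: "C1-lipschitz_on {0..1} (\<lambda>t. Re (\<gamma> t))" "C2-lipschitz_on {0..1} (\<lambda>t. Im (\<gamma> t))"
    using lipschitz_on_compose_bounded_linear[OF bounded_linear_Re assms]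
      lipschitz_on_compose_bounded_linear[OF bounded_linear_Im assms] by blast
  obtain a Ma where a: "a \<in> borel_measurable borel" "\<And>x. \<bar>a x\<bar> \<le> Ma"
    "negligible {x\<in>{0<..<1}. \<not> ((\<lambda>t. Re (\<gamma> t)) has_real_derivative a x) (at x)}"
    using lipschitz_interval_density[OF C(1) zero_le_one] by metis
  obtain b Mb where b: "b \<in> borel_measurable borel" "\<And>x. \<bar>b x\<bar> \<le> Mb"
    "negligible {x\<in>{0<..<1}. \<not> ((\<lambda>t. Im (\<gamma> t)) has_real_derivative b x) (at x)}"
    using lipschitz_interval_density[OF C(2) zero_le_one] by metis
  define v where "v t = Complex (a t) (b t)" for t
  have "v = (\<lambda>t. complex_of_real (a t) + \<i> * complex_of_real (b t))" by (auto simp: v_def complex_eq_iff)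
  then have "v \<in> borel_measurable borel" using a(1) b(1) by simp
  moreover have "bounded (range v)"
    by (rule boundedI[of _ "Ma + Mb"])
       (use a(2) b(2) in \<open>auto simp: v_def intro!: order_trans[OF cmod_le] add_mono\<close>)
  moreover have "(\<gamma> has_vector_derivative v t) (at t)"
    if "((\<lambda>t. Re (\<gamma> t)) has_real_derivative a t) (at t)" "((\<lambda>t. Im (\<gamma> t)) has_real_derivative b t) (at t)" for t
  proof -
    show ?thesis unfolding has_vector_derivative_complex_iff using that by (simp add: v_def)
  qed
  then have "negligible {t\<in>{0<..<1}. \<not> (\<gamma> has_vector_derivative v t) (at t)}"
    by (intro negligible_subset[OF negligible_Un[OF a(3) b(3)]]) auto
  ultimately show ?thesis using assms unfolding has_velocity_def by blast
qed

lemma integral_vector_derivative_eq: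
  assumes "has_velocity \<gamma> v"
  shows "integral {0..1} (\<lambda>t. F t (vector_derivative \<gamma> (at t))) = integral {0..1} (\<lambda>t. F t (v t))"
proof (rule integral_spike)
  show "negligible ({t\<in>{0<..<1}. \<not> (\<gamma> has_vector_derivative v t) (at t)} \<union> {0,1})"
    using has_velocityD(4)[OF assms] by (simp add: negligible_Un)
qed (auto simp: vector_derivative_at)

lemma signed_area_velocity:
  assumes "has_velocity \<gamma> v"
  shows "signed_area \<gamma> = 1/2 * integral {0..1} (\<lambda>t. cross2 (\<gamma> t) (v t))"
  unfolding signed_area_def cross2_def[symmetric]
  using integral_vector_derivative_eq[OF assms, of "\<lambda>t w. cross2 (\<gamma> t) w"] by simp

lemma curve_energy_velocity:
  assumes "has_velocity \<gamma> v"
  shows "curve_energy S \<gamma> = integral {0..1} (\<lambda>t. minkowski S (- \<i> * v t))"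
proof -
  have "Complex (Im w) (- Re w) = - \<i> * w" for w by (simp add: complex_eq_iff)
  then show ?thesis unfolding curve_energy_def
    using integral_vector_derivative_eq[OF assms, of "\<lambda>t w. minkowski S (- \<i> * w)"] by simp
qed

lemma velocity_ftc:
  fixes f f' :: "real \<Rightarrow> real"
  assumes "has_velocity \<gamma> v" "L-lipschitz_on {0..1} f"
    and "\<And>t. t \<in> {0<..<1} \<Longrightarrow> (\<gamma> has_vector_derivative v t) (at t) \<Longrightarrow> (f has_real_derivative f' t) (at t)"
    and st: "0 \<le> s" "s \<le> t" "t \<le> 1"
  shows "(f' has_integral (f t - f s)) {s..t}"
  by (rule lipschitz_ftc[OF assms(2) has_velocityD(4)[OF assms(1)]]) (use assms in auto)

lemma velocity_linear_ftc:
  fixes l :: "complex \<Rightarrow> real"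
  assumes v: "has_velocity \<gamma> v" and l: "bounded_linear l" and st: "0 \<le> s" "s \<le> t" "t \<le> 1"
  shows "((\<lambda>\<tau>. l (v \<tau>)) has_integral (l (\<gamma> t) - l (\<gamma> s))) {s..t}"
proof -
  obtain L where "L-lipschitz_on {0..1} (\<lambda>t. l (\<gamma> t))"
    using has_velocityD(1)[OF v] lipschitz_on_compose_bounded_linear[OF l] by blast
  then show ?thesis
    by (rule velocity_ftc[OF v _ _ st])
       (use bounded_linear.has_vector_derivative[OF l] in \<open>auto simp: has_real_derivative_iff_has_vector_derivative\<close>)
qed

lemma velocity_bilinear_ftc:
  fixes b :: "complex \<Rightarrow> complex \<Rightarrow> real"
  assumes v: "has_velocity \<gamma> v" and w: "has_velocity \<eta> w" and b: "bounded_bilinear b"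
    and st: "0 \<le> s" "s \<le> t" "t \<le> 1"
  shows "((\<lambda>\<tau>. b (\<gamma> \<tau>) (w \<tau>) + b (v \<tau>) (\<eta> \<tau>)) has_integral (b (\<gamma> t) (\<eta> t) - b (\<gamma> s) (\<eta> s))) {s..t}"
proof -
  obtain L1 L2 where L: "L1-lipschitz_on {0..1} \<gamma>" "L2-lipschitz_on {0..1} \<eta>"
    using has_velocityD(1)[OF v] has_velocityD(1)[OF w] by blast
  have "bounded (\<gamma> ` {0..1})" "bounded (\<eta> ` {0..1})"
    using has_velocityD(5)[OF v] has_velocityD(5)[OF w] by (auto intro!: compact_imp_bounded compact_continuous_image compact_Icc)
  then obtain M1 M2 where M: "\<And>t. t \<in> {0..1} \<Longrightarrow> norm (\<gamma> t) \<le> M1" "\<And>t. t \<in> {0..1} \<Longrightarrow> norm (\<eta> t) \<le> M2"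
    unfolding bounded_iff by blast
  obtain K where K: "0 < K" "\<And>x y. norm (b x y) \<le> norm x * norm y * K"
    using bounded_bilinear.pos_bounded[OF b] by blast
  have M0: "0 \<le> M1" "0 \<le> M2" using M[of 0] by (auto intro: order_trans[OF norm_ge_zero])
  have L0: "0 \<le> L1" "0 \<le> L2" using L by (auto simp: lipschitz_on_def)
  have lip: "(M1 * L2 * K + L1 * M2 * K)-lipschitz_on {0..1} (\<lambda>t. b (\<gamma> t) (\<eta> t))"
  proof (rule lipschitz_onI)
    fix x y :: real assume xy: "x \<in> {0..1}" "y \<in> {0..1}"
    have "b (\<gamma> x) (\<eta> x) - b (\<gamma> y) (\<eta> y) = b (\<gamma> x) (\<eta> x - \<eta> y) + b (\<gamma> x - \<gamma> y) (\<eta> y)"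
      by (simp add: bounded_bilinear.diff_right[OF b] bounded_bilinear.diff_left[OF b])
    then have "dist (b (\<gamma> x) (\<eta> x)) (b (\<gamma> y) (\<eta> y)) \<le> norm (b (\<gamma> x) (\<eta> x - \<eta> y)) + norm (b (\<gamma> x - \<gamma> y) (\<eta> y))"
      unfolding dist_norm by (metis norm_triangle_ineq)
    also have "\<dots> \<le> M1 * (L2 * dist x y) * K + (L1 * dist x y) * M2 * K"
      using lipschitz_onD[OF L(1) xy] lipschitz_onD[OF L(2) xy] M xy K(1) M0 L0
      by (intro add_mono order_trans[OF K(2)] mult_right_mono mult_mono) (auto simp: dist_norm)
    finally show "dist (b (\<gamma> x) (\<eta> x)) (b (\<gamma> y) (\<eta> y)) \<le> (M1 * L2 * K + L1 * M2 * K) * dist x y"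
      by (simp add: algebra_simps)
  qed (use M0 L0 K in auto)
  show ?thesis
  proof (rule lipschitz_ftc[OF lip negligible_Un[OF has_velocityD(4)[OF v] has_velocityD(4)[OF w]]])
    fix \<tau> assume \<tau>: "\<tau> \<in> {0<..<1} - ({t \<in> {0<..<1}. \<not> (\<gamma> has_vector_derivative v t) (at t)} \<union> {t \<in> {0<..<1}. \<not> (\<eta> has_vector_derivative w t) (at t)})"
    show "((\<lambda>t. b (\<gamma> t) (\<eta> t)) has_real_derivative b (\<gamma> \<tau>) (w \<tau>) + b (v \<tau>) (\<eta> \<tau>)) (at \<tau>)"
      unfolding has_real_derivative_iff_has_vector_derivative
      by (rule bounded_bilinear.has_vector_derivative[OF b]) (use \<tau> in auto)
  qed (use st in auto)
qed

lemma velocity_integrable: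
  fixes F :: "complex \<Rightarrow> complex \<Rightarrow> real" and \<gamma> v :: "real \<Rightarrow> complex"
  assumes F: "continuous_on UNIV (\<lambda>z. F (fst z) (snd z))" and \<gamma>: "continuous_on {0..1} \<gamma>"
    and v: "v \<in> borel_measurable borel" "bounded (range v)" and st: "0 \<le> s" "t \<le> 1"
  shows "(\<lambda>\<tau>. F (\<gamma> \<tau>) (v \<tau>)) integrable_on {s..t}"
proof -
  define g where "g \<tau> = \<gamma> (max 0 (min 1 \<tau>))" for \<tau>
  have g: "continuous_on UNIV g" unfolding g_def
    by (rule continuous_on_compose2[OF \<gamma>]) (auto intro!: continuous_intros)
  have gm: "g \<in> borel_measurable borel" using g by (simp add: borel_measurable_continuous_onI)
  have "bounded (\<gamma> ` {0..1})" using \<gamma> by (auto intro!: compact_imp_bounded compact_continuous_image compact_Icc)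
  moreover have "range g \<subseteq> \<gamma> ` {0..1}" by (auto simp: g_def intro!: imageI)
  ultimately have "bounded (range g)" using bounded_subset by blast
  then obtain M1 M2 where M: "\<And>\<tau>. norm (g \<tau>) \<le> M1" "\<And>\<tau>. norm (v \<tau>) \<le> M2"
    using v(2) unfolding bounded_iff by auto
  have "compact (cball (0::complex) M1 \<times> cball (0::complex) M2)" by (intro compact_Times) auto
  then have "bounded ((\<lambda>z. F (fst z) (snd z)) ` (cball 0 M1 \<times> cball 0 M2))"
    by (intro compact_imp_bounded compact_continuous_image continuous_on_subset[OF F]) auto
  then obtain M where FM: "\<forall>x\<in>(\<lambda>z. F (fst z) (snd z)) ` (cball 0 M1 \<times> cball 0 M2). norm x \<le> M"
    unfolding bounded_iff by blast
  have bd: "norm (F (g \<tau>) (v \<tau>)) \<le> M" for \<tau>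
    by (rule FM[rule_format, OF image_eqI[of _ _ "(g \<tau>, v \<tau>)"]]) (use M in auto)
  have "(\<lambda>\<tau>. F (g \<tau>) (v \<tau>)) \<in> borel_measurable borel"
    by (rule borel_measurable_continuous_Pair[OF gm v(1)]) (use F in simp)
  then have "(\<lambda>\<tau>. F (g \<tau>) (v \<tau>)) \<in> borel_measurable (lebesgue_on {s..t})"
    by (intro measurable_restrict_space1 measurable_completion) auto
  then have "(\<lambda>\<tau>. F (g \<tau>) (v \<tau>)) integrable_on {s..t}"
    by (rule measurable_bounded_by_integrable_imp_integrable[where g="\<lambda>_. M"]) (use bd in auto)
  then show ?thesis
  proof (rule integrable_eq)
    fix x assume "x \<in> {s..t}"
    with st have "max 0 (min 1 x) = x" by auto
    then show "F (g x) (v x) = F (\<gamma> x) (v x)" by (simp add: g_def)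
  qed
qed

lemma has_velocity_scale_shift:
  assumes "has_velocity \<gamma> v"
  shows "has_velocity (\<lambda>t. k *\<^sub>R (\<gamma> t - c)) (\<lambda>t. k *\<^sub>R v t)"
proof -
  obtain L where L: "L-lipschitz_on {0..1} \<gamma>" using has_velocityD(1)[OF assms] by blast
  have "(\<bar>k\<bar> * L)-lipschitz_on {0..1} (\<lambda>t. k *\<^sub>R (\<gamma> t - c))"
  proof (rule lipschitz_onI)
    fix x y :: real assume xy: "x \<in> {0..1}" "y \<in> {0..1}"
    show "dist (k *\<^sub>R (\<gamma> x - c)) (k *\<^sub>R (\<gamma> y - c)) \<le> \<bar>k\<bar> * L * dist x y"
      using mult_left_mono[OF lipschitz_onD[OF L xy], of "\<bar>k\<bar>"]
      by (simp add: dist_norm scaleR_diff_right[symmetric] mult.assoc)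
  qed (use L in \<open>auto simp: lipschitz_on_def\<close>)
  moreover have "negligible {t\<in>{0<..<1}. \<not> ((\<lambda>t. k *\<^sub>R (\<gamma> t - c)) has_vector_derivative k *\<^sub>R v t) (at t)}"
    by (rule negligible_subset[OF has_velocityD(4)[OF assms]]) (auto intro!: derivative_eq_intros)
  moreover have "bounded (range (\<lambda>t. k *\<^sub>R v t))"
    using bounded_scaling[OF has_velocityD(3)[OF assms], of k] by (simp add: image_image)
  ultimately show ?thesis using has_velocityD(2)[OF assms] unfolding has_velocity_def by auto
qed

lemma has_velocity_add:
  assumes "has_velocity \<gamma> v" "has_velocity \<eta> w"
  shows "has_velocity (\<lambda>t. \<gamma> t + \<eta> t) (\<lambda>t. v t + w t)"
proof -
  obtain L1 L2 where L: "L1-lipschitz_on {0..1} \<gamma>" "L2-lipschitz_on {0..1} \<eta>"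
    using has_velocityD(1)[OF assms(1)] has_velocityD(1)[OF assms(2)] by blast
  have "negligible {t\<in>{0<..<1}. \<not> ((\<lambda>t. \<gamma> t + \<eta> t) has_vector_derivative v t + w t) (at t)}"
    by (rule negligible_subset[OF negligible_Un[OF has_velocityD(4)[OF assms(1)] has_velocityD(4)[OF assms(2)]]])
       (auto intro!: derivative_eq_intros)
  moreover have "bounded (range (\<lambda>t. v t + w t))"
    using bounded_plus_comp[OF has_velocityD(3)[OF assms(1)] has_velocityD(3)[OF assms(2)]] by simp
  ultimately show ?thesis using has_velocityD(2)[OF assms(1)] has_velocityD(2)[OF assms(2)] lipschitz_on_add[OF L]
    unfolding has_velocity_def by auto
qed

lemma has_velocity_reverse:
  assumes "has_velocity \<gamma> v"
  shows "has_velocity (\<lambda>t. \<gamma> (1 - t)) (\<lambda>t. - v (1 - t))"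
proof -
  obtain L where L: "L-lipschitz_on {0..1} \<gamma>" using has_velocityD(1)[OF assms] by blast
  have "L-lipschitz_on {0..1} (\<lambda>t. \<gamma> (1 - t))"
  proof (rule lipschitz_onI)
    fix x y :: real assume xy: "x \<in> {0..1}" "y \<in> {0..1}"
    have "dist (\<gamma> (1 - x)) (\<gamma> (1 - y)) \<le> L * dist (1 - x) (1 - y)" by (rule lipschitz_onD[OF L]) (use xy in auto)
    then show "dist (\<gamma> (1 - x)) (\<gamma> (1 - y)) \<le> L * dist x y" by (simp add: dist_real_def abs_minus_commute)
  qed (use L in \<open>auto simp: lipschitz_on_def\<close>)
  moreover have "negligible {t\<in>{0<..<1}. \<not> ((\<lambda>t. \<gamma> (1 - t)) has_vector_derivative - v (1 - t)) (at t)}"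
  proof (rule negligible_subset)
    let ?N = "{t\<in>{0<..<1}. \<not> (\<gamma> has_vector_derivative v t) (at t)}"
    show "negligible ((\<lambda>t. 1 - t) ` ?N)"
      by (rule negligible_differentiable_image_negligible[OF _ has_velocityD(4)[OF assms]]) (auto intro!: derivative_intros)
    show "{t\<in>{0<..<1}. \<not> ((\<lambda>t. \<gamma> (1 - t)) has_vector_derivative - v (1 - t)) (at t)} \<subseteq> (\<lambda>t. 1 - t) ` ?N"
    proof safe
      fix t :: real assume t: "t \<in> {0<..<1}" "\<not> ((\<lambda>t. \<gamma> (1 - t)) has_vector_derivative - v (1 - t)) (at t)"
      have "\<not> (\<gamma> has_vector_derivative v (1 - t)) (at (1 - t))"
      proof
        assume "(\<gamma> has_vector_derivative v (1 - t)) (at (1 - t))"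
        then have "(\<gamma> \<circ> (\<lambda>t. 1 - t) has_vector_derivative (-1) *\<^sub>R v (1 - t)) (at t)"
          by (intro vector_diff_chain_at) (auto intro!: derivative_eq_intros)
        with t show False by (simp add: o_def)
      qed
      with t(1) show "t \<in> (\<lambda>t. 1 - t) ` ?N" by (intro image_eqI[of _ _ "1 - t"]) auto
    qed
  qed
  moreover have "bounded (range (\<lambda>t. - v (1 - t)))"
    using has_velocityD(3)[OF assms] unfolding bounded_iff by auto
  moreover have "(\<lambda>t. - v (1 - t)) \<in> borel_measurable borel"
    using has_velocityD(2)[OF assms] by measurable
  ultimately show ?thesis unfolding has_velocity_def by blast
qed

text \<open>A curve that halts at time \<open>s\<close> keeps its parameter interval, so a loop that is traversed before
  time \<open>s\<close> is again a closed curve on \<open>{0..1}\<close>.\<close>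

lemma has_velocity_stop:
  assumes v: "has_velocity \<gamma> v" and s: "0 \<le> s" "s \<le> 1"
  shows "has_velocity (\<lambda>t. \<gamma> (min t s)) (\<lambda>t. if t < s then v t else 0)"
proof -
  obtain L where L: "L-lipschitz_on {0..1} \<gamma>" using has_velocityD(1)[OF v] by blast
  have "L-lipschitz_on {0..1} (\<lambda>t. \<gamma> (min t s))"
  proof (rule lipschitz_onI)
    fix x y :: real assume xy: "x \<in> {0..1}" "y \<in> {0..1}"
    have "dist (\<gamma> (min x s)) (\<gamma> (min y s)) \<le> L * dist (min x s) (min y s)" by (rule lipschitz_onD[OF L]) (use xy s in auto)
    also have "\<dots> \<le> L * dist x y" using L by (intro mult_left_mono) (auto simp: dist_real_def lipschitz_on_def)
    finally show "dist (\<gamma> (min x s)) (\<gamma> (min y s)) \<le> L * dist x y" .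
  qed (use L in \<open>auto simp: lipschitz_on_def\<close>)
  moreover have "negligible {t\<in>{0<..<1}. \<not> ((\<lambda>t. \<gamma> (min t s)) has_vector_derivative (if t < s then v t else 0)) (at t)}"
  proof (rule negligible_subset[OF negligible_Un[OF has_velocityD(4)[OF v] negligible_sing[of s]]], safe)
    fix t assume t: "t \<in> {0<..<1}" "\<not> ((\<lambda>t. \<gamma> (min t s)) has_vector_derivative (if t < s then v t else 0)) (at t)" "t \<noteq> s"
      "(\<gamma> has_vector_derivative v t) (at t)"
    have "((\<lambda>t. \<gamma> (min t s)) has_vector_derivative (if t < s then v t else 0)) (at t)"
    proof (cases "t < s")
      case True
      have "((\<lambda>t. \<gamma> (min t s)) has_vector_derivative v t) (at t)"
        by (rule has_vector_derivative_transform_within_open[OF t(4), of "{..<s}"]) (use True in auto)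
      with True show ?thesis by simp
    next
      case False
      have "((\<lambda>t. \<gamma> s) has_vector_derivative 0) (at t)" by simp
      then have "((\<lambda>t. \<gamma> (min t s)) has_vector_derivative 0) (at t)"
        by (rule has_vector_derivative_transform_within_open[of _ _ _ "{s<..}"]) (use False t in auto)
      with False show ?thesis by simp
    qed
    with t(2) show False by simp
  qed
  moreover have "bounded (range (\<lambda>t. if t < s then v t else 0))"
    by (rule bounded_subset[of "insert 0 (range v)"]) (use has_velocityD(3)[OF v] in auto)
  moreover have "(\<lambda>t. if t < s then v t else 0) \<in> borel_measurable borel"
    using has_velocityD(2)[OF v] by measurable
  ultimately show ?thesis unfolding has_velocity_def by blast
qed

section \<open>The upper and lower boundary of a convex body\<close>

definition upper_graph :: "complex set \<Rightarrow> real \<Rightarrow> real" where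
  "upper_graph W x = Sup {y. Complex x y \<in> W}"

definition lower_graph :: "complex set \<Rightarrow> real \<Rightarrow> real" where
  "lower_graph W x = Inf {y. Complex x y \<in> W}"

lemma vertical_slice:
  assumes W: "compact W" "convex W" and z: "z \<in> W"
  shows "compact {y. Complex (Re z) y \<in> W}" "Complex (Re z) (upper_graph W (Re z)) \<in> W"
    "Complex (Re z) (lower_graph W (Re z)) \<in> W"
    "Im z \<le> upper_graph W (Re z)" "lower_graph W (Re z) \<le> Im z"
    "{y. Complex (Re z) y \<in> W} = {lower_graph W (Re z)..upper_graph W (Re z)}"
proof -
  let ?Y = "{y. Complex (Re z) y \<in> W}"
  have eq: "?Y = Im ` (W \<inter> {w. Re w = Re z})"
  proof (intro equalityI subsetI)
    fix y assume "y \<in> ?Y"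
    then show "y \<in> Im ` (W \<inter> {w. Re w = Re z})" by (intro image_eqI[of _ _ "Complex (Re z) y"]) auto
  next
    fix y assume "y \<in> Im ` (W \<inter> {w. Re w = Re z})"
    then obtain w where "w \<in> W" "Re w = Re z" "y = Im w" by auto
    then show "y \<in> ?Y" by (metis complex.collapse mem_Collect_eq)
  qed
  have "closed {w. Re w = Re z}" by (intro closed_Collect_eq continuous_intros)
  then show cpt: "compact ?Y" unfolding eq using W(1)
    by (intro compact_continuous_image compact_Int_closed continuous_intros)
  have ne0: "Im z \<in> ?Y" using z by simp
  then have ne: "?Y \<noteq> {}" by blast
  have bd: "bdd_above ?Y" "bdd_below ?Y"
    using cpt by (auto dest: compact_imp_bounded bounded_imp_bdd_above bounded_imp_bdd_below)
  have mem: "upper_graph W (Re z) \<in> ?Y" "lower_graph W (Re z) \<in> ?Y"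
    unfolding upper_graph_def lower_graph_def
    using closed_contains_Sup[OF ne bd(1) compact_imp_closed[OF cpt]]
      closed_contains_Inf[OF ne bd(2) compact_imp_closed[OF cpt]] by auto
  then show "Complex (Re z) (upper_graph W (Re z)) \<in> W" "Complex (Re z) (lower_graph W (Re z)) \<in> W" by auto
  have le: "y \<le> upper_graph W (Re z)" "lower_graph W (Re z) \<le> y" if "y \<in> ?Y" for y
    unfolding upper_graph_def lower_graph_def using that bd by (auto intro: cSup_upper cInf_lower)
  then show "Im z \<le> upper_graph W (Re z)" "lower_graph W (Re z) \<le> Im z" using z by auto
  have "convex ?Y"
  proof (rule convexI)
    fix a b u v :: real assume "a \<in> ?Y" "b \<in> ?Y" "0 \<le> u" "0 \<le> v" "u + v = 1"
    then have "u *\<^sub>R Complex (Re z) a + v *\<^sub>R Complex (Re z) b \<in> W" using W(2) by (auto intro: convexD)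
    moreover have "u *\<^sub>R Complex (Re z) a + v *\<^sub>R Complex (Re z) b = Complex (Re z) (u *\<^sub>R a + v *\<^sub>R b)"
      using \<open>u + v = 1\<close> by (simp add: complex_eq_iff distrib_right[symmetric])
    ultimately show "u *\<^sub>R a + v *\<^sub>R b \<in> ?Y" by simp
  qed
  then have "is_interval ?Y" by (simp add: is_interval_convex_1)
  then show "?Y = {lower_graph W (Re z)..upper_graph W (Re z)}"
  proof (intro equalityI subsetI)
    fix y assume "y \<in> {lower_graph W (Re z)..upper_graph W (Re z)}"
    then show "y \<in> ?Y" using mem_is_interval_1_I[OF \<open>is_interval ?Y\<close> mem(2) mem(1)] by auto
  qed (use le in simp)
qed

lemma convex_body_shadow:
  assumes W: "compact W" "convex W" and int: "interior W \<noteq> {}"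
  obtains a b where "a < b" "Re ` W = {a..b}"
proof -
  obtain z e where e: "0 < e" "cball z e \<subseteq> W" using int by (meson equals0I mem_interior_cball)
  have "connected (Re ` W)" "compact (Re ` W)" "Re ` W \<noteq> {}"
    using W e by (auto intro!: connected_continuous_image[OF _ convex_connected[OF W(2)]] compact_continuous_image continuous_intros)
  then obtain a b where ab: "Re ` W = {a..b}" by (metis connected_compact_interval_1)
  have "z \<in> W" "z + of_real e \<in> W" using e by (auto simp: dist_norm)
  then have "Re z \<in> Re ` W" "Re (z + of_real e) \<in> Re ` W" by blast+
  then have "Re z \<in> {a..b}" "Re z + e \<in> {a..b}" unfolding ab by auto
  then have "a < b" using e by auto
  then show ?thesis using ab that by blast
qed

text \<open>The graph is closed: limits of points of the graph lie in \<open>W\<close>, hence not above the graph, and by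
  concavity \<open>upper_graph W\<close> drops at most linearly away from each point \<open>x0\<close>, hence they lie not
  below it.  The slope is estimated with the chord from \<open>x0\<close> to the end point on the side of \<open>x\<close>,
  which also covers the end points of the interval (where one of the quotients is \<open>2 * M / 0 = 0\<close>).\<close>

lemma upper_graph_continuous:
  assumes W: "compact W" "convex W" and sh: "Re ` W = {a..b}"
  shows "continuous_on {a..b} (upper_graph W)"
proof -
  let ?f = "upper_graph W"
  have fW: "Complex x (?f x) \<in> W" and fle: "Complex x y \<in> W \<Longrightarrow> y \<le> ?f x" if "x \<in> {a..b}" for x y
  proof -
    from that sh obtain z where "z \<in> W" "Re z = x" by (metis imageE)
    then show "Complex x (?f x) \<in> W" using vertical_slice(2)[OF W] by blast
    show "Complex x y \<in> W \<Longrightarrow> y \<le> ?f x" using vertical_slice(4)[OF W, of "Complex x y"] by simp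
  qed
  obtain M where M: "\<And>z. z \<in> W \<Longrightarrow> norm z \<le> M" using compact_imp_bounded[OF W(1)] bounded_iff by blast
  have fM: "\<bar>?f x\<bar> \<le> M" if "x \<in> {a..b}" for x
    using M[OF fW[OF that]] abs_Im_le_cmod[of "Complex x (?f x)"] by simp
  have low: "?f x \<ge> ?f x0 - (2 * M / (b - x0) + 2 * M / (x0 - a)) * \<bar>x - x0\<bar>"
    if x: "x \<in> {a..b}" "x0 \<in> {a..b}" for x x0
  proof (cases "x = x0")
    case False
    define e where "e = (if x0 < x then b else a)"
    define s where "s = (x - x0) / (e - x0)"
    have e: "e \<in> {a..b}" "e \<noteq> x0" using x False by (auto simp: e_def)
    have s: "0 \<le> s" "s \<le> 1" using x False by (auto simp: s_def e_def divide_simps)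
    have "s * (e - x0) = x - x0" using e by (simp add: s_def)
    then have xs: "(1 - s) * x0 + s * e = x" by (simp add: algebra_simps)
    have "(1 - s) *\<^sub>R Complex x0 (?f x0) + s *\<^sub>R Complex e (?f e) \<in> W"
      using s fW x e by (intro convexD[OF W(2)]) auto
    moreover have "(1 - s) *\<^sub>R Complex x0 (?f x0) + s *\<^sub>R Complex e (?f e) = Complex x ((1 - s) * ?f x0 + s * ?f e)"
      using xs by (simp add: complex_eq_iff)
    ultimately have "(1 - s) * ?f x0 + s * ?f e \<le> ?f x" using fle x by metis
    moreover have "s * (?f x0 - ?f e) \<le> s * (2 * M)" using s fM[OF e(1)] fM[OF x(2)] by (intro mult_left_mono) auto
    moreover have "s * (2 * M) \<le> (2 * M / (b - x0) + 2 * M / (x0 - a)) * \<bar>x - x0\<bar>"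
    proof -
      have "0 \<le> M" using fM[OF x(1)] by auto
      then have nn: "0 \<le> 2 * M / (b - x0) * \<bar>x - x0\<bar>" "0 \<le> 2 * M / (x0 - a) * \<bar>x - x0\<bar>"
        using x by auto
      have "s * (2 * M) = 2 * M / (b - x0) * \<bar>x - x0\<bar> \<or> s * (2 * M) = 2 * M / (x0 - a) * \<bar>x - x0\<bar>"
      proof (cases "x0 < x")
        case True
        then show ?thesis by (simp add: s_def e_def)
      next
        case F: False
        have "(x - x0) / (a - x0) = (x0 - x) / (x0 - a)" by (metis minus_diff_eq minus_divide_divide)
        with F False show ?thesis by (simp add: s_def e_def)
      qed
      then show ?thesis using nn by (auto simp: distrib_right)
    qed
    ultimately show ?thesis by (simp add: algebra_simps)
  qed simp
  show ?thesis
  proof (rule continuous_from_closed_graph[of "{-M..M}"])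
    show "?f \<in> {a..b} \<rightarrow> {-M..M}" using fM by (auto simp: abs_le_iff minus_le_iff)
    show "closed ((\<lambda>x. (x, ?f x)) ` {a..b})"
      unfolding closed_sequential_limits
    proof (intro allI impI)
      fix Z l assume Z: "(\<forall>n. Z n \<in> (\<lambda>x. (x, ?f x)) ` {a..b}) \<and> Z \<longlonglongrightarrow> l"
      define X where "X n = fst (Z n)" for n
      obtain x0 y0 where l: "l = (x0, y0)" by force
      have XZ: "X n \<in> {a..b}" "snd (Z n) = ?f (X n)" for n
      proof -
        obtain x where "x \<in> {a..b}" "Z n = (x, ?f x)" using Z by blast
        then show "X n \<in> {a..b}" "snd (Z n) = ?f (X n)" by (simp_all add: X_def)
      qed
      have X: "X \<longlonglongrightarrow> x0" and Y: "(\<lambda>n. ?f (X n)) \<longlonglongrightarrow> y0"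
        using tendsto_fst[of Z l sequentially] tendsto_snd[of Z l sequentially] Z
        unfolding XZ(2) X_def[symmetric] l by simp_all
      have x0: "x0 \<in> {a..b}" by (rule closed_sequentially[OF closed_atLeastAtMost _ X]) (rule XZ(1))
      have lim: "(\<lambda>n. Complex (X n) (?f (X n))) \<longlonglongrightarrow> Complex x0 y0" using X Y by (rule tendsto_Complex)
      have "Complex x0 y0 \<in> W"
        by (rule closed_sequentially[OF compact_imp_closed[OF W(1)] fW[OF XZ(1)] lim])
      then have 1: "y0 \<le> ?f x0" using fle x0 by blast
      let ?K = "2 * M / (b - x0) + 2 * M / (x0 - a)"
      have "(\<lambda>n. ?f x0 - ?K * \<bar>X n - x0\<bar>) \<longlonglongrightarrow> ?f x0 - ?K * \<bar>x0 - x0\<bar>"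
        using X by (intro tendsto_intros)
      then have "?f x0 - ?K * \<bar>x0 - x0\<bar> \<le> y0"
        by (rule LIMSEQ_le[OF _ Y]) (intro exI[of _ 0] allI impI low XZ(1) x0)
      with 1 have "y0 = ?f x0" by simp
      then show "l \<in> (\<lambda>x. (x, ?f x)) ` {a..b}" using l x0 by auto
    qed
  qed auto
qed

lemma lower_graph_cnj: "lower_graph W x = - upper_graph (cnj ` W) x"
proof -
  have "{y. Complex x y \<in> cnj ` W} = uminus ` {y. Complex x y \<in> W}"
  proof (intro equalityI subsetI)
    fix y assume "y \<in> {y. Complex x y \<in> cnj ` W}"
    then obtain w where "w \<in> W" "Complex x y = cnj w" by auto
    then have "Complex x (- y) \<in> W" by (metis complex_cnj_cnj complex_cnj)
    then show "y \<in> uminus ` {y. Complex x y \<in> W}" by (intro image_eqI[of _ _ "- y"]) auto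
  next
    fix y assume "y \<in> uminus ` {y. Complex x y \<in> W}"
    then obtain y' where "Complex x y' \<in> W" "y = - y'" by auto
    then show "y \<in> {y. Complex x y \<in> cnj ` W}" by (auto intro!: image_eqI[of _ cnj "Complex x y'"] simp: complex_cnj)
  qed
  then show ?thesis by (simp add: upper_graph_def lower_graph_def Inf_real_def)
qed

lemma lower_graph_continuous:
  assumes W: "compact W" "convex W" and sh: "Re ` W = {a..b}"
  shows "continuous_on {a..b} (lower_graph W)"
proof -
  have "continuous_on {a..b} (upper_graph (cnj ` W))"
  proof (rule upper_graph_continuous)
    show "compact (cnj ` W)" using W by (intro compact_continuous_image continuous_intros)
    show "convex (cnj ` W)" using W by (simp add: convex_linear_image bounded_linear.linear bounded_linear_cnj)
    show "Re ` cnj ` W = {a..b}" using sh by (simp add: image_image)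
  qed
  then show ?thesis unfolding lower_graph_cnj by (intro continuous_intros)
qed

text \<open>The measure on \<^typ>\<open>complex\<close> has no product structure by definition; this makes Fubini's theorem
  applicable.\<close>

lemma lborel_complex_pair:
  "lborel = distr (lborel \<Otimes>\<^sub>M lborel) borel (\<lambda>z. Complex (fst z) (snd z))"
proof (rule lborel_eqI)
  have m: "(\<lambda>z. Complex (fst z) (snd z)) \<in> borel_measurable (borel :: (real \<times> real) measure)"
    by (intro borel_measurable_continuous_onI continuous_intros)
  fix l u :: complex assume lu: "\<And>b. b \<in> Basis \<Longrightarrow> l \<bullet> b \<le> u \<bullet> b"
  then have le: "Re l \<le> Re u" "Im l \<le> Im u" using lu[of 1] lu[of \<i>] by (auto simp: Basis_complex_def)
  have "(\<lambda>z. Complex (fst z) (snd z)) -` box l u = {Re l<..<Re u} \<times> {Im l<..<Im u}"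
    by (auto simp: in_box_complex_iff)
  then have "emeasure (distr (lborel \<Otimes>\<^sub>M lborel) borel (\<lambda>z. Complex (fst z) (snd z))) (box l u) =
      emeasure (lborel \<Otimes>\<^sub>M lborel) ({Re l<..<Re u} \<times> {Im l<..<Im u})"
    using m by (subst emeasure_distr) (auto simp: lborel_prod)
  also have "\<dots> = ennreal (Re u - Re l) * ennreal (Im u - Im l)"
    using le by (simp add: lborel.emeasure_pair_measure_Times)
  also have "\<dots> = (\<Prod>b\<in>Basis. (u - l) \<bullet> b)"
    using le by (simp add: Basis_complex_def ennreal_mult)
  finally show "emeasure (distr (lborel \<Otimes>\<^sub>M lborel) borel (\<lambda>z. Complex (fst z) (snd z))) (box l u) = (\<Prod>b\<in>Basis. (u - l) \<bullet> b)" .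
qed simp

lemma convex_body_area:
  assumes W: "compact W" "convex W" and sh: "Re ` W = {a..b}"
  shows "measure lebesgue W = integral {a..b} (upper_graph W) - integral {a..b} (lower_graph W)"
proof -
  note cont = upper_graph_continuous[OF W sh] lower_graph_continuous[OF W sh]
  have sl: "{y. Complex x y \<in> W} = {lower_graph W x..upper_graph W x}" "lower_graph W x \<le> upper_graph W x" if "x \<in> {a..b}" for x
  proof -
    from that sh obtain z where z: "z \<in> W" "Re z = x" by (metis imageE)
    then show "{y. Complex x y \<in> W} = {lower_graph W x..upper_graph W x}" using vertical_slice(6)[OF W] by blast
    show "lower_graph W x \<le> upper_graph W x" using vertical_slice(4,5)[OF W z(1)] unfolding z(2) by linarith
  qed
  have sl0: "{y. Complex x y \<in> W} = {}" if "x \<notin> {a..b}" for x using sh that by force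
  have Wb: "W \<in> sets borel" using W by (simp add: borel_compact)
  have m: "(\<lambda>z. Complex (fst z) (snd z)) \<in> borel_measurable (borel :: (real \<times> real) measure)"
    by (intro borel_measurable_continuous_onI continuous_intros)
  let ?V = "(\<lambda>z. Complex (fst z) (snd z)) -` W"
  have Vb: "?V \<in> sets (lborel \<Otimes>\<^sub>M lborel)" 
  proof -
    have "sets (lborel \<Otimes>\<^sub>M lborel :: (real \<times> real) measure) = sets borel" by (simp only: lborel_prod sets_lborel)
    then show ?thesis using measurable_sets[OF m Wb] by simp
  qed
  have "emeasure lborel W = emeasure (lborel \<Otimes>\<^sub>M lborel) ?V"
    by (subst lborel_complex_pair, subst emeasure_distr) (use m Wb in \<open>auto simp: lborel_prod\<close>)
  also have "\<dots> = (\<integral>\<^sup>+x. emeasure lborel {y. Complex x y \<in> W} \<partial>lborel)"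
    by (subst lborel.emeasure_pair_measure_alt[OF Vb]) (auto intro!: nn_integral_cong arg_cong[where f="emeasure lborel"])
  also have "\<dots> = (\<integral>\<^sup>+x. ennreal (indicator {a..b} x * (upper_graph W x - lower_graph W x)) \<partial>lborel)"
    by (intro nn_integral_cong) (use sl sl0 in \<open>auto split: split_indicator\<close>)
  also have "\<dots> = ennreal (integral {a..b} (\<lambda>x. upper_graph W x - lower_graph W x))"
    using cont sl by (intro nn_integral_has_integral_lebesgue integrable_integral integrable_continuous_interval continuous_intros) auto
  finally have "measure lborel W = integral {a..b} (\<lambda>x. upper_graph W x - lower_graph W x)"
    by (intro measure_eq_emeasure_eq_ennreal integral_nonneg integrable_continuous_interval continuous_intros cont) (use sl in auto)
  then show ?thesis using Wb cont by (simp add: integral_diff integrable_continuous_interval)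
qed

section \<open>Support functions\<close>

definition supp :: "complex set \<Rightarrow> complex \<Rightarrow> real" where
  "supp W u = (SUP x\<in>W. x \<bullet> u)"

lemma
  assumes W: "compact W" "W \<noteq> {}"
  shows supp_upper: "x \<in> W \<Longrightarrow> x \<bullet> u \<le> supp W u"
    and supp_attained: "\<exists>x\<in>W. x \<bullet> u = supp W u"
    and supp_least: "(\<And>x. x \<in> W \<Longrightarrow> x \<bullet> u \<le> c) \<Longrightarrow> supp W u \<le> c"
proof -
  have "compact ((\<lambda>x. x \<bullet> u) ` W)" using W by (intro compact_continuous_image continuous_intros)
  then have bd: "bdd_above ((\<lambda>x. x \<bullet> u) ` W)" and cl: "closed ((\<lambda>x. x \<bullet> u) ` W)"
    by (auto intro: bounded_imp_bdd_above compact_imp_bounded compact_imp_closed)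
  show "x \<in> W \<Longrightarrow> x \<bullet> u \<le> supp W u" unfolding supp_def using bd by (rule cSUP_upper[rotated])
  show "\<exists>x\<in>W. x \<bullet> u = supp W u" unfolding supp_def using closed_contains_Sup[OF _ bd cl] W by force
  show "(\<And>x. x \<in> W \<Longrightarrow> x \<bullet> u \<le> c) \<Longrightarrow> supp W u \<le> c" unfolding supp_def using W by (intro cSUP_least)
qed

lemma supp_add:
  assumes W: "compact W" "W \<noteq> {}"
  shows "supp W (u + v) \<le> supp W u + supp W v"
  by (rule supp_least[OF W]) (auto simp: inner_add_right intro!: add_mono supp_upper[OF W])

lemma supp_scale:
  assumes W: "compact W" "W \<noteq> {}" and k: "0 \<le> k"
  shows "supp W (k *\<^sub>R u) = k * supp W u"
proof (rule antisym)
  show "supp W (k *\<^sub>R u) \<le> k * supp W u"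
    by (rule supp_least[OF W]) (auto intro!: mult_left_mono k supp_upper[OF W])
  obtain x where "x \<in> W" "x \<bullet> u = supp W u" using supp_attained[OF W] by blast
  then show "k * supp W u \<le> supp W (k *\<^sub>R u)" using supp_upper[OF W, of x "k *\<^sub>R u"] by simp
qed

lemma supp_zero: "compact W \<Longrightarrow> W \<noteq> {} \<Longrightarrow> supp W 0 = 0"
  using supp_scale[of W 0 0] by simp

lemma supp_continuous:
  assumes W: "compact W" "W \<noteq> {}"
  shows "continuous_on UNIV (supp W)"
proof -
  obtain M where M: "\<And>z. z \<in> W \<Longrightarrow> norm z \<le> M" using compact_imp_bounded[OF W(1)] bounded_iff by blast
  have M0: "0 \<le> M" using M W(2) norm_ge_zero order_trans by blast
  have *: "supp W u - supp W v \<le> M * dist u v" for u v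
  proof -
    obtain x where x: "x \<in> W" "x \<bullet> (u - v) = supp W (u - v)" using supp_attained[OF W] by blast
    have "supp W u \<le> supp W (u - v) + supp W v" using supp_add[OF W, of "u - v" v] by simp
    moreover have "x \<bullet> (u - v) \<le> norm x * norm (u - v)" by (rule norm_cauchy_schwarz)
    moreover have "norm x * norm (u - v) \<le> M * norm (u - v)" using M[OF x(1)] by (intro mult_right_mono) auto
    ultimately show ?thesis using x by (simp add: dist_norm)
  qed
  have "M-lipschitz_on UNIV (supp W)"
  proof (rule lipschitz_onI)
    show "dist (supp W u) (supp W v) \<le> M * dist u v" for u v
      using *[of u v] *[of v u] by (simp add: dist_real_def dist_commute abs_le_iff)
  qed (rule M0)
  then show ?thesis by (rule lipschitz_on_continuous_on)
qed

text \<open>The length of a curve with velocity \<open>v\<close> measured by the support function of \<open>W\<close>; for a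
  convex curve it is twice the mixed area with \<open>W\<close>.\<close>

definition length_in :: "complex set \<Rightarrow> (real \<Rightarrow> complex) \<Rightarrow> real" where
  "length_in W v = integral {0..1} (\<lambda>t. supp W (- \<i> * v t))"

lemma supp_integrable:
  fixes v :: "real \<Rightarrow> complex"
  assumes W: "compact W" "W \<noteq> {}" and v: "v \<in> borel_measurable borel" "bounded (range v)" and st: "0 \<le> s" "t \<le> 1"
  shows "(\<lambda>\<tau>. supp W (- \<i> * v \<tau>)) integrable_on {s..t}"
proof (rule velocity_integrable[where \<gamma>="\<lambda>_. 0" and F="\<lambda>_ w. supp W (- \<i> * w)"])
  show "continuous_on UNIV (\<lambda>z. supp W (- \<i> * snd z))"
    by (rule continuous_on_compose2[OF supp_continuous[OF W]]) (auto intro!: continuous_intros)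
qed (use v st in auto)

lemma cross2_integrable:
  fixes \<gamma> v :: "real \<Rightarrow> complex"
  assumes \<gamma>: "continuous_on {0..1} \<gamma>" and v: "v \<in> borel_measurable borel" "bounded (range v)" and st: "0 \<le> s" "t \<le> 1"
  shows "(\<lambda>\<tau>. cross2 (\<gamma> \<tau>) (v \<tau>)) integrable_on {s..t}"
  by (rule velocity_integrable[OF _ assms]) (auto simp: cross2_def intro!: continuous_intros)

lemma signed_area_has_integral:
  assumes v: "has_velocity \<gamma> v"
  shows "((\<lambda>t. cross2 (\<gamma> t) (v t)) has_integral 2 * signed_area \<gamma>) {0..1}"
  using signed_area_velocity[OF v] cross2_integrable[OF has_velocityD(5,2,3)[OF v], of 0 1] by (simp add: has_integral_iff)

section \<open>The isoperimetric inequality\<close>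

lemma velocity_integral_zero:
  assumes v: "has_velocity \<gamma> v" and cl: "\<gamma> 0 = \<gamma> 1"
  shows "((\<lambda>t. cross2 c (v t)) has_integral 0) {0..1}"
  using velocity_linear_ftc[OF v cross2.bounded_linear_right, of 0 1 c] cl by simp

lemma signed_area_scale_shift:
  assumes v: "has_velocity \<gamma> v" and cl: "\<gamma> 0 = \<gamma> 1"
  shows "signed_area (\<lambda>t. k *\<^sub>R (\<gamma> t - c)) = k\<^sup>2 * signed_area \<gamma>"
proof -
  have "integral {0..1} (\<lambda>t. cross2 (k *\<^sub>R (\<gamma> t - c)) (k *\<^sub>R v t)) = integral {0..1} (\<lambda>t. k\<^sup>2 * (cross2 (\<gamma> t) (v t) - cross2 c (v t)))"
    by (simp add: cross2.scaleR_left cross2.scaleR_right cross2.diff_left power2_eq_square mult.assoc)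
  also have "\<dots> = k\<^sup>2 * (integral {0..1} (\<lambda>t. cross2 (\<gamma> t) (v t)) - 0)"
    using velocity_integral_zero[OF v cl, of c] cross2_integrable[OF has_velocityD(5,2,3)[OF v], of 0 1]
    by (subst integral_mult_right) (simp add: integral_diff has_integral_iff)
  finally show ?thesis
    unfolding signed_area_velocity[OF v] signed_area_velocity[OF has_velocity_scale_shift[OF v]] by simp
qed

text \<open>For a closed curve the integral of \<open>x dy + y dx\<close> vanishes, so \<open>(x dy - y dx) / 2\<close> may be
  replaced by \<open>x dy\<close>.\<close>

lemma signed_area_Re_Im:
  assumes v: "has_velocity \<gamma> v" and cl: "\<gamma> 0 = \<gamma> 1"
  shows "((\<lambda>t. Re (\<gamma> t) * Im (v t)) has_integral signed_area \<gamma>) {0..1}"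
proof -
  have b: "bounded_bilinear (\<lambda>z w. Re z * Im w)"
    by (intro bounded_bilinear.comp[OF bounded_bilinear_mult] bounded_linear_Re bounded_linear_Im)
  have 1: "((\<lambda>t. Re (\<gamma> t) * Im (v t) + Re (v t) * Im (\<gamma> t)) has_integral 0) {0..1}"
    using velocity_bilinear_ftc[OF v v b, of 0 1] cl by simp
  from has_integral_divide[OF has_integral_add[OF 1 signed_area_has_integral[OF v]], of 2] show ?thesis
    by (simp add: cross2_def algebra_simps)
qed

text \<open>Integrating \<open>k(x) dx\<close> along a curve depends on the real parts of its end points only, since an
  antiderivative of \<open>k\<close> composed with the real part is Lipschitz.\<close>

lemma graph_path_integral:
  assumes v: "has_velocity \<gamma> v" and rng: "\<And>t. t \<in> {0..1} \<Longrightarrow> Re (\<gamma> t) \<in> {a..b}"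
    and k: "continuous_on {a..b} k" and st: "0 \<le> s" "s \<le> t" "t \<le> 1"
  shows "((\<lambda>\<tau>. k (Re (\<gamma> \<tau>)) * Re (v \<tau>)) has_integral (integral {a..Re (\<gamma> t)} k - integral {a..Re (\<gamma> s)} k)) {s..t}"
proof -
  define K where "K x = integral {a..x} k" for x
  have dK: "(K has_real_derivative k x) (at x within {a..b})" if "x \<in> {a..b}" for x
    unfolding K_def by (rule integral_has_real_derivative[OF k that])
  have "bounded (k ` {a..b})" by (rule compact_imp_bounded[OF compact_continuous_image[OF k compact_Icc]])
  then obtain M where "\<forall>y\<in>k ` {a..b}. norm y \<le> M" unfolding bounded_iff by blast
  then have M: "\<bar>k x\<bar> \<le> M" if "x \<in> {a..b}" for x using that by simp
  have M0: "0 \<le> M" using M[OF rng[of 0]] by auto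
  have lipK: "M-lipschitz_on {a..b} K"
  proof (rule bounded_derivative_imp_lipschitz)
    show "(K has_derivative (*) (k x)) (at x within {a..b})" if "x \<in> {a..b}" for x
      using dK[OF that] by (simp add: has_field_derivative_def)
    show "onorm ((*) (k x)) \<le> M" if "x \<in> {a..b}" for x
      by (rule onorm_le) (use M[OF that] in \<open>auto simp: abs_mult intro!: mult_right_mono\<close>)
  qed (use M0 in auto)
  obtain L where L: "L-lipschitz_on {0..1} (\<lambda>t. Re (\<gamma> t))"
    using has_velocityD(1)[OF v] lipschitz_on_compose_bounded_linear[OF bounded_linear_Re] by blast
  have "(M * L)-lipschitz_on {0..1} (\<lambda>t. K (Re (\<gamma> t)))"
    by (rule lipschitz_on_compose2[OF L lipschitz_on_subset[OF lipK]]) (use rng in auto)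
  then have "((\<lambda>\<tau>. k (Re (\<gamma> \<tau>)) * Re (v \<tau>)) has_integral (K (Re (\<gamma> t)) - K (Re (\<gamma> s)))) {s..t}"
  proof (rule velocity_ftc[OF v _ _ st])
    fix t :: real assume t: "t \<in> {0<..<1}" "(\<gamma> has_vector_derivative v t) (at t)"
    have "((\<lambda>t. Re (\<gamma> t)) has_real_derivative Re (v t)) (at t within {0..1})"
      using t by (auto simp: has_vector_derivative_complex_iff intro: has_field_derivative_at_within)
    moreover have "(K has_real_derivative k (Re (\<gamma> t))) (at (Re (\<gamma> t)) within (\<lambda>t. Re (\<gamma> t)) ` {0..1})"
      by (rule has_field_derivative_subset[OF dK]) (use rng t in auto)
    ultimately have "(K \<circ> (\<lambda>t. Re (\<gamma> t)) has_real_derivative k (Re (\<gamma> t)) * Re (v t)) (at t within {0..1})"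
      by (rule DERIV_image_chain[rotated])
    moreover have "at t within {0..1} = at t" using t by (intro at_within_interior) auto
    ultimately show "((\<lambda>t. K (Re (\<gamma> t))) has_real_derivative k (Re (\<gamma> t)) * Re (v t)) (at t)"
      by (simp add: o_def)
  qed
  then show ?thesis by (simp add: K_def)
qed

text \<open>A closed curve that uses \<open>k1\<close> on the way from its real part at \<open>s1\<close> to that at \<open>s2\<close> and
  \<open>k2\<close> on the way back picks up the integral of \<open>k1 - k2\<close> in between, no matter how often the real
  part turns back.\<close>

lemma graph_loop_integral:
  assumes v: "has_velocity \<gamma> v" and cl: "\<gamma> 0 = \<gamma> 1" and rng: "\<And>t. t \<in> {0..1} \<Longrightarrow> Re (\<gamma> t) \<in> {a..b}"
    and k: "continuous_on {a..b} k1" "continuous_on {a..b} k2" and s: "0 \<le> s1" "s1 \<le> s2" "s2 \<le> 1"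
  shows "((\<lambda>t. (if s1 \<le> t \<and> t \<le> s2 then k1 (Re (\<gamma> t)) else k2 (Re (\<gamma> t))) * Re (v t)) has_integral
     (integral {a..Re (\<gamma> s2)} k1 - integral {a..Re (\<gamma> s1)} k1 + integral {a..Re (\<gamma> s1)} k2 - integral {a..Re (\<gamma> s2)} k2)) {0..1}"
proof -
  let ?h = "\<lambda>t. (if s1 \<le> t \<and> t \<le> s2 then k1 (Re (\<gamma> t)) else k2 (Re (\<gamma> t))) * Re (v t)"
  note P = graph_path_integral[OF v rng]
  have 1: "(?h has_integral (integral {a..Re (\<gamma> s1)} k2 - integral {a..Re (\<gamma> 0)} k2)) {0..s1}"
    by (rule has_integral_spike_finite[OF _ _ P[OF _ k(2), of 0 s1], of "{s1}"]) (use s in auto)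
  have 2: "(?h has_integral (integral {a..Re (\<gamma> s2)} k1 - integral {a..Re (\<gamma> s1)} k1)) {s1..s2}"
    by (rule has_integral_spike_finite[OF _ _ P[OF _ k(1), of s1 s2], of "{}"]) (use s in auto)
  have 3: "(?h has_integral (integral {a..Re (\<gamma> 1)} k2 - integral {a..Re (\<gamma> s2)} k2)) {s2..1}"
    by (rule has_integral_spike_finite[OF _ _ P[OF _ k(2), of s2 1], of "{s2}"]) (use s in auto)
  have "(?h has_integral (integral {a..Re (\<gamma> s1)} k2 - integral {a..Re (\<gamma> 0)} k2) +
     (integral {a..Re (\<gamma> s2)} k1 - integral {a..Re (\<gamma> s1)} k1) +
     (integral {a..Re (\<gamma> 1)} k2 - integral {a..Re (\<gamma> s2)} k2)) {0..1}"
    by (rule has_integral_combine[OF _ _ has_integral_combine[OF _ _ 1 2] 3]) (use s in auto)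
  then show ?thesis using cl by (simp add: algebra_simps)
qed

text \<open>Schmidt's comparison.  The curve is paired with \<open>F t = Complex (Re (\<gamma> t)) (F2 t)\<close>, a point of
  \<open>W\<close>; the part \<open>x dy\<close> of \<open>F \<bullet> u\<close> integrates to the area of \<open>\<gamma>\<close>, and the part \<open>- F2 dx\<close> to the area of
  \<open>W\<close>, because \<open>F2\<close> follows the lower boundary from left to right and the upper one back.\<close>

lemma isoperimetric_same_shadow:
  assumes W: "compact W" "convex W" "interior W \<noteq> {}"
    and v: "has_velocity \<gamma> v" and cl: "\<gamma> 0 = \<gamma> 1" and sh: "Re ` \<gamma> ` {0..1} = Re ` W"
  shows "signed_area \<gamma> + measure lebesgue W \<le> length_in W v"
proof -
  have Wne: "W \<noteq> {}" using W(3) interior_subset by auto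
  obtain a b where ab: "a < b" "Re ` W = {a..b}" by (rule convex_body_shadow[OF W])
  let ?f = "upper_graph W" and ?g = "lower_graph W"
  note cont = upper_graph_continuous[OF W(1,2) ab(2)] lower_graph_continuous[OF W(1,2) ab(2)]
  have inW: "Complex x (?f x) \<in> W" "Complex x (?g x) \<in> W" if "x \<in> {a..b}" for x
  proof -
    from that ab obtain z where "z \<in> W" "Re z = x" by (metis imageE)
    then show "Complex x (?f x) \<in> W" "Complex x (?g x) \<in> W" using vertical_slice(2,3)[OF W(1,2)] by blast+
  qed
  have rng: "Re (\<gamma> t) \<in> {a..b}" if "t \<in> {0..1}" for t using sh ab(2) that by blast
  have "a \<in> Re ` \<gamma> ` {0..1}" "b \<in> Re ` \<gamma> ` {0..1}" using ab sh by auto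
  then obtain t0 t1 where t: "t0 \<in> {0..1}" "Re (\<gamma> t0) = a" "t1 \<in> {0..1}" "Re (\<gamma> t1) = b" by auto
  have area: "measure lebesgue W = integral {a..b} ?f - integral {a..b} ?g"
    by (rule convex_body_area[OF W(1,2) ab(2)])
  obtain F2 where F2: "\<And>t. t \<in> {0..1} \<Longrightarrow> Complex (Re (\<gamma> t)) (F2 t) \<in> W"
    and int: "((\<lambda>t. F2 t * Re (v t)) has_integral - measure lebesgue W) {0..1}"
  proof (cases "t0 \<le> t1")
    case True
    show ?thesis
    proof (rule that)
      show "((\<lambda>t. (if t0 \<le> t \<and> t \<le> t1 then ?g (Re (\<gamma> t)) else ?f (Re (\<gamma> t))) * Re (v t)) has_integral - measure lebesgue W) {0..1}"
        using graph_loop_integral[OF v cl rng cont(2,1), of t0 t1] True t area by simp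
    qed (use inW rng in auto)
  next
    case False
    show ?thesis
    proof (rule that)
      show "((\<lambda>t. (if t1 \<le> t \<and> t \<le> t0 then ?f (Re (\<gamma> t)) else ?g (Re (\<gamma> t))) * Re (v t)) has_integral - measure lebesgue W) {0..1}"
        using graph_loop_integral[OF v cl rng cont, of t1 t0] False t area by simp
    qed (use inW rng in auto)
  qed
  have "((\<lambda>t. Re (\<gamma> t) * Im (v t) - F2 t * Re (v t)) has_integral signed_area \<gamma> - - measure lebesgue W) {0..1}"
    by (rule has_integral_diff[OF signed_area_Re_Im[OF v cl] int])
  moreover have "((\<lambda>t. supp W (- \<i> * v t)) has_integral length_in W v) {0..1}"
    unfolding length_in_def by (intro integrable_integral supp_integrable[OF W(1) Wne]) (use has_velocityD[OF v] in auto)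
  ultimately have "signed_area \<gamma> - - measure lebesgue W \<le> length_in W v"
  proof (rule has_integral_le)
    fix t :: real assume t: "t \<in> {0..1}"
    have "Re (\<gamma> t) * Im (v t) - F2 t * Re (v t) = Complex (Re (\<gamma> t)) (F2 t) \<bullet> (- \<i> * v t)"
      by (simp add: inner_complex_def)
    also have "\<dots> \<le> supp W (- \<i> * v t)" by (rule supp_upper[OF W(1) Wne F2[OF t]])
    finally show "Re (\<gamma> t) * Im (v t) - F2 t * Re (v t) \<le> supp W (- \<i> * v t)" .
  qed
  then show ?thesis by simp
qed

lemma length_in_scale:
  assumes W: "compact W" "W \<noteq> {}" and k: "0 \<le> k"
  shows "length_in W (\<lambda>t. k *\<^sub>R v t) = k * length_in W v"
proof -
  have "- \<i> * (k *\<^sub>R v t) = k *\<^sub>R (- \<i> * v t)" for t by simp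
  then show ?thesis unfolding length_in_def by (simp only: supp_scale[OF W k] integral_mult_right)
qed

text \<open>Scaling by \<open>r\<close>, the ratio of the widths, gives \<open>A / r + r * |W|\<close> as a lower bound for the length;
  the inequality of the means removes \<open>r\<close>.\<close>

theorem isoperimetric_inequality:
  assumes W: "compact W" "convex W" "interior W \<noteq> {}"
    and v: "has_velocity \<gamma> v" and cl: "\<gamma> 0 = \<gamma> 1" and pos: "0 < signed_area \<gamma>"
  shows "2 * sqrt (signed_area \<gamma> * measure lebesgue W) \<le> length_in W v"
proof -
  have Wne: "W \<noteq> {}" using W(3) interior_subset by auto
  obtain a b where ab: "a < b" "Re ` W = {a..b}" by (rule convex_body_shadow[OF W])
  have cont: "continuous_on {0..1} (\<lambda>t. Re (\<gamma> t))" by (intro continuous_intros has_velocityD(5)[OF v])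
  have "connected ((\<lambda>t. Re (\<gamma> t)) ` {0..1})" "compact ((\<lambda>t. Re (\<gamma> t)) ` {0..1})"
    by (auto intro!: connected_continuous_image[OF cont] compact_continuous_image[OF cont])
  then obtain \<alpha> \<beta> where rng: "(\<lambda>t. Re (\<gamma> t)) ` {0..1} = {\<alpha>..\<beta>}" by (metis connected_compact_interval_1)
  have "\<alpha> \<noteq> \<beta>"
  proof
    assume "\<alpha> = \<beta>"
    then have "Re (\<gamma> t) = \<alpha>" if "t \<in> {0..1}" for t using rng that by auto
    then have "((\<lambda>t. \<alpha> * Im (v t)) has_integral signed_area \<gamma>) {0..1}"
      by (intro has_integral_eq[OF _ signed_area_Re_Im[OF v cl]]) auto
    moreover have "((\<lambda>t. \<alpha> * Im (v t)) has_integral \<alpha> * (Im (\<gamma> 1) - Im (\<gamma> 0))) {0..1}"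
      by (intro has_integral_mult_right velocity_linear_ftc[OF v bounded_linear_Im]) auto
    ultimately have "signed_area \<gamma> = \<alpha> * (Im (\<gamma> 1) - Im (\<gamma> 0))" by (rule has_integral_unique)
    with cl pos show False by simp
  qed
  moreover have "\<alpha> \<le> \<beta>" using rng by (metis atLeastatMost_empty_iff2 empty_iff image_is_empty not_le zero_le_one atLeastAtMost_iff)
  ultimately have "\<alpha> < \<beta>" by simp
  define r where "r = (\<beta> - \<alpha>) / (b - a)"
  have r: "0 < r" "r * (b - a) = \<beta> - \<alpha>" using ab \<open>\<alpha> < \<beta>\<close> by (auto simp: r_def)
  define c where "c = complex_of_real (\<alpha> - r * a)"
  let ?\<delta> = "\<lambda>t. (1/r) *\<^sub>R (\<gamma> t - c)"
  have "signed_area ?\<delta> + measure lebesgue W \<le> length_in W (\<lambda>t. (1/r) *\<^sub>R v t)"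
  proof (rule isoperimetric_same_shadow[OF W has_velocity_scale_shift[OF v]])
    show "?\<delta> 0 = ?\<delta> 1" using cl by simp
    have "Re ` ?\<delta> ` {0..1} = (\<lambda>x. (x - (\<alpha> - r * a)) / r) ` (\<lambda>t. Re (\<gamma> t)) ` {0..1}"
      by (simp add: image_image c_def)
    also have "\<dots> = (\<lambda>x. (1/r) * x + (a - \<alpha>/r)) ` {\<alpha>..\<beta>}"
      unfolding rng using r by (intro image_cong) (auto simp: field_simps)
    also have "\<dots> = {a..b}"
      using r \<open>\<alpha> < \<beta>\<close> by (subst image_affinity_atLeastAtMost) (auto simp: field_simps)
    finally show "Re ` ?\<delta> ` {0..1} = Re ` W" using ab by simp
  qed
  then have "signed_area \<gamma> / r\<^sup>2 + measure lebesgue W \<le> length_in W v / r"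
    using r by (simp add: signed_area_scale_shift[OF v cl] length_in_scale[OF W(1) Wne] power_divide)
  then have "r * (signed_area \<gamma> / r\<^sup>2 + measure lebesgue W) \<le> r * (length_in W v / r)"
    using r by (intro mult_left_mono) auto
  moreover have "r * (signed_area \<gamma> / r\<^sup>2) = signed_area \<gamma> / r" using r by (simp add: power2_eq_square)
  ultimately have 1: "signed_area \<gamma> / r + r * measure lebesgue W \<le> length_in W v"
    using r by (simp add: distrib_left)
  have "sqrt ((signed_area \<gamma> / r) * (r * measure lebesgue W)) \<le> (signed_area \<gamma> / r + r * measure lebesgue W) / 2"
    using r pos by (intro arith_geo_mean_sqrt) auto
  with 1 r show ?thesis by simp
qed

section \<open>Equality in the isoperimetric inequality\<close>

lemma length_in_add:
  assumes W: "compact W" "W \<noteq> {}" and v: "v \<in> borel_measurable borel" "bounded (range v)"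
    and w: "w \<in> borel_measurable borel" "bounded (range w)"
  shows "length_in W (\<lambda>t. v t + w t) \<le> length_in W v + length_in W w"
proof -
  have b: "(\<lambda>t. v t + w t) \<in> borel_measurable borel" "bounded (range (\<lambda>t. v t + w t))"
    using v w by (auto intro: bounded_plus_comp)
  have "length_in W (\<lambda>t. v t + w t) \<le> integral {0..1} (\<lambda>t. supp W (- \<i> * v t) + supp W (- \<i> * w t))"
    unfolding length_in_def
  proof (rule integral_le)
    show "supp W (- \<i> * (v t + w t)) \<le> supp W (- \<i> * v t) + supp W (- \<i> * w t)" for t
      using supp_add[OF W, of "- \<i> * v t" "- \<i> * w t"] by (simp add: algebra_simps)
    show "(\<lambda>t. supp W (- \<i> * (v t + w t))) integrable_on {0..1}" by (rule supp_integrable[OF W b]) auto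
    show "(\<lambda>t. supp W (- \<i> * v t) + supp W (- \<i> * w t)) integrable_on {0..1}"
      by (intro integrable_add supp_integrable[OF W v] supp_integrable[OF W w]) auto
  qed
  also have "\<dots> = length_in W v + length_in W w"
    unfolding length_in_def by (intro integral_add supp_integrable[OF W] v w) auto
  finally show ?thesis .
qed

lemma measure_convex_pos:
  assumes "compact W" "convex W" "interior W \<noteq> {}"
  shows "0 < measure lebesgue W"
proof -
  have "\<not> negligible W" using negligible_convex_interior assms by blast
  moreover have "W \<in> lmeasurable" using assms by (simp add: lmeasurable_compact)
  ultimately have "measure lebesgue W \<noteq> 0" by (simp add: negligible_iff_measure)
  then show ?thesis using measure_nonneg[of lebesgue W] by linarith
qed

text \<open>Compare \<open>\<gamma>\<close> with \<open>(1 - e) \<gamma> + e \<eta>\<close>.  The area of this curve is a quadratic polynomial in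
  \<open>e\<close> whose mixed term is the integral on the left, its length is at most
  \<open>(1 - e) E + e E'\<close>, and the terms of order \<open>0\<close> cancel by assumption.  The terms of order \<open>e\<close>
  give the claim as \<open>e\<close> tends to \<open>0\<close>.\<close>

lemma isoperimetric_first_variation:
  assumes W: "compact W" "convex W" "interior W \<noteq> {}"
    and v: "has_velocity \<gamma> v" "\<gamma> 0 = \<gamma> 1" and w: "has_velocity \<eta> w" "\<eta> 0 = \<eta> 1" and pos: "0 < signed_area \<gamma>"
    and eq: "length_in W v = 2 * sqrt (signed_area \<gamma> * measure lebesgue W)"
  shows "integral {0..1} (\<lambda>t. cross2 (\<gamma> t) (w t)) \<le> sqrt (signed_area \<gamma> / measure lebesgue W) * length_in W w"
proof -
  have Wne: "W \<noteq> {}" using W(3) interior_subset by auto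
  define m where "m = measure lebesgue W"
  have m: "0 < m" unfolding m_def by (rule measure_convex_pos[OF W])
  define A where "A = signed_area \<gamma>"
  define E where "E = length_in W v"
  define E' where "E' = length_in W w"
  define A' where "A' = signed_area \<eta>"
  define M where "M = integral {0..1} (\<lambda>t. cross2 (\<gamma> t) (w t))"
  note vd = has_velocityD[OF v(1)] and wd = has_velocityD[OF w(1)]
  have E2: "E\<^sup>2 = 4 * m * A" using eq pos m by (simp add: E_def A_def m_def power_mult_distrib)
  have E0: "0 \<le> E" using eq pos m by (simp add: E_def m_def)
  have I1: "((\<lambda>t. cross2 (\<gamma> t) (w t)) has_integral M) {0..1}"
    unfolding M_def by (intro integrable_integral cross2_integrable vd wd) auto
  have I2: "((\<lambda>t. cross2 (\<eta> t) (v t)) has_integral M) {0..1}"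
  proof -
    have "((\<lambda>t. cross2 (\<gamma> t) (w t) + cross2 (v t) (\<eta> t)) has_integral 0) {0..1}"
      using velocity_bilinear_ftc[OF v(1) w(1) bounded_bilinear_cross2, of 0 1] v w by simp
    from has_integral_diff[OF I1 this] show ?thesis by (simp add: cross2_commute[of "v t" for t])
  qed
  have I3: "((\<lambda>t. cross2 (\<gamma> t) (v t)) has_integral 2 * A) {0..1}" "((\<lambda>t. cross2 (\<eta> t) (w t)) has_integral 2 * A') {0..1}"
    unfolding A_def A'_def by (rule signed_area_has_integral[OF v(1)] signed_area_has_integral[OF w(1)])+
  have key: "0 \<le> (1 - e) * (2 * E * E' - 4 * m * M) + e * (E'\<^sup>2 - 4 * m * A')" if e: "0 < e" "e < 1" for e
  proof -
    let ?z = "\<lambda>t. (1 - e) *\<^sub>R (\<gamma> t - 0) + e *\<^sub>R (\<eta> t - 0)"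
    let ?y = "\<lambda>t. (1 - e) *\<^sub>R v t + e *\<^sub>R w t"
    have vel: "has_velocity ?z ?y" by (intro has_velocity_add has_velocity_scale_shift v w)
    have expand: "cross2 (a *\<^sub>R x + b *\<^sub>R y) (a *\<^sub>R p + b *\<^sub>R q) =
        a\<^sup>2 * cross2 x p + a * b * cross2 x q + b * a * cross2 y p + b\<^sup>2 * cross2 y q" for a b x y p q
      by (simp add: cross2_def power2_eq_square algebra_simps)
    have "integral {0..1} (\<lambda>t. cross2 (?z t) (?y t)) = (1-e)\<^sup>2 * (2 * A) + (1-e) * e * M + e * (1-e) * M + e\<^sup>2 * (2 * A')"
    proof (rule integral_unique)
      have "((\<lambda>t. (1-e)\<^sup>2 * cross2 (\<gamma> t) (v t) + (1-e) * e * cross2 (\<gamma> t) (w t) + e * (1-e) * cross2 (\<eta> t) (v t) + e\<^sup>2 * cross2 (\<eta> t) (w t))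
         has_integral (1-e)\<^sup>2 * (2 * A) + (1-e) * e * M + e * (1-e) * M + e\<^sup>2 * (2 * A')) {0..1}"
        by (intro has_integral_add has_integral_mult_right I1 I2 I3)
      then show "((\<lambda>t. cross2 (?z t) (?y t)) has_integral (1-e)\<^sup>2 * (2 * A) + (1-e) * e * M + e * (1-e) * M + e\<^sup>2 * (2 * A')) {0..1}"
        by (rule has_integral_eq[rotated])
           (simp add: expand)
    qed
    then have area: "signed_area ?z = (1-e)\<^sup>2 * A + (1-e) * e * M + e\<^sup>2 * A'"
      unfolding signed_area_velocity[OF vel] by (simp add: algebra_simps)
    have len: "length_in W ?y \<le> (1 - e) * E + e * E'"
      using length_in_add[OF W(1) Wne, of "\<lambda>t. (1 - e) *\<^sub>R v t" "\<lambda>t. e *\<^sub>R w t"] e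
        has_velocityD[OF has_velocity_scale_shift[OF v(1)]] has_velocityD[OF has_velocity_scale_shift[OF w(1)]]
      by (simp add: length_in_scale[OF W(1) Wne] E_def E'_def)
    \<comment> \<open>If the area is not positive this is trivial, so \<open>e\<close> need not be small.\<close>
    have "4 * m * signed_area ?z \<le> ((1 - e) * E + e * E')\<^sup>2"
    proof (cases "0 < signed_area ?z")
      case True
      have "2 * sqrt (signed_area ?z * m) \<le> (1 - e) * E + e * E'"
        using isoperimetric_inequality[OF W vel _ True] v(2) w(2) len by (simp add: m_def)
      then have "(2 * sqrt (signed_area ?z * m))\<^sup>2 \<le> ((1 - e) * E + e * E')\<^sup>2"
        using True m by (intro power_mono) auto
      then show ?thesis using True m by (simp add: power_mult_distrib mult.commute mult.left_commute)
    next
      case False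
      then have "4 * m * signed_area ?z \<le> 0" using m by (simp add: mult_nonneg_nonpos)
      then show ?thesis using zero_le_power2 order_trans by blast
    qed
    moreover have "((1 - e) * E + e * E')\<^sup>2 - 4 * m * signed_area ?z =
        e * ((1 - e) * (2 * E * E' - 4 * m * M) + e * (E'\<^sup>2 - 4 * m * A')) + (1 - e)\<^sup>2 * (E\<^sup>2 - 4 * m * A)"
      unfolding area by (simp add: power2_eq_square algebra_simps)
    ultimately have "0 \<le> e * ((1 - e) * (2 * E * E' - 4 * m * M) + e * (E'\<^sup>2 - 4 * m * A'))"
      by (simp add: E2)
    then show ?thesis using e by (simp add: zero_le_mult_iff)
  qed
  have "((\<lambda>e. (1 - e) * (2 * E * E' - 4 * m * M) + e * (E'\<^sup>2 - 4 * m * A')) \<longlongrightarrow> (1 - 0) * (2 * E * E' - 4 * m * M) + 0 * (E'\<^sup>2 - 4 * m * A')) (at_right 0)"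
    by (intro tendsto_intros)
  then have "0 \<le> (1 - 0) * (2 * E * E' - 4 * m * M) + 0 * (E'\<^sup>2 - 4 * m * A')"
    by (rule tendsto_lowerbound)
       (use key in \<open>auto simp: eventually_at_right_field intro!: exI[of _ 1]\<close>)
  then have "4 * m * M \<le> 2 * E * E'" by simp
  also have "2 * E * E' = 4 * m * (sqrt (A / m) * E')"
  proof -
    have "sqrt (A * m) = m * sqrt (A / m)"
      using m by (simp add: real_sqrt_mult real_sqrt_divide) (simp add: field_simps)
    then show ?thesis using eq by (simp add: E_def A_def m_def)
  qed
  finally show ?thesis using m by (simp add: M_def A_def m_def E'_def)
qed

lemma has_velocity_ramp:
  assumes d: "0 < d"
  shows "has_velocity (\<lambda>t. max 0 (min 1 ((t - \<tau>) / d)) *\<^sub>R z) (\<lambda>t. if \<tau> < t \<and> t < \<tau> + d then (1 / d) *\<^sub>R z else 0)"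
proof -
  let ?r = "\<lambda>t. max 0 (min 1 ((t - \<tau>) / d))" and ?w = "\<lambda>t. if \<tau> < t \<and> t < \<tau> + d then (1 / d) *\<^sub>R z else 0"
  have "(norm z / d)-lipschitz_on {0..1} (\<lambda>t. ?r t *\<^sub>R z)"
  proof (rule lipschitz_onI)
    fix x y :: real
    have "\<bar>?r x - ?r y\<bar> \<le> \<bar>(x - \<tau>) / d - (y - \<tau>) / d\<bar>" by (auto simp: max_def min_def)
    also have "\<dots> = \<bar>x - y\<bar> / d" using d by (simp add: diff_divide_distrib[symmetric])
    finally have "\<bar>?r x - ?r y\<bar> * norm z \<le> \<bar>x - y\<bar> / d * norm z" by (intro mult_right_mono) auto
    then show "dist (?r x *\<^sub>R z) (?r y *\<^sub>R z) \<le> norm z / d * dist x y"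
      by (simp add: dist_norm scaleR_diff_left[symmetric] mult.commute)
  qed (use d in auto)
  moreover have "negligible {t\<in>{0<..<1}. \<not> ((\<lambda>t. ?r t *\<^sub>R z) has_vector_derivative ?w t) (at t)}"
  proof (rule negligible_subset[of "{\<tau>, \<tau> + d}"], simp, rule subsetI, rule ccontr)
    fix t assume "t \<in> {t\<in>{0<..<1}. \<not> ((\<lambda>t. ?r t *\<^sub>R z) has_vector_derivative ?w t) (at t)}" "t \<notin> {\<tau>, \<tau> + d}"
    then have t: "\<not> ((\<lambda>t. ?r t *\<^sub>R z) has_vector_derivative ?w t) (at t)" "t \<noteq> \<tau> + d" "t \<noteq> \<tau>" by auto
    consider "t < \<tau>" | "\<tau> < t" "t < \<tau> + d" | "\<tau> + d < t" using t by fastforce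
    then have "((\<lambda>t. ?r t *\<^sub>R z) has_vector_derivative ?w t) (at t)"
    proof cases
      case 1
      have "((\<lambda>t. ?r t *\<^sub>R z) has_vector_derivative 0) (at t)"
        by (rule has_vector_derivative_transform_within_open[of "\<lambda>_. 0" _ _ "{..<\<tau>}"])
           (use 1 d in \<open>auto simp: max_def min_def divide_simps\<close>)
      then show ?thesis using 1 by simp
    next
      case 2
      have "((\<lambda>t. ((t - \<tau>) / d) *\<^sub>R z) has_vector_derivative (1 / d) *\<^sub>R z) (at t)"
        using d by (auto intro!: derivative_eq_intros)
      then have "((\<lambda>t. ?r t *\<^sub>R z) has_vector_derivative (1 / d) *\<^sub>R z) (at t)"
        by (rule has_vector_derivative_transform_within_open[of _ _ _ "{\<tau><..<\<tau> + d}"])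
           (use 2 d in \<open>auto simp: max_def min_def divide_simps\<close>)
      then show ?thesis using 2 by simp
    next
      case 3
      have "((\<lambda>t. ?r t *\<^sub>R z) has_vector_derivative 0) (at t)"
        by (rule has_vector_derivative_transform_within_open[of "\<lambda>_. z" _ _ "{\<tau> + d<..}"])
           (use 3 d in \<open>auto simp: max_def min_def divide_simps\<close>)
      then show ?thesis using 3 by simp
    qed
    with t show False by simp
  qed
  moreover have "bounded (range ?w)"
    by (rule bounded_subset[of "{(1 / d) *\<^sub>R z, 0}"]) auto
  moreover have "?w \<in> borel_measurable borel" by measurable
  ultimately show ?thesis unfolding has_velocity_def by blast
qed

lemma spike_has_integral:
  fixes f :: "real \<Rightarrow> real"
  assumes "continuous_on {0..1} f" "0 \<le> \<tau>" "0 < d" "\<tau> + d \<le> 1"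
  shows "((\<lambda>t. if \<tau> < t \<and> t < \<tau> + d then (1 / d) * f t else 0) has_integral integral {\<tau>..\<tau> + d} f / d) {0..1}"
proof -
  have "(f has_integral integral {\<tau>..\<tau> + d} f) {\<tau>..\<tau> + d}"
    by (intro integrable_integral integrable_continuous_interval continuous_on_subset[OF assms(1)]) (use assms in auto)
  then have "((\<lambda>t. (1 / d) * f t) has_integral (1 / d) * integral {\<tau>..\<tau> + d} f) {\<tau>..\<tau> + d}"
    by (rule has_integral_mult_right)
  then have "((\<lambda>t. (1 / d) * f t) has_integral (1 / d) * integral {\<tau>..\<tau> + d} f) {\<tau><..<\<tau> + d}"
    by (metis box_real has_integral_open_interval)
  then have "((\<lambda>t. if t \<in> {\<tau><..<\<tau> + d} then (1 / d) * f t else 0) has_integral (1 / d) * integral {\<tau>..\<tau> + d} f) {0..1}"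
    by (subst has_integral_restrict) (use assms in auto)
  then show ?thesis by simp
qed

lemma interval_average_tendsto:
  fixes f :: "real \<Rightarrow> real"
  assumes f: "continuous_on {0..1} f" and \<tau>: "0 \<le> \<tau>" "\<tau> < 1"
  shows "((\<lambda>d. integral {\<tau>..\<tau> + d} f / d) \<longlongrightarrow> f \<tau>) (at_right 0)"
proof -
  have "continuous_on {\<tau>..1} f" by (rule continuous_on_subset[OF f]) (use \<tau> in auto)
  then have "((\<lambda>x. integral {\<tau>..x} f) has_real_derivative f \<tau>) (at \<tau> within {\<tau>..1})"
    by (rule integral_has_real_derivative) (use \<tau> in auto)
  then have "((\<lambda>x. integral {\<tau>..x} f) has_real_derivative f \<tau>) (at_right \<tau>)"
    using \<tau> by (simp add: at_within_Icc_at_right)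
  then have "((\<lambda>x. (integral {\<tau>..x} f - integral {\<tau>..\<tau>} f) / (x - \<tau>)) \<longlongrightarrow> f \<tau>) (at_right \<tau>)"
    by (simp add: has_field_derivative_iff)
  then show ?thesis
    by (subst (asm) at_right_to_0) (simp add: filterlim_filtermap add.commute)
qed

text \<open>The closed curve \<open>\<eta>\<close> moves by \<open>\<i> * u1\<close>, \<open>\<i> * u2\<close>, \<open>\<i> * u3\<close> during the short time intervals that
  begin at \<open>\<tau>1\<close>, \<open>\<tau>2\<close>, \<open>\<tau>3\<close>.  As these intervals shrink, the first variation only sees the three
  points of \<open>\<gamma>\<close>.\<close>

lemma three_point_inequality:
  assumes W: "compact W" "convex W" "interior W \<noteq> {}"
    and v: "has_velocity \<gamma> v" "\<gamma> 0 = \<gamma> 1" and pos: "0 < signed_area \<gamma>"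
    and eq: "length_in W v = 2 * sqrt (signed_area \<gamma> * measure lebesgue W)"
    and \<tau>: "\<tau>1 \<in> {0..<1}" "\<tau>2 \<in> {0..<1}" "\<tau>3 \<in> {0..<1}" and u: "u1 + u2 + u3 = 0"
  shows "\<gamma> \<tau>1 \<bullet> u1 + \<gamma> \<tau>2 \<bullet> u2 + \<gamma> \<tau>3 \<bullet> u3
    \<le> sqrt (signed_area \<gamma> / measure lebesgue W) * (supp W u1 + supp W u2 + supp W u3)"
proof -
  have Wne: "W \<noteq> {}" using W(3) interior_subset by auto
  define l where "l = sqrt (signed_area \<gamma> / measure lebesgue W)"
  have l: "0 \<le> l" using pos by (simp add: l_def)
  have cont: "continuous_on {0..1} (\<lambda>t. \<gamma> t \<bullet> u)" for u by (intro continuous_intros has_velocityD(5)[OF v(1)])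
  let ?I = "\<lambda>d \<tau> u. integral {\<tau>..\<tau> + d} (\<lambda>t. \<gamma> t \<bullet> u) / d"
  have est: "?I d \<tau>1 u1 + ?I d \<tau>2 u2 + ?I d \<tau>3 u3 \<le> l * (supp W u1 + supp W u2 + supp W u3)"
    if d: "0 < d" "\<tau>1 + d \<le> 1" "\<tau>2 + d \<le> 1" "\<tau>3 + d \<le> 1" for d
  proof -
    define r where "r \<tau> u = (\<lambda>t. max 0 (min 1 ((t - \<tau>) / d)) *\<^sub>R (\<i> * u))" for \<tau> and u :: complex
    define y where "y \<tau> u = (\<lambda>t. if \<tau> < t \<and> t < \<tau> + d then (1 / d) *\<^sub>R (\<i> * u) else 0)" for \<tau> and u :: complex
    have ry: "has_velocity (r \<tau> u) (y \<tau> u)" for \<tau> u unfolding r_def y_def by (rule has_velocity_ramp[OF d(1)])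
    have ends: "r \<tau> u 0 = 0" "r \<tau> u 1 = \<i> * u" if "0 \<le> \<tau>" "\<tau> + d \<le> 1" for \<tau> u
      using that d by (auto simp: r_def max_def min_def divide_simps)
    have yl: "length_in W (y \<tau> u) = supp W u" if "0 \<le> \<tau>" "\<tau> + d \<le> 1" for \<tau> u
    proof -
      have "((\<lambda>t. if \<tau> < t \<and> t < \<tau> + d then (1 / d) * supp W u else 0) has_integral integral {\<tau>..\<tau> + d} (\<lambda>t. supp W u) / d) {0..1}"
        using that d by (intro spike_has_integral) auto
      moreover have "supp W (- \<i> * y \<tau> u t) = (if \<tau> < t \<and> t < \<tau> + d then (1 / d) * supp W u else 0)" for t
        using supp_scale[OF W(1) Wne, of "1/d" u] supp_zero[OF W(1) Wne] d by (auto simp: y_def)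
      ultimately show ?thesis unfolding length_in_def using d by (simp add: has_integral_iff)
    qed
    have yc: "((\<lambda>t. cross2 (\<gamma> t) (y \<tau> u t)) has_integral ?I d \<tau> u) {0..1}" if "0 \<le> \<tau>" "\<tau> + d \<le> 1" for \<tau> u
    proof -
      have "cross2 (\<gamma> t) (y \<tau> u t) = (if \<tau> < t \<and> t < \<tau> + d then (1 / d) * (\<gamma> t \<bullet> u) else 0)" for t
        by (auto simp: y_def cross2_inner[symmetric])
      then show ?thesis using spike_has_integral[OF cont that(1) d(1) that(2)] by simp
    qed
    let ?\<eta> = "\<lambda>t. r \<tau>1 u1 t + r \<tau>2 u2 t + r \<tau>3 u3 t" and ?w = "\<lambda>t. y \<tau>1 u1 t + y \<tau>2 u2 t + y \<tau>3 u3 t"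
    have vel: "has_velocity ?\<eta> ?w" by (intro has_velocity_add ry)
    have closed: "?\<eta> 0 = ?\<eta> 1"
      using ends \<tau> d u by (simp add: distrib_left[symmetric])
    have "integral {0..1} (\<lambda>t. cross2 (\<gamma> t) (?w t)) \<le> l * length_in W ?w"
      unfolding l_def by (rule isoperimetric_first_variation[OF W v vel closed pos eq])
    moreover have "((\<lambda>t. cross2 (\<gamma> t) (?w t)) has_integral ?I d \<tau>1 u1 + ?I d \<tau>2 u2 + ?I d \<tau>3 u3) {0..1}"
      unfolding cross2.add_right by (intro has_integral_add yc) (use \<tau> d in auto)
    moreover have "length_in W ?w \<le> supp W u1 + supp W u2 + supp W u3"
    proof -
      note yb = has_velocityD(2,3)[OF ry] has_velocityD(2,3)[OF has_velocity_add[OF ry ry]]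
      have "length_in W ?w \<le> length_in W (\<lambda>t. y \<tau>1 u1 t + y \<tau>2 u2 t) + length_in W (y \<tau>3 u3)"
        by (rule length_in_add[OF W(1) Wne yb(3,4,1,2)])
      also have "length_in W (\<lambda>t. y \<tau>1 u1 t + y \<tau>2 u2 t) \<le> length_in W (y \<tau>1 u1) + length_in W (y \<tau>2 u2)"
        by (rule length_in_add[OF W(1) Wne yb(1,2,1,2)])
      finally show ?thesis using yl \<tau> d by simp
    qed
    ultimately show ?thesis using l by (auto simp: has_integral_iff intro: order_trans mult_left_mono)
  qed
  have "((\<lambda>d. ?I d \<tau>1 u1 + ?I d \<tau>2 u2 + ?I d \<tau>3 u3) \<longlongrightarrow> \<gamma> \<tau>1 \<bullet> u1 + \<gamma> \<tau>2 \<bullet> u2 + \<gamma> \<tau>3 \<bullet> u3) (at_right 0)"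
    by (intro tendsto_add interval_average_tendsto cont) (use \<tau> in auto)
  moreover have "\<forall>\<^sub>F d in at_right 0. ?I d \<tau>1 u1 + ?I d \<tau>2 u2 + ?I d \<tau>3 u3 \<le> l * (supp W u1 + supp W u2 + supp W u3)"
    unfolding eventually_at_right_field
    by (rule exI[of _ "min (1 - \<tau>1) (min (1 - \<tau>2) (1 - \<tau>3))"]) (use est \<tau> in auto)
  ultimately show ?thesis unfolding l_def[symmetric] by (rule tendsto_upperbound) simp
qed

text \<open>By Helly's theorem and compactness it suffices that the sets \<open>x - K\<close>, in which the translation has
  to be found, meet for any three points \<open>x\<close>.  If they do not, then the set of pairs of differences
  of points of three such sets misses the origin of \<open>complex \<times> complex\<close>, and a
  separating functional \<open>(u1, u2)\<close> violates the hypothesis with \<open>u3 = - (u1 + u2)\<close>.\<close>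

lemma common_translate:
  fixes X K :: "complex set"
  assumes K: "compact K" "convex K" "K \<noteq> {}" and X: "X \<noteq> {}"
    and three: "\<And>x1 x2 x3 u1 u2 u3. x1 \<in> X \<Longrightarrow> x2 \<in> X \<Longrightarrow> x3 \<in> X \<Longrightarrow> u1 + u2 + u3 = 0 \<Longrightarrow>
      x1 \<bullet> u1 + x2 \<bullet> u2 + x3 \<bullet> u3 \<le> supp K u1 + supp K u2 + supp K u3"
  obtains c where "\<And>x. x \<in> X \<Longrightarrow> x - c \<in> K"
proof -
  define F where "F x = (\<lambda>k. x - k) ` K" for x
  have memF: "c \<in> F x \<longleftrightarrow> x - c \<in> K" for c x unfolding F_def by (auto intro!: image_eqI[of _ _ "x - c"])
  have triple: "F x1 \<inter> F x2 \<inter> F x3 \<noteq> {}" if x: "x1 \<in> X" "x2 \<in> X" "x3 \<in> X" for x1 x2 x3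
  proof
    assume empty: "F x1 \<inter> F x2 \<inter> F x3 = {}"
    define L :: "complex \<times> complex \<times> complex \<Rightarrow> complex \<times> complex" where "L k = (snd (snd k) - fst k, snd (snd k) - fst (snd k))" for k
    have L: "linear L" unfolding L_def by (intro linearI) (auto simp: algebra_simps)
    define S where "S = (+) (x1 - x3, x2 - x3) ` L ` (K \<times> K \<times> K)"
    have "convex S" unfolding S_def using K by (intro convex_translation convex_linear_image L convex_Times)
    moreover have "compact S" unfolding S_def using K
      by (intro compact_translation compact_continuous_image compact_Times linear_continuous_on linear_conv_bounded_linear[THEN iffD1] L)
    moreover have "0 \<notin> S"
    proof
      assume "0 \<in> S"
      then obtain k1 k2 k3 where k: "k1 \<in> K" "k2 \<in> K" "k3 \<in> K" "x1 - x3 + (k3 - k1) = 0" "x2 - x3 + (k3 - k2) = 0"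
        unfolding S_def L_def by (auto simp: zero_prod_def)
      then have "x3 - k3 \<in> F x1 \<inter> F x2 \<inter> F x3" by (auto simp: memF) (simp_all add: algebra_simps)
      with empty show False by blast
    qed
    ultimately obtain a b where ab: "0 < b" "\<And>s. s \<in> S \<Longrightarrow> b < a \<bullet> s"
      using separating_hyperplane_closed_0[of S] compact_imp_closed by blast
    obtain u1 u2 where a: "a = (u1, u2)" by force
    obtain k1 k2 k3 where k: "k1 \<in> K" "k1 \<bullet> u1 = supp K u1" "k2 \<in> K" "k2 \<bullet> u2 = supp K u2" "k3 \<in> K" "k3 \<bullet> (- (u1 + u2)) = supp K (- (u1 + u2))"
      using supp_attained[OF K(1,3)] by metis
    have "(x1 - x3, x2 - x3) + L (k1, k2, k3) \<in> S" unfolding S_def using k by auto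
    from ab(2)[OF this] ab(1) have "0 < u1 \<bullet> (x1 - x3 + (k3 - k1)) + u2 \<bullet> (x2 - x3 + (k3 - k2))"
      by (simp add: a L_def)
    moreover have "x1 \<bullet> u1 + x2 \<bullet> u2 + x3 \<bullet> (- (u1 + u2)) \<le> k1 \<bullet> u1 + k2 \<bullet> u2 + k3 \<bullet> (- (u1 + u2))"
      unfolding k by (rule three) (use x in auto)
    ultimately show False by (simp add: inner_simps inner_commute algebra_simps)
  qed
  have small: "\<Inter>T \<noteq> {}" if T: "T \<subseteq> F ` X" "card T \<le> 3" "finite T" for T
  proof (cases "T = {}")
    case False
    then have "card T = 1 \<or> card T = 2 \<or> card T = 3" using T card_gt_0_iff[of T] by linarith
    then obtain P Q R where "T = {P, Q, R}"
      by (auto simp: card_1_singleton_iff card_2_iff card_3_iff)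
    moreover obtain x1 x2 x3 where "P = F x1" "Q = F x2" "R = F x3" "x1 \<in> X" "x2 \<in> X" "x3 \<in> X"
      using T(1) calculation by auto
    ultimately show ?thesis using triple[of x1 x2 x3] by auto
  qed simp
  have cv: "convex (F x)" "compact (F x)" for x
  proof -
    have "F x = (+) x ` uminus ` K" by (auto simp: F_def image_image)
    then show "convex (F x)" "compact (F x)" using K
      by (auto intro!: convex_translation convex_negations compact_translation compact_negations)
  qed
  have fin: "\<Inter>T \<noteq> {}" if T: "T \<subseteq> F ` X" "finite T" for T
  proof (cases "card T \<le> 3")
    case False
    show ?thesis
    proof (rule Helly)
      show "DIM(complex) + 1 \<le> card T" using False by simp
      show "\<Inter>t \<noteq> {}" if "t \<subseteq> T" "card t = DIM(complex) + 1" for t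
        by (rule small) (use that T finite_subset in auto)
    qed (use T cv in auto)
  qed (rule small[OF T(1) _ T(2)])
  obtain x0 where x0: "x0 \<in> X" using X by blast
  have "F x0 \<inter> \<Inter>(F ` X) \<noteq> {}"
  proof (rule compact_imp_fip[OF cv(2)])
    show "closed T" if "T \<in> F ` X" for T using that cv compact_imp_closed by blast
    show "F x0 \<inter> \<Inter>T \<noteq> {}" if "finite T" "T \<subseteq> F ` X" for T
      using fin[of "insert (F x0) T"] that x0 by auto
  qed
  then show ?thesis using that memF by blast
qed

lemma isoperimetric_equality_inscribed:
  assumes W: "compact W" "convex W" "interior W \<noteq> {}"
    and v: "has_velocity \<gamma> v" "\<gamma> 0 = \<gamma> 1" and pos: "0 < signed_area \<gamma>"
    and eq: "length_in W v = 2 * sqrt (signed_area \<gamma> * measure lebesgue W)"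
  obtains c where "\<And>t. t \<in> {0..1} \<Longrightarrow> \<gamma> t - c \<in> (\<lambda>x. sqrt (signed_area \<gamma> / measure lebesgue W) *\<^sub>R x) ` W"
proof -
  have Wne: "W \<noteq> {}" using W(3) interior_subset by auto
  define l where "l = sqrt (signed_area \<gamma> / measure lebesgue W)"
  have l: "0 \<le> l" using pos by (simp add: l_def)
  let ?K = "(\<lambda>x. l *\<^sub>R x) ` W"
  have K: "compact ?K" "convex ?K" "?K \<noteq> {}" using W Wne by (auto intro: compact_scaling convex_scaling)
  have sK: "l * supp W u \<le> supp ?K u" for u
  proof -
    obtain x where "x \<in> W" "x \<bullet> u = supp W u" using supp_attained[OF W(1) Wne] by blast
    then show ?thesis using supp_upper[OF K(1,3), of "l *\<^sub>R x" u] by auto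
  qed
  obtain c where c: "\<And>x. x \<in> \<gamma> ` {0..<1} \<Longrightarrow> x - c \<in> ?K"
  proof (rule common_translate[OF K])
    fix x1 x2 x3 u1 u2 u3 assume x: "x1 \<in> \<gamma> ` {0..<1}" "x2 \<in> \<gamma> ` {0..<1}" "x3 \<in> \<gamma> ` {0..<1}" "u1 + u2 + u3 = (0::complex)"
    then obtain t1 t2 t3 where t: "t1 \<in> {0..<1}" "t2 \<in> {0..<1}" "t3 \<in> {0..<1}" "x1 = \<gamma> t1" "x2 = \<gamma> t2" "x3 = \<gamma> t3" by blast
    have "x1 \<bullet> u1 + x2 \<bullet> u2 + x3 \<bullet> u3 \<le> l * (supp W u1 + supp W u2 + supp W u3)"
      unfolding t l_def by (rule three_point_inequality[OF W v pos eq t(1-3) x(4)])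
    also have "\<dots> \<le> supp ?K u1 + supp ?K u2 + supp ?K u3" unfolding distrib_left by (intro add_mono sK)
    finally show "x1 \<bullet> u1 + x2 \<bullet> u2 + x3 \<bullet> u3 \<le> supp ?K u1 + supp ?K u2 + supp ?K u3" .
  qed (auto intro: that)
  show ?thesis
  proof (rule that)
    fix t :: real assume "t \<in> {0..1}"
    then have "\<gamma> t \<in> \<gamma> ` {0..<1}" using v(2) by (cases "t = 1") (auto intro!: image_eqI[of _ _ 0])
    then show "\<gamma> t - c \<in> (\<lambda>x. sqrt (signed_area \<gamma> / measure lebesgue W) *\<^sub>R x) ` W"
      using c[of "\<gamma> t"] unfolding l_def by blast
  qed
qed

section \<open>Curves winding once around the boundary of a convex body\<close>

text \<open>The angle at which the curve is seen from \<open>c\<close> may pause but never decreases.  This is shared by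
  simple boundary loops and by their weakly monotone reparametrizations, up to orientation.\<close>

definition winds_once :: "complex \<Rightarrow> complex set \<Rightarrow> (real \<Rightarrow> complex) \<Rightarrow> bool" where
  "winds_once c K \<gamma> \<longleftrightarrow> (\<exists>\<theta>. continuous_on {0..1} \<theta> \<and> mono_on {0..1} \<theta> \<and> \<theta> 1 = \<theta> 0 + 2 * pi \<and>
     (\<forall>t\<in>{0..1}. \<gamma> t \<in> frontier K \<and> \<gamma> t - c = norm (\<gamma> t - c) *\<^sub>R cis (\<theta> t)))"

lemma cross2_cis: "cross2 (r *\<^sub>R cis a) (s *\<^sub>R cis b) = r * s * sin (b - a)"
  by (simp add: cross2_def sin_diff algebra_simps)

lemma frontier_ray_unique:
  fixes K :: "complex set"
  assumes K: "convex K" "c \<in> interior K" and xy: "x \<in> frontier K" "y \<in> frontier K"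
    and d: "x - c = r *\<^sub>R e" "y - c = s *\<^sub>R e" and rs: "0 \<le> r" "0 \<le> s"
  shows "x = y"
proof -
  have no: False if "x \<in> frontier K" "y \<in> frontier K" "x - c = r *\<^sub>R e" "y - c = s *\<^sub>R e" "0 \<le> r" "r < s" for x y and r s :: real
  proof -
    have "y - ((s - r) / s) *\<^sub>R (y - c) \<in> interior K"
      using that by (intro mem_interior_closure_convex_shrink[OF K]) (auto simp: frontier_def)
    moreover have "((s - r) / s) *\<^sub>R (y - c) = s *\<^sub>R e - r *\<^sub>R e"
      using that by (simp add: scaleR_diff_left[symmetric])
    moreover have "y - (s *\<^sub>R e - r *\<^sub>R e) = x" using that by (simp add: algebra_simps)
    ultimately have "x \<in> interior K" by simp
    with that show False by (simp add: frontier_def)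
  qed
  show ?thesis
  proof (cases r s rule: linorder_cases)
    case equal then show ?thesis using d by (metis diff_add_cancel)
  qed (use no[of x y r s] no[of y x s r] assms in auto)
qed

lemma frontier_neq_center: "c \<in> interior K \<Longrightarrow> x \<in> frontier K \<Longrightarrow> x \<noteq> c"
  by (auto simp: frontier_def)

lemma frontier_normal:
  fixes K :: "complex set"
  assumes K: "compact K" "convex K" "c \<in> interior K" and x: "x \<in> frontier K"
  obtains n where "norm n = 1" "\<And>y. y \<in> K \<Longrightarrow> (y - x) \<bullet> n \<le> 0"
proof -
  have ri: "rel_interior K = interior K" using K(3) by (metis empty_iff rel_interior_nonempty_interior)
  obtain a where a: "a \<noteq> 0" "\<And>y. y \<in> closure K \<Longrightarrow> a \<bullet> x \<le> a \<bullet> y"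
    by (rule supporting_hyperplane_relative_frontier[OF K(2), of x]) (use x ri in \<open>auto simp: frontier_def\<close>)
  show ?thesis
  proof (rule that)
    show "norm (- a /\<^sub>R norm a) = 1" using a by simp
    show "(y - x) \<bullet> (- a /\<^sub>R norm a) \<le> 0" if "y \<in> K" for y
      using a(2)[of y] closure_subset that by (auto simp: inner_simps inner_commute divide_simps)
  qed
qed

lemma normal_center_pos:
  fixes K :: "complex set"
  assumes c: "c \<in> interior K" and n: "n \<noteq> 0" "\<And>y. y \<in> K \<Longrightarrow> (y - x) \<bullet> n \<le> 0"
  shows "0 < (x - c) \<bullet> n"
proof -
  obtain e where e: "0 < e" "cball c e \<subseteq> K" using c by (meson mem_interior_cball)
  have "c + (e / norm n) *\<^sub>R n \<in> cball c e" using e n by (simp add: dist_norm)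
  then have "(c + (e / norm n) *\<^sub>R n - x) \<bullet> n \<le> 0" using e n by blast
  moreover have "0 < (e / norm n) * (n \<bullet> n)" using e n by simp
  ultimately show ?thesis by (simp add: inner_simps)
qed

text \<open>The functional given by any outward normal \<open>n\<close> is maximal at \<open>\<gamma> t\<close> along the curve, so \<open>n\<close> is
  orthogonal to \<open>v\<close>.  Of the two remaining directions the orientation selects \<open>- \<i> * v\<close>: the angle
  does not decrease, so \<open>cross2 (\<gamma> t - c) v \<ge> 0\<close>, whereas \<open>(\<gamma> t - c) \<bullet> n > 0\<close> as \<open>c\<close> is interior.\<close>

lemma winds_once_normal:
  assumes K: "compact K" "convex K" "c \<in> interior K" and w: "winds_once c K \<gamma>"
    and t: "t \<in> {0<..<1}" and v: "(\<gamma> has_vector_derivative v) (at t)"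
  shows "\<And>x. x \<in> K \<Longrightarrow> x \<bullet> (- \<i> * v) \<le> \<gamma> t \<bullet> (- \<i> * v)"
    and "v \<noteq> 0 \<Longrightarrow> outward_normal K (\<gamma> t) = (- \<i> * v) /\<^sub>R norm v"
    and "\<And>n. v \<noteq> 0 \<Longrightarrow> norm n = 1 \<Longrightarrow> (\<And>x. x \<in> K \<Longrightarrow> (x - \<gamma> t) \<bullet> n \<le> 0) \<Longrightarrow> n = (- \<i> * v) /\<^sub>R norm v"
proof -
  obtain \<theta> where \<theta>: "continuous_on {0..1} \<theta>" "mono_on {0..1} \<theta>"
    "\<And>t. t \<in> {0..1} \<Longrightarrow> \<gamma> t \<in> frontier K" "\<And>t. t \<in> {0..1} \<Longrightarrow> \<gamma> t - c = norm (\<gamma> t - c) *\<^sub>R cis (\<theta> t)"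
    using w unfolding winds_once_def by blast
  have fr: "\<gamma> t \<in> frontier K" using \<theta>(3) t by auto
  have KK: "frontier K \<subseteq> K" using K(1) by (simp add: compact_imp_closed frontier_subset_closed)
  have cr: "0 \<le> cross2 (\<gamma> t - c) v"
  proof (rule ccontr)
    assume "\<not> 0 \<le> cross2 (\<gamma> t - c) v"
    have "((\<lambda>s. cross2 (\<gamma> t - c) (\<gamma> s - c)) has_real_derivative cross2 (\<gamma> t - c) v) (at t)"
      unfolding has_real_derivative_iff_has_vector_derivative
      by (rule bounded_linear.has_vector_derivative[OF cross2.bounded_linear_right]) (use v in \<open>auto intro!: derivative_eq_intros\<close>)
    from DERIV_neg_dec_right[OF this] \<open>\<not> 0 \<le> cross2 (\<gamma> t - c) v\<close>
    obtain d where d: "0 < d" "\<And>h. 0 < h \<Longrightarrow> h < d \<Longrightarrow> cross2 (\<gamma> t - c) (\<gamma> (t + h) - c) < 0" by auto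
    obtain d' where d': "0 < d'" "\<And>s. s \<in> {0..1} \<Longrightarrow> dist s t < d' \<Longrightarrow> dist (\<theta> s) (\<theta> t) < pi"
      using \<theta>(1) t unfolding continuous_on_iff by (metis greaterThanLessThan_subseteq_atLeastAtMost_iff order_refl pi_gt_zero subsetD)
    define h where "h = min (d/2) (min (d'/2) (1 - t))"
    have h: "0 < h" "h < d" "h < d'" "t + h \<le> 1" using d(1) d'(1) t by (auto simp: h_def)
    then have s: "t + h \<in> {0..1}" using t by auto
    have "\<theta> t \<le> \<theta> (t + h)" using \<theta>(2) s t h by (auto simp: mono_on_def)
    moreover have "\<theta> (t + h) - \<theta> t < pi" using d'(2)[OF s] h by (auto simp: dist_real_def)
    ultimately have "0 \<le> sin (\<theta> (t + h) - \<theta> t)" by (intro sin_ge_zero) auto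
    then have "0 \<le> cross2 (norm (\<gamma> t - c) *\<^sub>R cis (\<theta> t)) (norm (\<gamma> (t + h) - c) *\<^sub>R cis (\<theta> (t + h)))"
      unfolding cross2_cis by simp
    then have "0 \<le> cross2 (\<gamma> t - c) (\<gamma> (t + h) - c)" using \<theta>(4) s t by (metis greaterThanLessThan_subseteq_atLeastAtMost_iff order_refl subsetD)
    with d(2)[OF h(1,2)] show False by simp
  qed
  have normal: "v \<noteq> 0 \<Longrightarrow> n = (- \<i> * v) /\<^sub>R norm v" if n: "norm n = 1" "\<And>y. y \<in> K \<Longrightarrow> (y - \<gamma> t) \<bullet> n \<le> 0" for n
  proof -
    assume v0: "v \<noteq> 0"
    have "((\<lambda>s. \<gamma> s \<bullet> n) has_real_derivative v \<bullet> n) (at t)"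
      using v unfolding has_real_derivative_iff_has_vector_derivative
      by (intro bounded_linear.has_vector_derivative[OF bounded_linear_inner_left])
    then have vn: "v \<bullet> n = 0"
    proof (rule DERIV_local_max)
      show "0 < min t (1 - t)" using t by auto
      show "\<forall>y. \<bar>t - y\<bar> < min t (1 - t) \<longrightarrow> \<gamma> y \<bullet> n \<le> \<gamma> t \<bullet> n"
      proof (intro allI impI)
        fix y assume "\<bar>t - y\<bar> < min t (1 - t)"
        then have "y \<in> {0..1}" by auto
        then have "\<gamma> y \<in> K" using \<theta>(3) KK by auto
        from n(2)[OF this] show "\<gamma> y \<bullet> n \<le> \<gamma> t \<bullet> n" by (simp add: inner_diff_left)
      qed
    qed
    define u where "u = (- \<i> * v) /\<^sub>R norm v"
    have u: "norm u = 1" using v0 by (simp add: u_def norm_mult)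
    have vu: "v = norm v *\<^sub>R (\<i> * u)" using v0 by (simp add: u_def)
    have "(\<i> * u) \<bullet> n = 0" using vn vu v0 by (metis inner_scaleR_left mult_eq_0_iff norm_eq_zero)
    then have orth: "Re u * Im n = Im u * Re n" by (simp add: inner_complex_def)
    define k where "k = u \<bullet> n"
    have u1: "(Re u)\<^sup>2 + (Im u)\<^sup>2 = 1" using u by (simp add: cmod_def)
    have "Re n = k * Re u"
    proof -
      have "k * Re u = (Re u)\<^sup>2 * Re n + Im u * (Re u * Im n)" by (simp add: k_def inner_complex_def power2_eq_square algebra_simps)
      also have "\<dots> = ((Re u)\<^sup>2 + (Im u)\<^sup>2) * Re n" unfolding orth by (simp add: power2_eq_square algebra_simps)
      finally show ?thesis using u1 by simp
    qed
    moreover have "Im n = k * Im u"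
    proof -
      have "k * Im u = (Im u)\<^sup>2 * Im n + Re u * (Im u * Re n)" by (simp add: k_def inner_complex_def power2_eq_square algebra_simps)
      also have "\<dots> = ((Re u)\<^sup>2 + (Im u)\<^sup>2) * Im n" unfolding orth[symmetric] by (simp add: power2_eq_square algebra_simps)
      finally show ?thesis using u1 by simp
    qed
    ultimately have nk: "n = k *\<^sub>R u" by (simp add: complex_eq_iff)
    have "0 < (\<gamma> t - c) \<bullet> n" by (rule normal_center_pos[OF K(3)]) (use n in auto)
    moreover have "(\<gamma> t - c) \<bullet> n = k / norm v * cross2 (\<gamma> t - c) v"
      unfolding nk u_def by (simp add: cross2_inner[symmetric] divide_inverse)
    ultimately have "0 < k / norm v * cross2 (\<gamma> t - c) v" by simp
    then have "0 < k" using cr v0 by (simp add: zero_less_mult_iff zero_less_divide_iff)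
    moreover have "\<bar>k\<bar> = 1" using nk n(1) u by simp
    ultimately show ?thesis using nk by (simp add: u_def)
  qed
  show "n = (- \<i> * v) /\<^sub>R norm v" if "v \<noteq> 0" "norm n = 1" "\<And>x. x \<in> K \<Longrightarrow> (x - \<gamma> t) \<bullet> n \<le> 0" for n
    by (rule normal[OF that(2,3,1)])
  obtain n0 where n0: "norm n0 = 1" "\<And>y. y \<in> K \<Longrightarrow> (y - \<gamma> t) \<bullet> n0 \<le> 0" using frontier_normal[OF K fr] by metis
  show "x \<bullet> (- \<i> * v) \<le> \<gamma> t \<bullet> (- \<i> * v)" if "x \<in> K" for x
  proof (cases "v = 0")
    case False
    then have "- \<i> * v = norm v *\<^sub>R n0" using normal[OF n0] by simp
    then show ?thesis using n0(2)[OF that] by (simp add: inner_diff_left mult_left_mono)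
  qed simp
  show "outward_normal K (\<gamma> t) = (- \<i> * v) /\<^sub>R norm v" if "v \<noteq> 0"
    unfolding outward_normal_def
  proof (rule the_equality)
    show "norm ((- \<i> * v) /\<^sub>R norm v) = 1 \<and> (\<forall>x\<in>K. (x - \<gamma> t) \<bullet> ((- \<i> * v) /\<^sub>R norm v) \<le> 0)"
      using normal[OF n0 that] n0 by simp
  qed (use normal that in blast)
qed

lemma winds_once_surj:
  assumes K: "convex K" "c \<in> interior K" and w: "winds_once c K \<gamma>" and x: "x \<in> frontier K"
  shows "x \<in> \<gamma> ` {0..1}"
proof -
  obtain \<theta> where \<theta>: "continuous_on {0..1} \<theta>" "\<theta> 1 = \<theta> 0 + 2 * pi"
    "\<And>t. t \<in> {0..1} \<Longrightarrow> \<gamma> t \<in> frontier K" "\<And>t. t \<in> {0..1} \<Longrightarrow> \<gamma> t - c = norm (\<gamma> t - c) *\<^sub>R cis (\<theta> t)"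
    using w unfolding winds_once_def by blast
  obtain \<phi> where \<phi>: "\<theta> 0 \<le> \<phi>" "\<phi> \<le> \<theta> 0 + 2 * pi" "x - c = norm (x - c) *\<^sub>R cis \<phi>"
  proof -
    define k where "k = \<lceil>(\<theta> 0 - Arg (x - c)) / (2 * pi)\<rceil>"
    have k: "(\<theta> 0 - Arg (x - c)) / (2 * pi) \<le> k" "k < (\<theta> 0 - Arg (x - c)) / (2 * pi) + 1" unfolding k_def by linarith+
    have "cis (Arg (x - c) + 2 * pi * k) = cis (Arg (x - c))"
      by (simp add: cis_mult[symmetric] cis_multiple_2pi)
    moreover have "x - c = norm (x - c) *\<^sub>R cis (Arg (x - c))"
      using frontier_neq_center[OF K(2) x] by (simp add: cis_Arg sgn_div_norm)
    ultimately show ?thesis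
      using k by (intro that[of "Arg (x - c) + 2 * pi * k"]) (auto simp: field_simps)
  qed
  obtain t where t: "0 \<le> t" "t \<le> 1" "\<theta> t = \<phi>" using IVT'[of \<theta> 0 \<phi> 1] \<theta>(1,2) \<phi> by auto
  have "x = \<gamma> t"
    by (rule frontier_ray_unique[OF K x _ \<phi>(3) \<theta>(4)[of t, unfolded t(3)]]) (use \<theta>(3) t in auto)
  with t show ?thesis by auto
qed

lemma cis_between:
  assumes "A \<le> \<phi>" "\<phi> \<le> B" "B - A < pi"
  obtains \<alpha> \<beta> where "0 \<le> \<alpha>" "0 \<le> \<beta>" "cis \<phi> = \<alpha> *\<^sub>R cis A + \<beta> *\<^sub>R cis B"
proof (cases "A = B")
  case True
  then show ?thesis using assms by (intro that[of 1 0]) auto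
next
  case False
  then have s: "0 < sin (B - A)" using assms by (intro sin_gt_zero) auto
  have re: "cos \<phi> * sin (B - A) = sin (B - \<phi>) * cos A + sin (\<phi> - A) * cos B"
    by (simp add: sin_diff algebra_simps)
  have "sin \<phi> * sin (B - A) = sin (B - \<phi>) * sin A + sin (\<phi> - A) * sin B"
    by (simp add: sin_diff algebra_simps)
  with re s have "cis \<phi> = (sin (B - \<phi>) / sin (B - A)) *\<^sub>R cis A + (sin (\<phi> - A) / sin (B - A)) *\<^sub>R cis B"
    by (simp add: complex_eq_iff field_simps)
  moreover have "0 \<le> sin (B - \<phi>)" "0 \<le> sin (\<phi> - A)" using assms by (auto intro!: sin_ge_zero)
  ultimately show ?thesis using s by (intro that) auto
qed

text \<open>If a point of \<open>K\<close> lies beyond \<open>z\<close> in the direction \<open>d\<close>, a normal at \<open>z\<close> cannot point along \<open>d\<close>.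
  So adding a multiple of \<open>d\<close> to \<open>\<alpha> *\<^sub>R p\<close> does not help \<open>z\<close> to reach the supporting line.\<close>

lemma frontier_cone_factor:
  fixes K :: "complex set"
  assumes K: "compact K" "convex K" "0 \<in> interior K" and z: "z \<in> frontier K" and p: "p \<in> K"
    and zp: "z = \<alpha> *\<^sub>R p + \<beta> *\<^sub>R d" "0 \<le> \<alpha>" "0 \<le> \<beta>" and k: "z + k *\<^sub>R d \<in> K" "0 < k"
  shows "1 \<le> \<alpha>"
proof -
  obtain n where n: "norm n = 1" "\<And>y. y \<in> K \<Longrightarrow> (y - z) \<bullet> n \<le> 0" using frontier_normal[OF K z] by metis
  have zn: "0 < z \<bullet> n" using normal_center_pos[OF K(3), of n z] n by fastforce
  have "d \<bullet> n \<le> 0" using n(2)[OF k(1)] k(2) by (simp add: mult_le_0_iff)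
  then have "z \<bullet> n \<le> \<alpha> * (p \<bullet> n)" using zp(3) by (subst zp(1)) (simp add: inner_add_left mult_nonneg_nonpos)
  also have "\<dots> \<le> \<alpha> * (z \<bullet> n)" using n(2)[OF p] zp(2) by (intro mult_left_mono) (auto simp: inner_diff_left)
  finally show ?thesis using zn by simp
qed

text \<open>The angle \<open>D\<close> is that of a vertical direction.  It splits the arc from \<open>p\<close> to \<open>q\<close> in two parts of
  angle less than \<open>pi\<close>, and in each of them \<open>z\<close> lies in the cone spanned by the vertical direction
  and one of \<open>p\<close> and \<open>q\<close>.\<close>

lemma frontier_arc_vertical:
  fixes K :: "complex set"
  assumes K: "compact K" "convex K" "0 \<in> interior K" and z: "z \<in> frontier K" "z = norm z *\<^sub>R cis \<phi>"
    and p: "p \<in> K" "p \<noteq> 0" "p = norm p *\<^sub>R cis A" and q: "q \<in> K" "q \<noteq> 0" "q = norm q *\<^sub>R cis B"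
    and ord: "A \<le> \<phi>" "\<phi> \<le> B" "A \<le> D" "D \<le> B" "D - A < pi" "B - D < pi"
    and k: "z + k *\<^sub>R cis D \<in> K" "0 < k" and D: "cos D = 0"
  shows "\<exists>\<alpha>\<ge>1. Re z = \<alpha> * Re p \<or> Re z = \<alpha> * Re q"
proof (cases "\<phi> \<le> D")
  case True
  then obtain \<alpha> \<beta> where ab: "0 \<le> \<alpha>" "0 \<le> \<beta>" "cis \<phi> = \<alpha> *\<^sub>R cis A + \<beta> *\<^sub>R cis D"
    using cis_between[of A \<phi> D] ord by metis
  define \<alpha>' where "\<alpha>' = norm z * \<alpha> / norm p"
  have "\<alpha>' *\<^sub>R p = (norm z * \<alpha>) *\<^sub>R cis A" using p(2) by (subst p(3)) (simp add: \<alpha>'_def)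
  then have zz: "z = \<alpha>' *\<^sub>R p + (norm z * \<beta>) *\<^sub>R cis D" by (subst z(2)) (simp add: ab(3) scaleR_add_right)
  have "1 \<le> \<alpha>'" by (rule frontier_cone_factor[OF K z(1) p(1) zz _ _ k]) (use ab in \<open>auto simp: \<alpha>'_def\<close>)
  moreover have "Re z = \<alpha>' * Re p" by (subst zz) (simp add: D)
  ultimately show ?thesis by blast
next
  case False
  then obtain \<alpha> \<beta> where ab: "0 \<le> \<alpha>" "0 \<le> \<beta>" "cis \<phi> = \<alpha> *\<^sub>R cis D + \<beta> *\<^sub>R cis B"
    using cis_between[of D \<phi> B] ord by (metis linear)
  define \<beta>' where "\<beta>' = norm z * \<beta> / norm q"
  have "\<beta>' *\<^sub>R q = (norm z * \<beta>) *\<^sub>R cis B" using q(2) by (subst q(3)) (simp add: \<beta>'_def)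
  then have zz: "z = \<beta>' *\<^sub>R q + (norm z * \<alpha>) *\<^sub>R cis D" by (subst z(2)) (simp add: ab(3) scaleR_add_right)
  have "1 \<le> \<beta>'" by (rule frontier_cone_factor[OF K z(1) q(1) zz _ _ k]) (use ab in \<open>auto simp: \<beta>'_def\<close>)
  moreover have "Re z = \<beta>' * Re q" by (subst zz) (simp add: D)
  ultimately show ?thesis by blast
qed

lemma angle_normalize:
  obtains m :: int where "x \<le> a + 2 * pi * m" "a + 2 * pi * m < x + 2 * pi"
proof -
  define m where "m = \<lceil>(x - a) / (2 * pi)\<rceil>"
  have "(x - a) / (2 * pi) \<le> m" "m < (x - a) / (2 * pi) + 1" unfolding m_def by linarith+
  then show ?thesis by (intro that[of m]) (auto simp: field_simps)
qed

lemma cos_neg_normalize: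
  assumes "cos a < 0"
  obtains m :: int where "pi / 2 < a + 2 * pi * m" "a + 2 * pi * m < 3 * pi / 2"
proof -
  obtain m :: int where m: "- pi / 2 \<le> a + 2 * pi * m" "a + 2 * pi * m < - pi / 2 + 2 * pi"
    by (rule angle_normalize)
  have c: "cos (a + 2 * pi * m) < 0" using assms cos_int_2pin[of m] sin_int_2pin[of m] by (simp add: cos_add)
  have "\<not> a + 2 * pi * m \<le> pi / 2" using cos_ge_zero[of "a + 2 * pi * m"] c m by linarith
  then show ?thesis using m by (intro that[of m]) auto
qed

text \<open>Going counterclockwise from a leftmost point \<open>p\<close> to a rightmost point \<open>q\<close>, the angle passes
  \<open>3 * pi / 2\<close>; a point on this arc that is not on the lower boundary would, by the preceding
  lemma, be at least as far left as \<open>p\<close> or as far right as \<open>q\<close>.  The way back passes \<open>pi / 2\<close>.  The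
  two conclusions differ in which of \<open>p\<close>, \<open>q\<close> the curve reaches first.\<close>

lemma winds_once_left_right:
  fixes K :: "complex set"
  assumes K: "compact K" "convex K" "0 \<in> interior K" and w: "winds_once 0 K \<gamma>"
    and ab: "Re ` K = {a..b}" and ends: "t0 \<in> {0..1}" "Re (\<gamma> t0) = a" "t1 \<in> {0..1}" "Re (\<gamma> t1) = b"
    and t: "t \<in> {0..1}" "a < Re (\<gamma> t)" "Re (\<gamma> t) < b"
  shows "t0 \<le> t1 \<Longrightarrow> Im (\<gamma> t) = (if t0 \<le> t \<and> t \<le> t1 then lower_graph K (Re (\<gamma> t)) else upper_graph K (Re (\<gamma> t)))"
    and "t1 \<le> t0 \<Longrightarrow> Im (\<gamma> t) = (if t1 \<le> t \<and> t \<le> t0 then upper_graph K (Re (\<gamma> t)) else lower_graph K (Re (\<gamma> t)))"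
proof -
  obtain \<theta> where \<theta>: "mono_on {0..1} \<theta>" "\<theta> 1 = \<theta> 0 + 2 * pi"
    "\<And>t. t \<in> {0..1} \<Longrightarrow> \<gamma> t \<in> frontier K" "\<And>t. t \<in> {0..1} \<Longrightarrow> \<gamma> t - 0 = norm (\<gamma> t - 0) *\<^sub>R cis (\<theta> t)"
    using w unfolding winds_once_def by blast
  have \<theta>4: "\<gamma> t = norm (\<gamma> t) *\<^sub>R cis (\<theta> t)" if "t \<in> {0..1}" for t using \<theta>(4)[OF that] by simp
  have mono: "\<theta> s \<le> \<theta> t" if "0 \<le> s" "s \<le> t" "t \<le> 1" for s t using \<theta>(1) that by (auto simp: mono_on_def)
  have KK: "frontier K \<subseteq> K" using K(1) by (simp add: compact_imp_closed frontier_subset_closed)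
  let ?p = "\<gamma> t0" and ?q = "\<gamma> t1" and ?z = "\<gamma> t"
  have a0: "a < 0" "0 < b"
  proof -
    obtain e where e: "0 < e" "cball 0 e \<subseteq> K" using K(3) by (meson mem_interior_cball)
    then have "complex_of_real (- e) \<in> K" "complex_of_real e \<in> K" by auto
    then have "- e \<in> Re ` K" "e \<in> Re ` K" by force+
    then show "a < 0" "0 < b" using e(1) unfolding ab by auto
  qed
  have mem: "?p \<in> K" "?q \<in> K" "?z \<in> K" "?p \<noteq> 0" "?q \<noteq> 0" using \<theta>(3) ends(1,3) t(1) KK a0 ends(2,4) by auto
  have "Re ?p = norm ?p * cos (\<theta> t0)" "Re ?q = norm ?q * cos (\<theta> t1)"
    by (subst \<theta>4; use ends(1,3) in simp)+
  then have cs: "cos (\<theta> t0) < 0" "0 < cos (\<theta> t1)" using a0 ends(2,4)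
    by (simp_all add: mult_less_0_iff zero_less_mult_iff)
  have cs': "cos (\<theta> t1 + pi) < 0" using cs by simp
  note vs = vertical_slice[OF K(1,2) mem(3)]
  have no: False if h: "\<alpha> \<ge> 1" "Re ?z = \<alpha> * Re ?p \<or> Re ?z = \<alpha> * Re ?q" for \<alpha>
  proof -
    have "\<alpha> * a \<le> a" "b \<le> \<alpha> * b" using h(1) a0 by (simp_all add: mult_le_cancel_right1 mult_le_cancel_left1 mult_le_cancel_right2)
    then show False using h(2) t ends(2,4) by auto
  qed
  have cisT: "cis (x + 2 * pi * real_of_int m) = cis x" for x m by (simp add: cis_mult[symmetric] cis_multiple_2pi)
  have z: "?z \<in> frontier K" "?z = norm ?z *\<^sub>R cis (\<theta> t + 2 * pi * real_of_int m)" for m using \<theta>(3) \<theta>4 t(1) cisT by auto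
  have p: "?p = norm ?p *\<^sub>R cis (\<theta> t0 + 2 * pi * real_of_int m)" for m using \<theta>4 ends(1) cisT by auto
  have q: "?q = norm ?q *\<^sub>R cis (\<theta> t1 + 2 * pi * real_of_int m)" for m using \<theta>4 ends(3) cisT by auto
  have low: "Im ?z = lower_graph K (Re ?z)"
    if h: "\<theta> t0 + 2 * pi * real_of_int m0 \<le> \<theta> t + 2 * pi * real_of_int m" "\<theta> t + 2 * pi * real_of_int m \<le> \<theta> t1 + 2 * pi * real_of_int m1"
      "pi/2 < \<theta> t0 + 2 * pi * real_of_int m0" "\<theta> t0 + 2 * pi * real_of_int m0 < 3*pi/2"
      "3*pi/2 < \<theta> t1 + 2 * pi * real_of_int m1" "\<theta> t1 + 2 * pi * real_of_int m1 < 5*pi/2" for m0 m m1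
  proof (rule ccontr)
    assume "Im ?z \<noteq> lower_graph K (Re ?z)"
    then have k: "0 < Im ?z - lower_graph K (Re ?z)" using vs(5) by simp
    have D: "cis (3*pi/2) = -\<i>" using cos_3over2_pi sin_3over2_pi by (simp add: complex_eq_iff)
    have "?z + (Im ?z - lower_graph K (Re ?z)) *\<^sub>R cis (3*pi/2) = Complex (Re ?z) (lower_graph K (Re ?z))"
      unfolding D by (simp add: complex_eq_iff)
    then have kK: "?z + (Im ?z - lower_graph K (Re ?z)) *\<^sub>R cis (3*pi/2) \<in> K" using vs(3) by simp
    have "\<exists>\<alpha>\<ge>1. Re ?z = \<alpha> * Re ?p \<or> Re ?z = \<alpha> * Re ?q"
      by (rule frontier_arc_vertical[OF K z(1) z(2)[of m] mem(1,4) p[of m0] mem(2,5) q[of m1] _ _ _ _ _ _ kK k])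
         (use h cos_3over2_pi in auto)
    then show False using no by blast
  qed
  have up: "Im ?z = upper_graph K (Re ?z)"
    if h: "\<theta> t1 + 2 * pi * real_of_int m1 \<le> \<theta> t + 2 * pi * real_of_int m" "\<theta> t + 2 * pi * real_of_int m \<le> \<theta> t0 + 2 * pi * real_of_int m0"
      "-pi/2 < \<theta> t1 + 2 * pi * real_of_int m1" "\<theta> t1 + 2 * pi * real_of_int m1 < pi/2"
      "pi/2 < \<theta> t0 + 2 * pi * real_of_int m0" "\<theta> t0 + 2 * pi * real_of_int m0 < 3*pi/2" for m0 m m1
  proof (rule ccontr)
    assume "Im ?z \<noteq> upper_graph K (Re ?z)"
    then have k: "0 < upper_graph K (Re ?z) - Im ?z" using vs(4) by simp
    have "?z + (upper_graph K (Re ?z) - Im ?z) *\<^sub>R cis (pi/2) = Complex (Re ?z) (upper_graph K (Re ?z))"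
      by (simp add: complex_eq_iff)
    then have kK: "?z + (upper_graph K (Re ?z) - Im ?z) *\<^sub>R cis (pi/2) \<in> K" using vs(2) by simp
    have "\<exists>\<alpha>\<ge>1. Re ?z = \<alpha> * Re ?q \<or> Re ?z = \<alpha> * Re ?p"
      by (rule frontier_arc_vertical[OF K z(1) z(2)[of m] mem(2,5) q[of m1] mem(1,4) p[of m0] _ _ _ _ _ _ kK k])
         (use h in auto)
    then show False using no by blast
  qed
  \<comment> \<open>The angles of \<open>p\<close> and \<open>q\<close> are moved to the left and to the right half of a full turn; monotonicity
      of \<open>\<theta>\<close> then determines how the two numbers of turns are related.\<close>
  obtain m0 :: int where m0: "pi/2 < \<theta> t0 + 2 * pi * real_of_int m0" "\<theta> t0 + 2 * pi * real_of_int m0 < 3*pi/2"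
    by (rule cos_neg_normalize[OF cs(1)])
  obtain m1 :: int where m1: "pi/2 < \<theta> t1 + pi + 2 * pi * real_of_int m1" "\<theta> t1 + pi + 2 * pi * real_of_int m1 < 3*pi/2"
    by (rule cos_neg_normalize[OF cs'])
  have pm: "2 * pi * real_of_int (x + 1) = 2 * pi * real_of_int x + 2 * pi" "2 * pi * real_of_int (x - 1) = 2 * pi * real_of_int x - 2 * pi" for x by (auto simp: algebra_simps)
  have intbound: "x \<le> y" if "2 * pi * real_of_int x < 2 * pi * real_of_int y + 2 * pi" for x y :: int
  proof -
    have "2 * pi * real_of_int x < 2 * pi * real_of_int (y + 1)" using that by (simp add: algebra_simps)
    then have "real_of_int x < real_of_int (y + 1)" by simp
    then show ?thesis by linarith
  qed
  show "Im ?z = (if t0 \<le> t \<and> t \<le> t1 then lower_graph K (Re ?z) else upper_graph K (Re ?z))" if le: "t0 \<le> t1"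
  proof -
    have r: "\<theta> t0 \<le> \<theta> t1" "\<theta> t1 \<le> \<theta> t0 + 2 * pi" using mono[of t0 t1] mono[of 0 t0] mono[of t1 1] \<theta>(2) ends(1,3) le by auto
    have "m0 \<le> m1 + 1" by (rule intbound, unfold pm) (use r m0 m1 in linarith)
    moreover have "m1 + 1 \<le> m0" by (rule intbound, unfold pm) (use r m0 m1 in linarith)
    ultimately have mm: "m1 = m0 - 1" by simp
    have m1': "\<theta> t1 + 2 * pi * real_of_int m1 = \<theta> t1 + 2 * pi * real_of_int m0 - 2 * pi" unfolding mm pm by simp
    show ?thesis
    proof (cases "t0 \<le> t \<and> t \<le> t1")
      case True
      have "Im ?z = lower_graph K (Re ?z)"
        by (rule low[of m0 m0 m0]) (use True mono[of t0 t] mono[of t t1] ends(1,3) m0 m1 m1' in auto)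
      with True show ?thesis by simp
    next
      case False
      then consider "t < t0" | "t1 < t" by linarith
      then have "Im ?z = upper_graph K (Re ?z)"
      proof cases
        case 1
        show ?thesis
          by (rule up[of m1 m0 m0]) (use 1 mono[of t t0] mono[of 0 t] mono[of t1 1] \<theta>(2) t ends(1,3) m0 m1 m1' in auto)
      next
        case 2
        show ?thesis
          by (rule up[of m1 m1 m0]) (use 2 mono[of t1 t] mono[of t 1] mono[of 0 t0] \<theta>(2) t ends(1,3) m0 m1 m1' in auto)
      qed
      with False show ?thesis by auto
    qed
  qed
  show "Im ?z = (if t1 \<le> t \<and> t \<le> t0 then upper_graph K (Re ?z) else lower_graph K (Re ?z))" if le: "t1 \<le> t0"
  proof -
    have r: "\<theta> t1 \<le> \<theta> t0" "\<theta> t0 \<le> \<theta> t1 + 2 * pi" using mono[of t1 t0] mono[of 0 t1] mono[of t0 1] \<theta>(2) ends(1,3) le by auto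
    have "m0 \<le> m1" by (rule intbound) (use r m0 m1 in simp)
    moreover have "m1 \<le> m0" by (rule intbound) (use r m0 m1 in simp)
    ultimately have mm: "m1 = m0" by simp
    have m1': "\<theta> t1 + 2 * pi * real_of_int (m0 + 1) = \<theta> t1 + 2 * pi * real_of_int m0 + 2 * pi"
       "\<theta> t + 2 * pi * real_of_int (m0 + 1) = \<theta> t + 2 * pi * real_of_int m0 + 2 * pi" unfolding pm by simp_all
    show ?thesis
    proof (cases "t1 \<le> t \<and> t \<le> t0")
      case True
      have "Im ?z = upper_graph K (Re ?z)"
        by (rule up[of m0 m0 m0]) (use True mono[of t1 t] mono[of t t0] ends(1,3) m0 m1 mm in auto)
      with True show ?thesis by simp
    next
      case False
      then consider "t < t1" | "t0 < t" by linarith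
      then have "Im ?z = lower_graph K (Re ?z)"
      proof cases
        case 1
        show ?thesis
          by (rule low[of m0 "m0 + 1" "m0 + 1"]) (unfold m1', use 1 mono[of t t1] mono[of 0 t] mono[of t0 1] \<theta>(2) t ends(1,3) m0 m1 mm in auto)
      next
        case 2
        show ?thesis
          by (rule low[of m0 m0 "m0 + 1"]) (unfold m1', use 2 mono[of t0 t] mono[of t 1] mono[of 0 t1] \<theta>(2) t ends(1,3) m0 m1 mm in auto)
      qed
      with False show ?thesis by auto
    qed
  qed
qed

text \<open>The curve follows the lower boundary from left to right and the upper boundary back, except
  possibly on vertical segments at the left and right ends.  There the real part is extremal, so
  its derivative vanishes, and the imaginary part does not matter for \<open>y dx\<close>.\<close>

lemma winds_once_area_origin:
  assumes K: "compact K" "convex K" "0 \<in> interior K" and w: "winds_once 0 K \<gamma>"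
    and v: "has_velocity \<gamma> v" and cl: "\<gamma> 0 = \<gamma> 1"
  shows "signed_area \<gamma> = measure lebesgue K"
proof -
  have "interior K \<noteq> {}" using K(3) by blast
  then obtain a b where ab: "a < b" "Re ` K = {a..b}" using convex_body_shadow[OF K(1,2)] by blast
  note cont = upper_graph_continuous[OF K(1,2) ab(2)] lower_graph_continuous[OF K(1,2) ab(2)]
  have KK: "frontier K \<subseteq> K" using K(1) by (simp add: compact_imp_closed frontier_subset_closed)
  have fr: "\<gamma> t \<in> frontier K" if "t \<in> {0..1}" for t using w that unfolding winds_once_def by blast
  then have rng: "Re (\<gamma> t) \<in> {a..b}" if "t \<in> {0..1}" for t using KK that ab(2) by blast
  have hit: "\<exists>t\<in>{0..1}. Re (\<gamma> t) = Re x" if x: "x \<in> K" "Re x = a \<or> Re x = b" for x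
  proof -
    have "x \<notin> interior K"
    proof
      assume "x \<in> interior K"
      then obtain e where e: "0 < e" "cball x e \<subseteq> K" by (meson mem_interior_cball)
      then have "x + of_real e \<in> K" "x - of_real e \<in> K" by (auto simp: dist_norm)
      then have "Re x + e \<in> Re ` K" "Re x - e \<in> Re ` K" by (force intro: image_eqI)+
      then show False using x(2) e(1) ab by auto
    qed
    then have "x \<in> frontier K" using x(1) closure_subset by (auto simp: frontier_def)
    then show ?thesis using winds_once_surj[OF K(2,3) w] by blast
  qed
  have "a \<in> Re ` K" "b \<in> Re ` K" using ab by auto
  then obtain t0 t1 where t: "t0 \<in> {0..1}" "Re (\<gamma> t0) = a" "t1 \<in> {0..1}" "Re (\<gamma> t1) = b"
    using hit by (metis imageE)
  have area: "measure lebesgue K = integral {a..b} (upper_graph K) - integral {a..b} (lower_graph K)"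
    by (rule convex_body_area[OF K(1,2) ab(2)])
  obtain F2 where F2: "\<And>t. t \<in> {0..1} \<Longrightarrow> a < Re (\<gamma> t) \<Longrightarrow> Re (\<gamma> t) < b \<Longrightarrow> Im (\<gamma> t) = F2 t"
    and int: "((\<lambda>t. F2 t * Re (v t)) has_integral - measure lebesgue K) {0..1}"
  proof (cases "t0 \<le> t1")
    case True
    show ?thesis
    proof (rule that)
      show "((\<lambda>t. (if t0 \<le> t \<and> t \<le> t1 then lower_graph K (Re (\<gamma> t)) else upper_graph K (Re (\<gamma> t))) * Re (v t)) has_integral - measure lebesgue K) {0..1}"
        using graph_loop_integral[OF v cl rng cont(2,1), of t0 t1] True t area by simp
    qed (rule winds_once_left_right(1)[OF K w ab(2) t _ _ _ True])
  next
    case False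
    then have le: "t1 \<le> t0" by simp
    show ?thesis
    proof (rule that)
      show "((\<lambda>t. (if t1 \<le> t \<and> t \<le> t0 then upper_graph K (Re (\<gamma> t)) else lower_graph K (Re (\<gamma> t))) * Re (v t)) has_integral - measure lebesgue K) {0..1}"
        using graph_loop_integral[OF v cl rng cont, of t1 t0] False t area by simp
    qed (rule winds_once_left_right(2)[OF K w ab(2) t _ _ _ le])
  qed
  have 1: "((\<lambda>t. Im (\<gamma> t) * Re (v t)) has_integral - measure lebesgue K) {0..1}"
  proof (rule has_integral_spike[OF _ _ int])
    show "negligible ({t\<in>{0<..<1}. \<not> (\<gamma> has_vector_derivative v t) (at t)} \<union> {0,1})"
      using has_velocityD(4)[OF v] by (simp add: negligible_Un)
    fix t assume "t \<in> {0..1} - ({t\<in>{0<..<1}. \<not> (\<gamma> has_vector_derivative v t) (at t)} \<union> {0,1})"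
    then have t: "t \<in> {0<..<1}" "t \<in> {0..1}" "(\<gamma> has_vector_derivative v t) (at t)" by auto
    then have der: "((\<lambda>t. Re (\<gamma> t)) has_real_derivative Re (v t)) (at t)" by (simp add: has_vector_derivative_complex_iff)
    have near: "y \<in> {0..1}" if "\<bar>t - y\<bar> < min t (1 - t)" for y using that by auto
    have pos: "0 < min t (1 - t)" using t by auto
    consider "a < Re (\<gamma> t)" "Re (\<gamma> t) < b" | "Re (\<gamma> t) = a" | "Re (\<gamma> t) = b" using rng[OF t(2)] by force
    then show "Im (\<gamma> t) * Re (v t) = F2 t * Re (v t)"
    proof cases
      case 1 then show ?thesis using F2[OF t(2)] by simp
    next
      case 2
      have "Re (v t) = 0" by (rule DERIV_local_min[OF der pos]) (use near rng 2 in auto)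
      then show ?thesis by simp
    next
      case 3
      have "Re (v t) = 0" by (rule DERIV_local_max[OF der pos]) (use near rng 3 in auto)
      then show ?thesis by simp
    qed
  qed
  have "((\<lambda>t. Re (\<gamma> t) * Im (v t) - Im (\<gamma> t) * Re (v t)) has_integral signed_area \<gamma> - - measure lebesgue K) {0..1}"
    by (rule has_integral_diff[OF signed_area_Re_Im[OF v cl] 1])
  then have "2 * signed_area \<gamma> = signed_area \<gamma> + measure lebesgue K"
    using signed_area_velocity[OF v] by (simp add: cross2_def has_integral_iff)
  then show ?thesis by simp
qed

lemma winds_once_translate:
  assumes "winds_once c K \<gamma>"
  shows "winds_once 0 ((\<lambda>x. x - c) ` K) (\<lambda>t. \<gamma> t - c)"
proof -
  have eq: "(\<lambda>x. x - c) ` X = (+) (- c) ` X" for X by simp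
  have "frontier ((\<lambda>x. x - c) ` K) = (\<lambda>x. x - c) ` frontier K" unfolding eq by (rule frontier_translation)
  then show ?thesis using assms unfolding winds_once_def by auto
qed

lemma winds_once_area:
  assumes K: "compact K" "convex K" "c \<in> interior K" and w: "winds_once c K \<gamma>"
    and v: "has_velocity \<gamma> v" and cl: "\<gamma> 0 = \<gamma> 1"
  shows "signed_area \<gamma> = measure lebesgue K"
proof -
  have eq: "(\<lambda>x. x - c) ` K = (+) (- c) ` K" by simp
  have "signed_area (\<lambda>t. \<gamma> t - c) = measure lebesgue ((\<lambda>x. x - c) ` K)"
  proof (rule winds_once_area_origin)
    show "compact ((\<lambda>x. x - c) ` K)" "convex ((\<lambda>x. x - c) ` K)" unfolding eq by (intro compact_translation convex_translation K)+
    show "0 \<in> interior ((\<lambda>x. x - c) ` K)" unfolding eq interior_translation using K(3) by (auto intro: image_eqI[of _ _ c])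
    show "winds_once 0 ((\<lambda>x. x - c) ` K) (\<lambda>t. \<gamma> t - c)" by (rule winds_once_translate[OF w])
    show "has_velocity (\<lambda>t. \<gamma> t - c) v" using has_velocity_scale_shift[OF v, of 1 c] by simp
  qed (use cl in simp)
  moreover have "signed_area (\<lambda>t. \<gamma> t - c) = signed_area \<gamma>" using signed_area_scale_shift[OF v cl, of 1 c] by simp
  moreover have "measure lebesgue ((\<lambda>x. x - c) ` K) = measure lebesgue K" unfolding eq by (rule measure_translation)
  ultimately show ?thesis by simp
qed

section \<open>Boundary loops and their reparametrizations\<close>

text \<open>The reciprocal of the radius is the gauge function of \<open>K - c\<close>, which is subadditive and bounded by
  the norm divided by \<open>e\<close>.  The proof exhibits the point at the claimed radius as a convex
  combination of \<open>c + r2 *\<^sub>R l2\<close> and a point of the inscribed ball.\<close>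

lemma frontier_inverse_radius:
  fixes K :: "complex set"
  assumes K: "convex K" "closed K" "c \<in> interior K" and e: "0 < e" "cball c e \<subseteq> K"
    and r: "0 < r1" "0 < r2" "c + r1 *\<^sub>R l1 \<in> frontier K" "c + r2 *\<^sub>R l2 \<in> K"
  shows "1 / r1 \<le> 1 / r2 + norm (l1 - l2) / e"
proof -
  define d where "d = norm (l1 - l2)"
  define t where "t = inverse (1 / r2 + d / e)"
  have pos: "0 < 1 / r2 + d / e" using r e by (simp add: d_def add_pos_nonneg)
  then have "0 < t" "t * (1 / r2 + d / e) = 1" by (simp_all add: t_def)
  then have t: "0 < t" "t / r2 + t * d / e = 1" by (simp_all add: distrib_left)
  have sK: "c + (if d = 0 then 0 else (e / d) *\<^sub>R (l1 - l2)) \<in> K"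
    using e by (intro subsetD[OF e(2)]) (auto simp: dist_norm d_def)
  have "(t / r2) *\<^sub>R (c + r2 *\<^sub>R l2) + (t * d / e) *\<^sub>R (c + (if d = 0 then 0 else (e / d) *\<^sub>R (l1 - l2))) \<in> K"
    by (rule convexD[OF K(1) r(4) sK]) (use t r e in \<open>auto simp: d_def\<close>)
  also have "(t / r2) *\<^sub>R (c + r2 *\<^sub>R l2) + (t * d / e) *\<^sub>R (c + (if d = 0 then 0 else (e / d) *\<^sub>R (l1 - l2)))
      = (t / r2 + t * d / e) *\<^sub>R c + (t *\<^sub>R l2 + t *\<^sub>R (l1 - l2))"
    using r e by (auto simp: d_def scaleR_add_right scaleR_add_left)
  also have "\<dots> = c + t *\<^sub>R l1" unfolding t(2) by (simp add: scaleR_add_right[symmetric])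
  finally have tK: "c + t *\<^sub>R l1 \<in> K" .
  have "t \<le> r1"
  proof (rule ccontr)
    assume "\<not> t \<le> r1"
    then have lt: "r1 < t" by simp
    have i1: "(c + t *\<^sub>R l1) - ((t - r1) / t) *\<^sub>R ((c + t *\<^sub>R l1) - c) \<in> interior K"
      using lt t(1) r(1) by (intro mem_interior_convex_shrink[OF K(1,3) tK]) auto
    have i2: "(c + t *\<^sub>R l1) - ((t - r1) / t) *\<^sub>R ((c + t *\<^sub>R l1) - c) = c + r1 *\<^sub>R l1"
      using t(1) by (simp add: scaleR_diff_left)
    show False using r(3) i1 unfolding i2 by (simp add: frontier_def)
  qed
  then have "1 / r1 \<le> 1 / t" using t(1) by (simp add: frac_le)
  then show ?thesis by (simp add: t_def d_def inverse_eq_divide)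
qed

lemma norm_cis_diff_le: "norm (cis a - cis b) \<le> \<bar>a - b\<bar>"
proof -
  have "norm (cis a - cis b) \<le> 1 * norm (a - b)"
  proof (rule differentiable_bound[of UNIV cis "\<lambda>x h. h *\<^sub>R (\<i> * cis x)"])
    show "(cis has_derivative (\<lambda>h. h *\<^sub>R (\<i> * cis x))) (at x within UNIV)" for x
      by (auto intro!: derivative_eq_intros simp: algebra_simps)
    show "onorm (\<lambda>h. h *\<^sub>R (\<i> * cis x)) \<le> 1" for x
      by (rule onorm_bound) (auto simp: norm_mult)
  qed auto
  then show ?thesis by simp
qed

lemma frontier_radius_function:
  fixes K :: "complex set"
  assumes K: "compact K" "convex K" "c \<in> interior K"
  obtains \<rho> L where "\<And>s. 0 < \<rho> s" "\<And>s. c + \<rho> s *\<^sub>R cis s \<in> frontier K"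
    "L-lipschitz_on UNIV (\<lambda>s. c + \<rho> s *\<^sub>R cis s)"
proof -
  have "\<exists>d. 0 < d \<and> c + d *\<^sub>R cis s \<in> frontier K" for s
    using ray_to_frontier[OF compact_imp_bounded[OF K(1)] K(3), of "cis s"] by auto
  then obtain \<rho> where \<rho>: "\<And>s. 0 < \<rho> s" "\<And>s. c + \<rho> s *\<^sub>R cis s \<in> frontier K" by metis
  obtain e where e: "0 < e" "cball c e \<subseteq> K" using K(3) by (meson mem_interior_cball)
  have KK: "frontier K \<subseteq> K" using K(1) by (simp add: compact_imp_closed frontier_subset_closed)
  have "bounded ((\<lambda>x. x - c) ` K)" using K(1) by (intro compact_imp_bounded compact_continuous_image continuous_intros)
  then obtain R where "\<forall>y\<in>(\<lambda>x. x - c) ` K. norm y \<le> R" unfolding bounded_iff by blast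
  then have \<rho>R: "\<rho> s \<le> R" for s using \<rho>(1)[of s] \<rho>(2)[of s] KK by force
  have R0: "0 \<le> R" using \<rho>(1)[of 0] \<rho>R[of 0] by simp
  have inv: "\<bar>1 / \<rho> a - 1 / \<rho> b\<bar> \<le> \<bar>a - b\<bar> / e" for a b
  proof -
    have *: "1 / \<rho> a \<le> 1 / \<rho> b + \<bar>a - b\<bar> / e" for a b
    proof -
      have "1 / \<rho> a \<le> 1 / \<rho> b + norm (cis a - cis b) / e"
        using frontier_inverse_radius[OF K(2) compact_imp_closed[OF K(1)] K(3) e \<rho>(1) \<rho>(1) \<rho>(2)] \<rho>(2) KK by blast
      also have "norm (cis a - cis b) / e \<le> \<bar>a - b\<bar> / e" using e norm_cis_diff_le by (simp add: divide_right_mono)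
      finally show ?thesis by simp
    qed
    show ?thesis using *[of a b] *[of b a] by (simp add: abs_le_iff abs_minus_commute)
  qed
  have rl: "\<bar>\<rho> a - \<rho> b\<bar> \<le> R * R / e * \<bar>a - b\<bar>" for a b
  proof -
    have "\<rho> a - \<rho> b = \<rho> a * \<rho> b * (1 / \<rho> b - 1 / \<rho> a)" using \<rho>(1)[of a] \<rho>(1)[of b] by (simp add: field_simps)
    then have "\<bar>\<rho> a - \<rho> b\<bar> = (\<rho> a * \<rho> b) * \<bar>1 / \<rho> b - 1 / \<rho> a\<bar>" using \<rho>(1)[of a] \<rho>(1)[of b] by (simp add: abs_mult)
    also have "\<dots> \<le> (R * R) * (\<bar>b - a\<bar> / e)"
      using \<rho>(1)[of a] \<rho>(1)[of b] \<rho>R R0 inv by (intro mult_mono) auto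
    finally show ?thesis by (simp add: abs_minus_commute)
  qed
  show ?thesis
  proof (rule that[OF \<rho>])
    show "(R * R / e + R)-lipschitz_on UNIV (\<lambda>s. c + \<rho> s *\<^sub>R cis s)"
    proof (rule lipschitz_onI)
      fix a b :: real
      have "(c + \<rho> a *\<^sub>R cis a) - (c + \<rho> b *\<^sub>R cis b) = (\<rho> a - \<rho> b) *\<^sub>R cis a + \<rho> b *\<^sub>R (cis a - cis b)"
        by (simp add: algebra_simps)
      then have "dist (c + \<rho> a *\<^sub>R cis a) (c + \<rho> b *\<^sub>R cis b) \<le> norm ((\<rho> a - \<rho> b) *\<^sub>R cis a) + norm (\<rho> b *\<^sub>R (cis a - cis b))"
        unfolding dist_norm by (metis norm_triangle_ineq)
      also have "\<dots> \<le> R * R / e * \<bar>a - b\<bar> + R * \<bar>a - b\<bar>"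
        using rl[of a b] \<rho>R[of b] \<rho>(1)[of b] norm_cis_diff_le[of a b] R0
        by (intro add_mono) (auto intro!: mult_mono)
      finally show "dist (c + \<rho> a *\<^sub>R cis a) (c + \<rho> b *\<^sub>R cis b) \<le> (R * R / e + R) * dist a b"
        by (simp add: dist_real_def algebra_simps)
    qed (use R0 e in auto)
  qed
qed

lemma cis_eq_cis_iff: "cis a = cis b \<longleftrightarrow> (\<exists>n::int. a = b + 2 * pi * n)"
  using sin_cos_eq_iff[of a b] by (auto simp: complex_eq_iff)

text \<open>The loop is parametrized by the angle, starting at \<open>\<phi>\<close>; the starting angle is free so that any
  curve that winds once is a reparametrization of one of these loops with the same end points.\<close>

lemma standard_boundary_loop:
  fixes K :: "complex set"
  assumes K: "compact K" "convex K" "c \<in> interior K"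
  obtains \<beta> where "simple_boundary_loop \<beta> K" "\<And>s. \<beta> s \<in> frontier K"
    "\<And>s. \<beta> s - c = norm (\<beta> s - c) *\<^sub>R cis (\<phi> + 2 * pi * s)"
proof -
  obtain \<rho> L where \<rho>: "\<And>s. 0 < \<rho> s" "\<And>s. c + \<rho> s *\<^sub>R cis s \<in> frontier K"
    and lip: "L-lipschitz_on UNIV (\<lambda>s. c + \<rho> s *\<^sub>R cis s)" by (rule frontier_radius_function[OF K]) blast
  define \<beta> where "\<beta> s = c + \<rho> (\<phi> + 2 * pi * s) *\<^sub>R cis (\<phi> + 2 * pi * s)" for s
  have fr: "\<beta> s \<in> frontier K" for s unfolding \<beta>_def by (rule \<rho>)
  have dir: "\<beta> s - c = norm (\<beta> s - c) *\<^sub>R cis (\<phi> + 2 * pi * s)" for s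
    using \<rho>(1)[of "\<phi> + 2 * pi * s"] by (simp add: \<beta>_def)
  have L0: "0 \<le> L" using lip by (simp add: lipschitz_on_def)
  have "(2 * pi * L)-lipschitz_on {0..1} \<beta>"
  proof (rule lipschitz_onI)
    fix x y :: real
    have "dist (\<beta> x) (\<beta> y) \<le> L * dist (\<phi> + 2 * pi * x) (\<phi> + 2 * pi * y)"
      unfolding \<beta>_def by (rule lipschitz_onD[OF lip]) auto
    also have "dist (\<phi> + 2 * pi * x) (\<phi> + 2 * pi * y) = 2 * pi * dist x y"
      by (simp add: dist_real_def right_diff_distrib[symmetric] abs_mult)
    finally show "dist (\<beta> x) (\<beta> y) \<le> 2 * pi * L * dist x y" by (simp add: mult_ac)
  qed (use L0 in auto)
  note lip\<beta> = this
  have b01: "\<beta> 0 = \<beta> 1"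
  proof (rule frontier_ray_unique[OF K(2,3) fr fr dir[of 0]])
    show "\<beta> 1 - c = norm (\<beta> 1 - c) *\<^sub>R cis (\<phi> + 2 * pi * 0)"
    proof -
      have "cis (\<phi> + 2 * pi * 1) = cis (\<phi> + 2 * pi * 0)" unfolding cis_eq_cis_iff by (intro exI[of _ 1]) simp
      then show ?thesis using dir[of 1] by simp
    qed
  qed auto
  have simple: "x = y \<or> x = 0 \<and> y = 1 \<or> x = 1 \<and> y = 0" if xy: "x \<in> {0..1}" "y \<in> {0..1}" "\<beta> x = \<beta> y" for x y
  proof -
    have "cis (\<phi> + 2 * pi * x) = cis (\<phi> + 2 * pi * y)"
    proof -
      have "norm (\<beta> x - c) \<noteq> 0" using frontier_neq_center[OF K(3) fr, of x] by simp
      moreover have "norm (\<beta> x - c) *\<^sub>R cis (\<phi> + 2 * pi * x) = norm (\<beta> x - c) *\<^sub>R cis (\<phi> + 2 * pi * y)"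
        using dir[of x] dir[of y] unfolding xy(3) by simp
      ultimately show ?thesis by simp
    qed
    then obtain n :: int where "2 * pi * x = 2 * pi * y + 2 * pi * n" unfolding cis_eq_cis_iff by auto
    then have "2 * pi * x = 2 * pi * (y + n)" by (simp add: distrib_left)
    then have n: "x = y + n" by simp
    then have "- 1 \<le> real_of_int n" "real_of_int n \<le> 1" using xy by auto
    then have "n = -1 \<or> n = 0 \<or> n = 1" by linarith
    with n xy show ?thesis by auto
  qed
  have w: "winds_once c K \<beta>"
    unfolding winds_once_def
    by (rule exI[of _ "\<lambda>s. \<phi> + 2 * pi * s"]) (use fr dir in \<open>auto intro!: continuous_intros simp: mono_on_def\<close>)
  have "path_image \<beta> = frontier K"
    using winds_once_surj[OF K(2,3) w] fr by (auto simp: path_image_def)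
  moreover have "simple_path \<beta>"
    using simple lipschitz_on_continuous_on[OF lip\<beta>] by (auto simp: simple_path_def loop_free_def path_def)
  ultimately have "simple_boundary_loop \<beta> K"
    using lip\<beta> b01 unfolding simple_boundary_loop_def closed_lipschitz_curve_def by blast
  then show ?thesis using that fr dir by blast
qed

lemma winds_once_reparametrization:
  fixes K :: "complex set"
  assumes K: "compact K" "convex K" "c \<in> interior K" and w: "winds_once c K \<gamma>"
  shows "\<exists>\<beta>. simple_boundary_loop \<beta> K \<and> reparametrization_of \<gamma> \<beta>"
proof -
  obtain \<theta> where \<theta>: "continuous_on {0..1} \<theta>" "mono_on {0..1} \<theta>" "\<theta> 1 = \<theta> 0 + 2 * pi"
    "\<And>t. t \<in> {0..1} \<Longrightarrow> \<gamma> t \<in> frontier K" "\<And>t. t \<in> {0..1} \<Longrightarrow> \<gamma> t - c = norm (\<gamma> t - c) *\<^sub>R cis (\<theta> t)"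
    using w unfolding winds_once_def by blast
  obtain \<beta> where \<beta>: "simple_boundary_loop \<beta> K" "\<And>s. \<beta> s \<in> frontier K"
    "\<And>s. \<beta> s - c = norm (\<beta> s - c) *\<^sub>R cis (\<theta> 0 + 2 * pi * s)" by (rule standard_boundary_loop[OF K]) blast
  define \<phi> where "\<phi> t = (\<theta> t - \<theta> 0) / (2 * pi)" for t
  have "\<gamma> t = \<beta> (\<phi> t)" if t: "t \<in> {0..1}" for t
    by (rule frontier_ray_unique[OF K(2,3) \<theta>(4)[OF t] \<beta>(2) \<theta>(5)[OF t]])
       (use \<beta>(3)[of "\<phi> t"] in \<open>auto simp: \<phi>_def\<close>)
  moreover have "continuous_on {0..1} \<phi>" "mono_on {0..1} \<phi>" "\<phi> 0 = 0" "\<phi> 1 = 1"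
    unfolding \<phi>_def using \<theta>(1,2,3) by (auto intro!: continuous_intros simp: mono_on_def divide_right_mono)
  ultimately show ?thesis using \<beta>(1) unfolding reparametrization_of_def by blast
qed

lemma continuous_angle:
  fixes \<gamma> :: "real \<Rightarrow> complex"
  assumes "continuous_on {0..1} \<gamma>" "\<And>t. t \<in> {0..1} \<Longrightarrow> \<gamma> t \<noteq> c"
  obtains \<theta> where "continuous_on {0..1} \<theta>" "\<And>t. t \<in> {0..1} \<Longrightarrow> \<gamma> t - c = norm (\<gamma> t - c) *\<^sub>R cis (\<theta> t)"
proof -
  obtain g where g: "continuous_on {0..1} g" "\<And>t. t \<in> {0..1} \<Longrightarrow> \<gamma> t - c = exp (g t)"
    by (rule continuous_logarithm_on_contractible[of "{0..1}" "\<lambda>t. \<gamma> t - c"])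
       (use assms in \<open>auto intro!: continuous_intros convex_imp_contractible\<close>)
  show ?thesis
  proof (rule that[of "\<lambda>t. Im (g t)"])
    show "continuous_on {0..1} (\<lambda>t. Im (g t))" by (intro continuous_intros g)
    show "\<gamma> t - c = norm (\<gamma> t - c) *\<^sub>R cis (Im (g t))" if "t \<in> {0..1}" for t
      using g(2)[OF that] by (simp add: exp_eq_polar scaleR_conv_of_real norm_mult)
  qed
qed

text \<open>Two points of the frontier in the same direction from \<open>c\<close> coincide, so by simplicity the angle is
  injective, hence monotone.  It grows by a multiple of \<open>2 * pi\<close>; were it more than once, the loop
  would meet its starting point in between.\<close>

lemma simple_loop_winds_once_if_increasing:
  fixes K :: "complex set"
  assumes K: "convex K" "c \<in> interior K" and fr: "\<And>t. t \<in> {0..1} \<Longrightarrow> \<beta> t \<in> frontier K" and cl: "\<beta> 0 = \<beta> 1"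
    and simple: "\<And>x y. x \<in> {0..1} \<Longrightarrow> y \<in> {0..1} \<Longrightarrow> \<beta> x = \<beta> y \<Longrightarrow> x = y \<or> x = 0 \<and> y = 1 \<or> x = 1 \<and> y = 0"
    and \<theta>: "continuous_on {0..1} \<theta>" "\<And>t. t \<in> {0..1} \<Longrightarrow> \<beta> t - c = norm (\<beta> t - c) *\<^sub>R cis (\<theta> t)" and less: "\<theta> 0 < \<theta> 1"
  shows "winds_once c K \<beta>"
proof -
  have same: "\<beta> x = \<beta> y" if xy: "x \<in> {0..1}" "y \<in> {0..1}" "cis (\<theta> x) = cis (\<theta> y)" for x y
  proof (rule frontier_ray_unique[OF K fr[OF xy(1)] fr[OF xy(2)] \<theta>(2)[OF xy(1)]])
    show "\<beta> y - c = norm (\<beta> y - c) *\<^sub>R cis (\<theta> x)" unfolding xy(3) by (rule \<theta>(2)[OF xy(2)])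
  qed auto
  have inj: "inj_on \<theta> {0..1}"
  proof (rule inj_onI)
    fix x y :: real assume xy: "x \<in> {0..1}" "y \<in> {0..1}" "\<theta> x = \<theta> y"
    then have "x = y \<or> x = 0 \<and> y = 1 \<or> x = 1 \<and> y = 0" using simple[OF xy(1,2)] same[OF xy(1,2)] by simp
    then show "x = y" using xy less by auto
  qed
  have between: "\<theta> 0 < \<theta> x \<and> \<theta> x < \<theta> 1" if "0 < x" "x < 1" for x
    using continuous_inj_imp_mono[OF that \<theta>(1) inj] less by auto
  have mono: "\<theta> x \<le> \<theta> y" if xy: "0 \<le> x" "x \<le> y" "y \<le> 1" for x y
  proof (cases "x = 0 \<or> x = y \<or> y = 1")
    case True
    then show ?thesis using between[of x] between[of y] xy less by (cases "x = y"; cases "x = 0"; cases "y = 1") auto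
  next
    case False
    then have "0 < x" "x < y" "y < 1" using xy by auto
    then show ?thesis
      using continuous_inj_imp_mono[of 0 x y \<theta>] continuous_on_subset[OF \<theta>(1), of "{0..y}"] inj_on_subset[OF inj, of "{0..y}"] between[of y] by auto
  qed
  have "norm (\<beta> 0 - c) \<noteq> 0" using frontier_neq_center[OF K(2) fr, of 0] by auto
  moreover have "norm (\<beta> 0 - c) *\<^sub>R cis (\<theta> 1) = norm (\<beta> 0 - c) *\<^sub>R cis (\<theta> 0)"
    using \<theta>(2)[of 0] \<theta>(2)[of 1] unfolding cl by simp
  ultimately have "cis (\<theta> 1) = cis (\<theta> 0)" by simp
  then obtain n :: int where n: "\<theta> 1 = \<theta> 0 + 2 * pi * n" unfolding cis_eq_cis_iff by auto
  then have "0 < 2 * pi * real_of_int n" using less by simp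
  then have "1 \<le> n" by (simp add: zero_less_mult_iff)
  then have "2 * pi * 1 \<le> 2 * pi * real_of_int n" by (intro mult_left_mono) auto
  then have "\<theta> 0 + 2 * pi \<le> \<theta> 1" using n by simp
  then obtain t where t: "0 \<le> t" "t \<le> 1" "\<theta> t = \<theta> 0 + 2 * pi" using IVT'[of \<theta> 0 "\<theta> 0 + 2 * pi" 1] \<theta>(1) by auto
  have "cis (\<theta> t) = cis (\<theta> 0)" unfolding t(3) by (subst cis_mult[symmetric]) simp
  then have "\<beta> t = \<beta> 0" using same[of t 0] t by auto
  moreover have "t \<noteq> 0" using t(3) by auto
  ultimately have "t = 1" using simple[of t 0] t by auto
  then have "\<theta> 1 = \<theta> 0 + 2 * pi" using t by simp
  then show ?thesis unfolding winds_once_def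
    by (intro exI[of _ \<theta>]) (use \<theta> fr mono in \<open>auto simp: mono_on_def\<close>)
qed

lemma simple_loop_winds_once:
  fixes K :: "complex set"
  assumes K: "compact K" "convex K" "c \<in> interior K" and \<beta>: "simple_boundary_loop \<beta> K"
  shows "winds_once c K \<beta> \<or> winds_once c K (\<lambda>t. \<beta> (1 - t))"
proof -
  have cont: "continuous_on {0..1} \<beta>" and cl: "\<beta> 0 = \<beta> 1"
    using \<beta> lipschitz_on_continuous_on unfolding simple_boundary_loop_def closed_lipschitz_curve_def by blast+
  have fr: "\<beta> t \<in> frontier K" if "t \<in> {0..1}" for t
    using \<beta> that unfolding simple_boundary_loop_def path_image_def by blast
  have simple: "x = y \<or> x = 0 \<and> y = 1 \<or> x = 1 \<and> y = 0" if "x \<in> {0..1}" "y \<in> {0..1}" "\<beta> x = \<beta> y" for x y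
    using \<beta> that unfolding simple_boundary_loop_def simple_path_def loop_free_def by blast
  obtain \<theta> where \<theta>: "continuous_on {0..1} \<theta>" "\<And>t. t \<in> {0..1} \<Longrightarrow> \<beta> t - c = norm (\<beta> t - c) *\<^sub>R cis (\<theta> t)"
    by (rule continuous_angle[OF cont, of c]) (use frontier_neq_center[OF K(3) fr] in blast)+
  have ne: "\<theta> 0 \<noteq> \<theta> 1"
  proof
    assume eq: "\<theta> 0 = \<theta> 1"
    have same: "\<beta> x = \<beta> y" if xy: "x \<in> {0..1}" "y \<in> {0..1}" "\<theta> x = \<theta> y" for x y
    proof (rule frontier_ray_unique[OF K(2,3) fr[OF xy(1)] fr[OF xy(2)] \<theta>(2)[OF xy(1)]])
      show "\<beta> y - c = norm (\<beta> y - c) *\<^sub>R cis (\<theta> x)" unfolding xy(3) by (rule \<theta>(2)[OF xy(2)])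
    qed auto
    have half: "\<theta> (1/2) \<noteq> \<theta> 0" using same[of "1/2" 0] simple[of "1/2" 0] by auto
    define m where "m = (\<theta> 0 + \<theta> (1/2)) / 2"
    have c1: "continuous_on {0..1/2} \<theta>" "continuous_on {1/2..1} \<theta>" by (auto intro: continuous_on_subset[OF \<theta>(1)])
    obtain x where x: "0 \<le> x" "x \<le> 1/2" "\<theta> x = m"
    proof (cases "\<theta> 0 < \<theta> (1/2)")
      case True then show ?thesis using IVT'[of \<theta> 0 m "1/2"] c1 that by (auto simp: m_def)
    next
      case False then show ?thesis using IVT2'[of \<theta> "1/2" m 0] c1 that by (auto simp: m_def)
    qed
    obtain y where y: "1/2 \<le> y" "y \<le> 1" "\<theta> y = m"
    proof (cases "\<theta> 0 < \<theta> (1/2)")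
      case True then show ?thesis using IVT2'[of \<theta> 1 m "1/2"] c1 that eq by (auto simp: m_def)
    next
      case False then show ?thesis using IVT'[of \<theta> "1/2" m 1] c1 that eq by (auto simp: m_def)
    qed
    have "m \<noteq> \<theta> (1/2)" "m \<noteq> \<theta> 0" using half by (auto simp: m_def)
    then have "x \<noteq> 1/2" "x \<noteq> 0" using x(3) by blast+
    moreover have "x = y \<or> x = 0 \<and> y = 1 \<or> x = 1 \<and> y = 0" using simple[of x y] same[of x y] x y by auto
    ultimately show False using x y by auto
  qed
  show ?thesis
  proof (cases "\<theta> 0 < \<theta> 1")
    case True
    have "winds_once c K \<beta>"
      by (rule simple_loop_winds_once_if_increasing[OF K(2,3) fr cl simple \<theta> True])
    then show ?thesis ..
  next
    case False
    have "winds_once c K (\<lambda>t. \<beta> (1 - t))"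
    proof (rule simple_loop_winds_once_if_increasing[OF K(2,3), where \<theta>="\<lambda>t. \<theta> (1 - t)"])
      show "x = y \<or> x = 0 \<and> y = 1 \<or> x = 1 \<and> y = 0" if "x \<in> {0..1}" "y \<in> {0..1}" "\<beta> (1 - x) = \<beta> (1 - y)" for x y
        using simple[of "1 - x" "1 - y"] that by auto
      show "continuous_on {0..1} (\<lambda>t. \<theta> (1 - t))"
        by (rule continuous_on_compose2[OF \<theta>(1)]) (auto intro!: continuous_intros)
    qed (use fr cl \<theta>(2) ne False in auto)
    then show ?thesis ..
  qed
qed

lemma winds_once_compose:
  assumes w: "winds_once c K \<beta>" and \<phi>: "continuous_on {0..1} \<phi>" "mono_on {0..1} \<phi>" "\<phi> 0 = 0" "\<phi> 1 = (1::real)"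
    and eq: "\<And>t. t \<in> {0..1} \<Longrightarrow> \<gamma> t = \<beta> (\<phi> t)"
  shows "winds_once c K \<gamma>"
proof -
  obtain \<theta> where \<theta>: "continuous_on {0..1} \<theta>" "mono_on {0..1} \<theta>" "\<theta> 1 = \<theta> 0 + 2 * pi"
    "\<And>t. t \<in> {0..1} \<Longrightarrow> \<beta> t \<in> frontier K" "\<And>t. t \<in> {0..1} \<Longrightarrow> \<beta> t - c = norm (\<beta> t - c) *\<^sub>R cis (\<theta> t)"
    using w unfolding winds_once_def by auto
  have \<phi>01: "\<phi> t \<in> {0..1}" if "t \<in> {0..1}" for t
  proof -
    have "\<phi> 0 \<le> \<phi> t" "\<phi> t \<le> \<phi> 1" using \<phi>(2) that by (auto simp: mono_on_def)
    then show ?thesis using \<phi>(3,4) by simp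
  qed
  show ?thesis unfolding winds_once_def
  proof (intro exI[of _ "\<lambda>t. \<theta> (\<phi> t)"] conjI ballI)
    show "continuous_on {0..1} (\<lambda>t. \<theta> (\<phi> t))" by (rule continuous_on_compose2[OF \<theta>(1) \<phi>(1)]) (use \<phi>01 in auto)
    show "mono_on {0..1} (\<lambda>t. \<theta> (\<phi> t))" using \<theta>(2) \<phi>(2) \<phi>01 by (auto simp: mono_on_def)
  qed (use \<theta> \<phi> \<phi>01 eq in auto)
qed

lemma reparametrization_winds_once:
  fixes K :: "complex set"
  assumes K: "compact K" "convex K" "c \<in> interior K" and \<beta>: "simple_boundary_loop \<beta> K" and r: "reparametrization_of \<gamma> \<beta>"
  shows "winds_once c K \<gamma> \<or> winds_once c K (\<lambda>t. \<gamma> (1 - t))"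
proof -
  obtain \<phi> where \<phi>: "continuous_on {0..1} \<phi>" "mono_on {0..1} \<phi>" "\<phi> 0 = 0" "\<phi> 1 = (1::real)" "\<And>t. t \<in> {0..1} \<Longrightarrow> \<gamma> t = \<beta> (\<phi> t)"
    using r unfolding reparametrization_of_def by blast
  from simple_loop_winds_once[OF K \<beta>] show ?thesis
  proof
    assume w: "winds_once c K \<beta>"
    have "winds_once c K \<gamma>" by (rule winds_once_compose[OF w, of \<phi>]) (use \<phi> in auto)
    then show ?thesis ..
  next
    assume w: "winds_once c K (\<lambda>t. \<beta> (1 - t))"
    have "winds_once c K (\<lambda>t. \<gamma> (1 - t))"
    proof (rule winds_once_compose[OF w, of "\<lambda>t. 1 - \<phi> (1 - t)"])
      show "continuous_on {0..1} (\<lambda>t. 1 - \<phi> (1 - t))"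
        by (intro continuous_intros continuous_on_compose2[OF \<phi>(1)]) auto
    qed (use \<phi> in \<open>auto simp: mono_on_def\<close>)
    then show ?thesis ..
  qed
qed

lemma has_integral_reverse:
  fixes f :: "real \<Rightarrow> real"
  assumes "(f has_integral i) {0..1}"
  shows "((\<lambda>t. f (1 - t)) has_integral i) {0..1}"
proof -
  have "(\<lambda>x. (1 / (-1)) *\<^sub>R x + -((1 / (-1)) *\<^sub>R (1::real))) ` cbox 0 1 = {0..1}"
    using image_affinity_atLeastAtMost[of "-1" 1 0 "1::real"] by simp
  then show ?thesis using has_integral_affinity[of f i 0 1 "-1" 1] assms by simp
qed

lemma signed_area_reverse:
  assumes v: "has_velocity \<gamma> v"
  shows "signed_area (\<lambda>t. \<gamma> (1 - t)) = - signed_area \<gamma>"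
proof -
  from has_integral_neg[OF has_integral_reverse[OF signed_area_has_integral[OF v]]]
  have "((\<lambda>t. cross2 (\<gamma> (1 - t)) (- v (1 - t))) has_integral - (2 * signed_area \<gamma>)) {0..1}"
    by (simp add: cross2.minus_right)
  then show ?thesis unfolding signed_area_velocity[OF has_velocity_reverse[OF v]] by (simp add: has_integral_iff)
qed

section \<open>Curves tangential to the boundary\<close>

lemma has_integral_nonneg_ae:
  fixes f :: "real \<Rightarrow> real"
  assumes "(f has_integral i) S" "negligible N" "\<And>t. t \<in> S - N \<Longrightarrow> 0 \<le> f t"
  shows "0 \<le> i"
proof -
  have "((\<lambda>t. if t \<in> N then 0 else f t) has_integral i) S"
    by (rule has_integral_spike[OF assms(2) _ assms(1)]) auto
  then show ?thesis by (rule has_integral_nonneg) (use assms(3) in auto)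
qed

lemma has_integral_zero_ae:
  fixes f :: "real \<Rightarrow> real"
  assumes f: "(f has_integral 0) S" and nn: "\<And>t. t \<in> S \<Longrightarrow> 0 \<le> f t"
  shows "negligible {t\<in>S. f t \<noteq> 0}"
proof -
  have af: "f absolutely_integrable_on S"
    using f nn by (intro nonnegative_absolutely_integrable_1) auto
  then have "0 = set_lebesgue_integral lebesgue S f"
    using f by (simp add: set_lebesgue_integral_eq_integral has_integral_iff)
  then have "AE x in lebesgue. indicator S x *\<^sub>R f x = 0"
    unfolding set_lebesgue_integral_def using af nn
    by (subst (asm) eq_commute, subst (asm) integral_nonneg_eq_0_iff_AE) (auto simp: set_integrable_def indicator_def)
  then have "AE x in lebesgue. x \<notin> {t\<in>S. f t \<noteq> 0}"
    by eventually_elim (auto simp: indicator_def split: if_splits)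
  then show ?thesis by (simp add: negligible_iff_null_sets AE_iff_null_sets eventually_ae_filter) (auto dest: null_sets_completion_subset)
qed

lemma mono_on_if_locally_mono:
  fixes \<theta> :: "real \<Rightarrow> real"
  assumes d: "0 < d" and loc: "\<And>s t. 0 \<le> s \<Longrightarrow> s \<le> t \<Longrightarrow> t \<le> 1 \<Longrightarrow> t - s < d \<Longrightarrow> \<theta> s \<le> \<theta> t"
  shows "mono_on {0..1} \<theta>"
proof -
  have "\<theta> s \<le> \<theta> t" if "0 \<le> s" "s \<le> t" "t \<le> 1" "t - s \<le> real n * (d/2)" for n s t
    using that
  proof (induction n arbitrary: s)
    case 0 then show ?case by simp
  next
    case (Suc n)
    define s' where "s' = min t (s + d/2)"
    have "t - s' \<le> real n * (d/2)"
    proof (cases "t \<le> s + d/2")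
      case True then show ?thesis using d by (simp add: s'_def)
    next
      case False then show ?thesis using Suc.prems(4) by (simp add: s'_def algebra_simps)
    qed
    then have "\<theta> s' \<le> \<theta> t" using Suc.prems d by (intro Suc.IH) (auto simp: s'_def)
    moreover have "\<theta> s \<le> \<theta> s'" using Suc.prems d by (intro loc) (auto simp: s'_def)
    ultimately show ?case by simp
  qed
  moreover have "\<exists>n. t - s \<le> real n * (d/2)" for s t
    using d reals_Archimedean3[of "d/2"] by (metis half_gt_zero less_imp_le)
  ultimately show ?thesis unfolding mono_on_def by (metis atLeastAtMost_iff)
qed

lemma supp_lower_ball:
  assumes W: "compact W" and e: "0 < e" "cball c e \<subseteq> W"
  shows "c \<bullet> u + e * norm u \<le> supp W u"
proof (cases "u = 0")
  case True
  then show ?thesis using supp_zero[OF W] e by (cases "W = {}") auto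
next
  case False
  have "c + (e / norm u) *\<^sub>R u \<in> W" using e False by (intro subsetD[OF e(2)]) (auto simp: dist_norm)
  moreover from this have "W \<noteq> {}" by blast
  ultimately have "(c + (e / norm u) *\<^sub>R u) \<bullet> u \<le> supp W u" using supp_upper[OF W] by blast
  then show ?thesis using False by (simp add: inner_add_left power2_norm_eq_inner[symmetric] power2_eq_square)
qed

lemma cross2_le_norm: "\<bar>cross2 a b\<bar> \<le> norm a * norm b"
  using Cauchy_Schwarz_ineq2[of a "- \<i> * b"] by (simp only: cross2_inner) (simp add: norm_mult)

lemma velocity_zero_constant:
  assumes v: "has_velocity \<gamma> v" and st: "0 \<le> s" "s \<le> t" "t \<le> 1" and N: "negligible N" "\<And>\<tau>. \<tau> \<in> {s..t} - N \<Longrightarrow> v \<tau> = 0"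
  shows "\<gamma> s = \<gamma> t"
proof -
  have "l (\<gamma> t) - l (\<gamma> s) = 0" if l: "bounded_linear l" for l :: "complex \<Rightarrow> real"
  proof (rule has_integral_unique[OF velocity_linear_ftc[OF v l st]])
    show "((\<lambda>\<tau>. l (v \<tau>)) has_integral 0) {s..t}"
      by (rule has_integral_spike[OF N(1) _ has_integral_0]) (use N(2) linear_0[OF bounded_linear.linear[OF l]] in simp)
  qed
  from this[OF bounded_linear_Re] this[OF bounded_linear_Im] show ?thesis by (simp add: complex_eq_iff)
qed

text \<open>At an interior point of \<open>K\<close> no nonzero functional attains its maximum over \<open>K\<close>, so the velocity
  vanishes there.  Hence the set of times at which the curve is at a given interior point is open
  and closed.\<close>

lemma tangential_curve_on_frontier:
  fixes K :: "complex set"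
  assumes K: "compact K" and v: "has_velocity \<gamma> v" and inK: "\<And>t. t \<in> {0..1} \<Longrightarrow> \<gamma> t \<in> K"
    and N: "negligible N" "\<And>t. t \<in> {0..1} - N \<Longrightarrow> cross2 (\<gamma> t) (v t) = supp K (- \<i> * v t)"
    and nonconst: "\<exists>t\<in>{0..1}. \<gamma> t \<noteq> \<gamma> 0" and t: "t \<in> {0..1}"
  shows "\<gamma> t \<in> frontier K"
proof (rule ccontr)
  assume "\<gamma> t \<notin> frontier K"
  then have ti: "\<gamma> t \<in> interior K" using inK[OF t] closure_subset by (auto simp: frontier_def)
  have cont: "continuous_on {0..1} \<gamma>" by (rule has_velocityD(5)[OF v])
  define S where "S = {s\<in>{0..1}. \<gamma> s = \<gamma> t}"
  have "closedin (top_of_set {0..1}) S"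
    unfolding S_def by (rule continuous_closedin_preimage_constant[OF cont])
  moreover have "openin (top_of_set {0..1}) S"
    unfolding openin_euclidean_subtopology_iff
  proof (intro conjI ballI)
    fix s assume s: "s \<in> S"
    then have s01: "s \<in> {0..1}" "\<gamma> s = \<gamma> t" by (auto simp: S_def)
    obtain e where e: "0 < e" "ball (\<gamma> s) e \<subseteq> interior K" using ti s01 open_interior by (metis openE)
    obtain d where d: "0 < d" "\<And>x. x \<in> {0..1} \<Longrightarrow> dist x s < d \<Longrightarrow> dist (\<gamma> x) (\<gamma> s) < e"
      using cont s01 e(1) unfolding continuous_on_iff by metis
    have v0: "v x = 0" if x: "x \<in> {0..1} - N" "dist x s < d" for x
    proof (rule ccontr)
      assume v0: "v x \<noteq> 0"
      have "\<gamma> x \<in> interior K" using d(2)[of x] x e(2) by (auto simp: dist_commute)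
      then obtain r where r: "0 < r" "cball (\<gamma> x) r \<subseteq> K" by (meson mem_interior_cball)
      have "\<gamma> x \<bullet> (- \<i> * v x) + r * norm (- \<i> * v x) \<le> supp K (- \<i> * v x)" by (rule supp_lower_ball[OF K r])
      moreover have "\<gamma> x \<bullet> (- \<i> * v x) = supp K (- \<i> * v x)" using N(2)[OF x(1)] by (simp only: cross2_inner)
      ultimately have "r * norm (v x) \<le> 0" by (simp add: norm_mult)
      then show False using r(1) v0 by (simp add: mult_le_0_iff)
    qed
    show "\<exists>e>0. \<forall>x'\<in>{0..1}. dist x' s < e \<longrightarrow> x' \<in> S"
    proof (intro exI[of _ d] conjI ballI impI d(1))
      fix x assume x: "x \<in> {0..1}" "dist x s < d"
      have "\<gamma> (min x s) = \<gamma> (max x s)"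
        by (rule velocity_zero_constant[OF v _ _ _ N(1)])
           (use x s01 in \<open>auto intro!: v0 simp: dist_real_def min_def max_def split: if_splits\<close>)
      then have "\<gamma> x = \<gamma> s" by (auto simp: min_def max_def split: if_splits)
      then show "x \<in> S" using x(1) s01(2) by (simp add: S_def)
    qed
  qed (auto simp: S_def)
  ultimately have "S = {} \<or> S = {0..1}"
    using connected_Icc[of 0 "1::real"] unfolding connected_clopen by blast
  moreover have "t \<in> S" using t by (simp add: S_def)
  ultimately have S01: "S = {0..1}" by blast
  have all: "\<gamma> s = \<gamma> t" if "s \<in> {0..1}" for s
  proof -
    have "s \<in> S" unfolding S01 by (rule that)
    then show ?thesis by (simp add: S_def)
  qed
  obtain s where "s \<in> {0..1}" "\<gamma> s \<noteq> \<gamma> 0" using nonconst by blast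
  then show False using all[of s] all[of 0] by simp
qed

text \<open>Seen from \<open>c\<close>, the curve is tangential with \<open>cross2 (\<gamma> t - c) (v t) \<ge> e * norm (v t)\<close>, where \<open>e\<close> is
  the radius of a disc around \<open>c\<close> in \<open>K\<close>.  On short time intervals this outweighs the change of
  \<open>\<gamma>\<close>, and so the angle does not decrease.  If it grew by more than \<open>2 * pi\<close>, the first turn alone
  would account for the whole area, although the rest of the curve contributes a positive amount.\<close>

lemma tangential_curve_winds_once:
  fixes K :: "complex set"
  assumes K: "compact K" "convex K" "c \<in> interior K" and v: "has_velocity \<gamma> v" and cl: "\<gamma> 0 = \<gamma> 1"
    and inK: "\<And>t. t \<in> {0..1} \<Longrightarrow> \<gamma> t \<in> K"
    and N: "negligible N" "\<And>t. t \<in> {0..1} - N \<Longrightarrow> cross2 (\<gamma> t) (v t) = supp K (- \<i> * v t)"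
    and area: "signed_area \<gamma> = measure lebesgue K"
  shows "winds_once c K \<gamma>"
proof -
  have "interior K \<noteq> {}" using K(3) by blast
  then have Kpos: "0 < measure lebesgue K" by (rule measure_convex_pos[OF K(1,2)])
  have const: False if "\<And>t. t \<in> {0..1} \<Longrightarrow> \<gamma> t = \<gamma> 0"
  proof -
    have "((\<lambda>t. cross2 (\<gamma> t) (v t)) has_integral 0) {0..1}"
    proof (rule has_integral_eq[OF _ velocity_integral_zero[OF v cl, of "\<gamma> 0"]])
      show "cross2 (\<gamma> 0) (v t) = cross2 (\<gamma> t) (v t)" if t: "t \<in> {0..1}" for t
        unfolding \<open>\<And>t. t \<in> {0..1} \<Longrightarrow> \<gamma> t = \<gamma> 0\<close>[OF t] ..
    qed
    then show False using signed_area_velocity[OF v] area Kpos by (simp add: has_integral_iff)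
  qed
  have fr: "\<gamma> t \<in> frontier K" if "t \<in> {0..1}" for t
    by (rule tangential_curve_on_frontier[OF K(1) v inK N _ that]) (use const in blast)+
  obtain e where e: "0 < e" "cball c e \<subseteq> K" using K(3) by (meson mem_interior_cball)
  have tang: "e * norm (v t) \<le> cross2 (\<gamma> t - c) (v t)" if "t \<in> {0..1} - N" for t
  proof -
    have "c \<bullet> (- \<i> * v t) + e * norm (- \<i> * v t) \<le> supp K (- \<i> * v t)" by (rule supp_lower_ball[OF K(1) e])
    then show ?thesis using N(2)[OF that] by (simp only: cross2_inner cross2.diff_left) (simp add: norm_mult)
  qed
  have cont: "continuous_on {0..1} \<gamma>" by (rule has_velocityD(5)[OF v])
  obtain L0 where "L0-lipschitz_on {0..1} \<gamma>" using has_velocityD(1)[OF v] by blast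
  then have lip: "(L0+1)-lipschitz_on {0..1} \<gamma>" and "0 \<le> L0" by (auto elim!: lipschitz_on_mono simp: lipschitz_on_nonneg)
  define L where "L = L0 + 1"
  have L: "0 < L" "L-lipschitz_on {0..1} \<gamma>" using lip \<open>0 \<le> L0\<close> by (auto simp: L_def)
  have local_cross: "0 \<le> cross2 (\<gamma> s - c) (\<gamma> t - c)" if st: "0 \<le> s" "s \<le> t" "t \<le> 1" "t - s \<le> e / L" for s t
  proof -
    have "((\<lambda>\<tau>. cross2 (\<gamma> s - c) (v \<tau>)) has_integral cross2 (\<gamma> s - c) (\<gamma> t) - cross2 (\<gamma> s - c) (\<gamma> s)) {s..t}"
      by (rule velocity_linear_ftc[OF v cross2.bounded_linear_right st(1-3)])
    then have "0 \<le> cross2 (\<gamma> s - c) (\<gamma> t) - cross2 (\<gamma> s - c) (\<gamma> s)"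
    proof (rule has_integral_nonneg_ae[OF _ N(1)])
      fix \<tau> assume \<tau>: "\<tau> \<in> {s..t} - N"
      then have \<tau>01: "\<tau> \<in> {0..1} - N" "s \<in> {0..1}" using st by auto
      have "norm (\<gamma> \<tau> - \<gamma> s) \<le> L * (\<tau> - s)"
        using lipschitz_onD[OF L(2), of \<tau> s] \<tau> \<tau>01 by (auto simp: dist_norm)
      also have "\<dots> \<le> L * (e / L)" using \<tau> st L by (intro mult_left_mono) auto
      finally have "norm (\<gamma> \<tau> - \<gamma> s) * norm (v \<tau>) \<le> e * norm (v \<tau>)" using L by (intro mult_right_mono) auto
      then have "\<bar>cross2 (\<gamma> \<tau> - \<gamma> s) (v \<tau>)\<bar> \<le> e * norm (v \<tau>)" using cross2_le_norm order_trans by blast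
      moreover have "cross2 (\<gamma> s - c) (v \<tau>) = cross2 (\<gamma> \<tau> - c) (v \<tau>) - cross2 (\<gamma> \<tau> - \<gamma> s) (v \<tau>)"
        by (simp add: cross2.diff_left)
      ultimately show "0 \<le> cross2 (\<gamma> s - c) (v \<tau>)" using tang[OF \<tau>01(1)] by linarith
    qed
    also have "cross2 (\<gamma> s - c) (\<gamma> t) - cross2 (\<gamma> s - c) (\<gamma> s) = cross2 (\<gamma> s - c) (\<gamma> t - c)"
      by (simp add: cross2_def algebra_simps)
    finally show ?thesis .
  qed
  have neq: "\<gamma> t \<noteq> c" if "t \<in> {0..1}" for t using frontier_neq_center[OF K(3) fr[OF that]] .
  obtain \<theta> where \<theta>: "continuous_on {0..1} \<theta>" "\<And>t. t \<in> {0..1} \<Longrightarrow> \<gamma> t - c = norm (\<gamma> t - c) *\<^sub>R cis (\<theta> t)"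
    by (rule continuous_angle[OF cont neq]) blast+
  have "uniformly_continuous_on {0..1} \<theta>" by (rule compact_uniformly_continuous[OF \<theta>(1) compact_Icc])
  then obtain d where d: "0 < d" "\<And>x y. x \<in> {0..1} \<Longrightarrow> y \<in> {0..1} \<Longrightarrow> dist y x < d \<Longrightarrow> dist (\<theta> y) (\<theta> x) < pi"
    unfolding uniformly_continuous_on_def using pi_gt_zero by blast
  have mono: "mono_on {0..1} \<theta>"
  proof (rule mono_on_if_locally_mono[of "min d (e / L)"])
    fix s t assume st: "0 \<le> s" "s \<le> t" "t \<le> (1::real)" "t - s < min d (e / L)"
    then have 01: "s \<in> {0..1}" "t \<in> {0..1}" by auto
    have "0 \<le> cross2 (\<gamma> s - c) (\<gamma> t - c)" by (rule local_cross) (use st in auto)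
    also have "cross2 (\<gamma> s - c) (\<gamma> t - c) = norm (\<gamma> s - c) * norm (\<gamma> t - c) * sin (\<theta> t - \<theta> s)"
      by (subst \<theta>(2)[OF 01(1)], subst \<theta>(2)[OF 01(2)], rule cross2_cis)
    finally have "0 \<le> norm (\<gamma> s - c) * norm (\<gamma> t - c) * sin (\<theta> t - \<theta> s)" .
    moreover have "0 < norm (\<gamma> s - c) * norm (\<gamma> t - c)" using neq[OF 01(1)] neq[OF 01(2)] by simp
    ultimately have "0 \<le> sin (\<theta> t - \<theta> s)" by (meson mult_pos_neg not_less)
    moreover have "\<bar>\<theta> t - \<theta> s\<bar> < pi" using d(2)[OF 01] st by (simp add: dist_real_def)
    ultimately show "\<theta> s \<le> \<theta> t" using sin_gt_zero[of "\<theta> s - \<theta> t"] sin_minus[of "\<theta> s - \<theta> t"] by force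
  qed (use d e L in auto)
  have mono': "\<theta> s \<le> \<theta> t" if "0 \<le> s" "s \<le> t" "t \<le> 1" for s t using mono that by (auto simp: mono_on_def)
  have "norm (\<gamma> 0 - c) *\<^sub>R cis (\<theta> 1) = norm (\<gamma> 0 - c) *\<^sub>R cis (\<theta> 0)"
    using \<theta>(2)[of 0] \<theta>(2)[of 1] unfolding cl by simp
  then have "cis (\<theta> 1) = cis (\<theta> 0)" using neq[of 0] by simp
  then obtain k :: int where k: "\<theta> 1 = \<theta> 0 + 2 * pi * k" unfolding cis_eq_cis_iff by auto
  have same: "\<gamma> x = \<gamma> y" if xy: "x \<in> {0..1}" "y \<in> {0..1}" "cis (\<theta> x) = cis (\<theta> y)" for x y
  proof (rule frontier_ray_unique[OF K(2,3) fr[OF xy(1)] fr[OF xy(2)] \<theta>(2)[OF xy(1)]])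
    show "\<gamma> y - c = norm (\<gamma> y - c) *\<^sub>R cis (\<theta> x)" unfolding xy(3) by (rule \<theta>(2)[OF xy(2)])
  qed auto
  have "\<theta> 0 \<noteq> \<theta> 1"
  proof
    assume eq: "\<theta> 0 = \<theta> 1"
    have const\<theta>: "\<theta> t = \<theta> 0" if "t \<in> {0..1}" for t using mono'[of 0 t] mono'[of t 1] that eq by auto
    have "\<gamma> t = \<gamma> 0" if "t \<in> {0..1}" for t using same[of t 0] const\<theta>[OF that] that by simp
    then show False by (rule const)
  qed
  then have "\<theta> 0 < \<theta> 1" using mono'[of 0 1] by simp
  then have "0 < 2 * pi * real_of_int k" unfolding k by linarith
  then have k1: "1 \<le> k" by (simp add: zero_less_mult_iff)
  have "k = 1"
  proof (rule ccontr)
    assume "k \<noteq> 1"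
    then have "2 \<le> real_of_int k" using k1 by linarith
    then have "2 * pi * 2 \<le> 2 * pi * real_of_int k" by (intro mult_left_mono) auto
    then have big: "\<theta> 0 + 4 * pi \<le> \<theta> 1" using k by simp
    have big': "\<theta> 0 \<le> \<theta> 0 + 2 * pi" "\<theta> 0 + 2 * pi \<le> \<theta> 1" "\<theta> 0 \<le> \<theta> 0 + 3 * pi" "\<theta> 0 + 3 * pi \<le> \<theta> 1"
      using big pi_gt_zero by linarith+
    obtain t1 where t1: "0 \<le> t1" "t1 \<le> 1" "\<theta> t1 = \<theta> 0 + 2 * pi" using IVT'[OF big'(1,2) zero_le_one \<theta>(1)] by blast
    \<comment> \<open>Half a turn later the curve is on the opposite side of \<open>c\<close>, so it has moved since \<open>t1\<close>.\<close>
    obtain t2 where t2: "0 \<le> t2" "t2 \<le> 1" "\<theta> t2 = \<theta> 0 + 3 * pi" using IVT'[OF big'(3,4) zero_le_one \<theta>(1)] by blast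
    have t12: "t1 \<le> t2" using mono'[of t2 t1] t1 t2 by (cases "t1 \<le> t2") auto
    have c21: "cis (\<theta> t1) = cis (\<theta> 0)" "cis (\<theta> t2) = - cis (\<theta> t1)"
      unfolding t1(3) t2(3) by (simp_all add: complex_eq_iff cos_add sin_add)
    have "\<gamma> t1 = \<gamma> 0" using same[of t1 0] t1 c21 by auto
    have ne12: "\<gamma> t2 \<noteq> \<gamma> t1"
    proof
      assume "\<gamma> t2 = \<gamma> t1"
      then have "norm (\<gamma> t1 - c) *\<^sub>R (- cis (\<theta> t1)) = norm (\<gamma> t1 - c) *\<^sub>R cis (\<theta> t1)"
        using \<theta>(2)[of t2] \<theta>(2)[of t1] t1 t2 c21(2) by simp
      then have "- cis (\<theta> t1) = cis (\<theta> t1)" using neq[of t1] t1 by simp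
      then show False by (metis cis_neq_zero neg_eq_iff_add_eq_0 mult_2 mult_eq_0_iff zero_neq_numeral)
    qed
    let ?g = "\<lambda>t. \<gamma> (min t t1)" and ?w = "\<lambda>t. if t < t1 then v t else 0"
    have vg: "has_velocity ?g ?w" by (rule has_velocity_stop[OF v t1(1,2)])
    have "winds_once c K ?g"
      unfolding winds_once_def
    proof (intro exI[of _ "\<lambda>t. \<theta> (min t t1)"] conjI ballI)
      show "continuous_on {0..1} (\<lambda>t. \<theta> (min t t1))"
        by (rule continuous_on_compose2[OF \<theta>(1)]) (use t1 in \<open>auto intro!: continuous_intros\<close>)
      show "mono_on {0..1} (\<lambda>t. \<theta> (min t t1))"
        using t1 by (auto simp: mono_on_def intro!: mono')
    qed (use t1 fr \<theta>(2) in auto)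
    moreover have g01: "?g 0 = ?g 1" using t1 \<open>\<gamma> t1 = \<gamma> 0\<close> by simp
    ultimately have area1: "signed_area ?g = measure lebesgue K" using winds_once_area[OF K _ vg] by blast
    have I: "((\<lambda>t. cross2 (\<gamma> t) (v t)) has_integral 2 * measure lebesgue K) {0..1}"
      using signed_area_has_integral[OF v] area by simp
    have I1: "((\<lambda>t. cross2 (?g t) (?w t)) has_integral 2 * measure lebesgue K) {0..1}"
      using signed_area_has_integral[OF vg] area1 by simp
    have "((\<lambda>t. (cross2 (\<gamma> t) (v t) - cross2 c (v t)) - (cross2 (?g t) (?w t) - cross2 c (?w t))) has_integral
        ((2 * measure lebesgue K - 0) - (2 * measure lebesgue K - 0))) {0..1}"
      by (intro has_integral_diff I I1 velocity_integral_zero[OF v cl] velocity_integral_zero[OF vg g01])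
    then have diff0: "((\<lambda>t. (cross2 (\<gamma> t) (v t) - cross2 c (v t)) - (cross2 (?g t) (?w t) - cross2 c (?w t))) has_integral 0) {0..1}"
      by (simp only: diff_self)
    have zero: "((\<lambda>t. if t < t1 then 0 else cross2 (\<gamma> t - c) (v t)) has_integral 0) {0..1}"
      by (rule has_integral_eq[OF _ diff0]) (auto simp: cross2.diff_left cross2.zero_right)
    define u where "u = \<gamma> t2 - \<gamma> t1"
    have J: "((\<lambda>t. e * (u \<bullet> v t)) has_integral e * (u \<bullet> \<gamma> t2 - u \<bullet> \<gamma> t1)) {t1..t2}"
      by (intro has_integral_mult_right velocity_linear_ftc[OF v bounded_linear_inner_right]) (use t1 t2 t12 in auto)
    then have "((\<lambda>t. if t \<in> {t1..t2} then e * (u \<bullet> v t) else 0) has_integral e * (u \<bullet> \<gamma> t2 - u \<bullet> \<gamma> t1)) {0..1}"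
      by (subst has_integral_restrict) (use t1 t2 in auto)
    from has_integral_diff[OF has_integral_mult_right[OF zero, of "norm u"] this]
    have "0 \<le> norm u * 0 - e * (u \<bullet> \<gamma> t2 - u \<bullet> \<gamma> t1)"
    proof (rule has_integral_nonneg_ae[OF _ N(1)])
      fix t assume t: "t \<in> {0..1} - N"
      have "e * (u \<bullet> v t) \<le> norm u * (e * norm (v t))"
        using norm_cauchy_schwarz[of u "v t"] e(1) by (simp add: mult.left_commute)
      also have "\<dots> \<le> norm u * cross2 (\<gamma> t - c) (v t)" using tang[OF t] by (intro mult_left_mono) auto
      finally have 1: "e * (u \<bullet> v t) \<le> norm u * cross2 (\<gamma> t - c) (v t)" .
      have "0 \<le> e * norm (v t)" using e(1) by simp
      then have 2: "0 \<le> norm u * cross2 (\<gamma> t - c) (v t)" using tang[OF t] by simp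
      show "0 \<le> norm u * (if t < t1 then 0 else cross2 (\<gamma> t - c) (v t)) - (if t \<in> {t1..t2} then e * (u \<bullet> v t) else 0)"
        using 1 2 by auto
    qed
    then have "e * (u \<bullet> u) \<le> 0" by (simp add: u_def inner_diff_right)
    then have "u \<bullet> u \<le> 0" using e(1) by (simp add: mult_le_0_iff)
    then have "u \<bullet> u = 0" using inner_ge_zero[of u] by linarith
    then have "u = 0" by simp
    with ne12 show False by (simp add: u_def)
  qed
  then have "\<theta> 1 = \<theta> 0 + 2 * pi" using k by simp
  then show ?thesis unfolding winds_once_def using \<theta> mono fr by blast
qed

section \<open>The Wulff shape\<close>

locale anisotropy =
  fixes P :: "real \<Rightarrow> real"
  assumes cont: "continuous_on UNIV P" and periodic: "\<And>\<theta>. P (\<theta> + 2 * pi) = P \<theta>" and nonneg: "\<And>\<theta>. 0 \<le> P \<theta>"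
    and large: "\<exists>a b. b - a > pi \<and> (\<forall>\<theta>\<in>{a<..<b}. 0 < P \<theta>)"
begin

text \<open>The positively homogeneous extension of \<open>P\<close>, known as surface tension.\<close>

definition tension :: "complex \<Rightarrow> real" where
  "tension w = norm w * P (Arg w)"

definition wulff :: "complex set" where
  "wulff = {x. \<forall>w. x \<bullet> w \<le> tension w}"

lemma P_cis_cong: "cis a = cis b \<Longrightarrow> P a = P b"
proof -
  have nat: "P (x + 2 * pi * real n) = P x" for x n
  proof (induction n)
    case (Suc n)
    have "P (x + 2 * pi * real (Suc n)) = P ((x + 2 * pi * real n) + 2 * pi)" by (simp add: algebra_simps)
    then show ?case using periodic Suc by simp
  qed simp
  assume "cis a = cis b"
  then obtain n :: int where n: "a = b + 2 * pi * n" unfolding cis_eq_cis_iff by blast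
  show ?thesis
  proof (cases "0 \<le> n")
    case True
    then show ?thesis using nat[of b "nat n"] n by simp
  next
    case False
    then have "b = a + 2 * pi * real (nat (- n))" using n by simp
    then show ?thesis using nat[of a "nat (- n)"] by simp
  qed
qed

lemma tension_cis: "tension (r *\<^sub>R cis a) = r * P a" if "0 \<le> r"
proof (cases "r = 0")
  case False
  then have "cis (Arg (r *\<^sub>R cis a)) = cis a" using that by (simp add: cis_Arg sgn_div_norm norm_mult)
  from P_cis_cong[OF this] show ?thesis using that by (simp add: tension_def)
qed (simp add: tension_def)

lemma tension_scale: "0 \<le> r \<Longrightarrow> tension (r *\<^sub>R w) = r * tension w"
proof -
  assume r: "0 \<le> r"
  have w: "w = norm w *\<^sub>R cis (Arg w)" by (cases "w = 0") (simp_all add: cis_Arg sgn_div_norm)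
  have "r *\<^sub>R w = (r * norm w) *\<^sub>R cis (Arg w)" using arg_cong[OF w, of "\<lambda>z. r *\<^sub>R z"] by simp
  then have "tension (r *\<^sub>R w) = tension ((r * norm w) *\<^sub>R cis (Arg w))" by (simp only:)
  also have "\<dots> = r * tension w" using r by (subst tension_cis) (auto simp: tension_def)
  finally show ?thesis .
qed

lemma tension_nonneg: "0 \<le> tension w" by (simp add: tension_def nonneg)

lemma tension_bound: "\<exists>M. \<forall>w. tension w \<le> M * norm w"
proof -
  have "bounded (P ` {-pi..pi})" by (intro compact_imp_bounded compact_continuous_image compact_Icc continuous_on_subset[OF cont]) auto
  then obtain M where M: "\<forall>y\<in>P ` {-pi..pi}. norm y \<le> M" unfolding bounded_iff by blast
  have "tension w \<le> M * norm w" for w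
  proof -
    have "Arg w \<in> {-pi..pi}" using Arg_bounded[of w] by auto
    then have "P (Arg w) \<le> M" using M by (auto simp: abs_le_iff)
    then have "norm w * P (Arg w) \<le> norm w * M" by (rule mult_left_mono) simp
    then show ?thesis by (simp add: tension_def mult.commute)
  qed
  then show ?thesis by blast
qed

text \<open>Across the negative real axis, where \<^const>\<open>Arg\<close> jumps, \<open>Arg w\<close> may be replaced by
  \<open>Arg (- w) + pi\<close> by periodicity.\<close>

lemma tension_continuous: "continuous_on UNIV tension"
proof -
  have "isCont tension w" for w
  proof (cases "w = 0")
    case True
    obtain M where M: "\<And>w. tension w \<le> M * norm w" using tension_bound by blast
    have "(tension \<longlongrightarrow> 0) (at 0)"
    proof (rule tendsto_sandwich[of "\<lambda>_. 0" tension _ "\<lambda>w. M * norm w"])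
      show "((\<lambda>w::complex. M * norm w) \<longlongrightarrow> 0) (at 0)" by (auto intro!: tendsto_eq_intros)
    qed (auto simp: tension_nonneg M)
    then show ?thesis using True by (simp add: isCont_def tension_def)
  next
    case False
    have P: "isCont P x" for x using cont by (simp add: continuous_on_eq_continuous_at)
    have "w \<notin> \<real>\<^sub>\<le>\<^sub>0 \<or> - w \<notin> \<real>\<^sub>\<le>\<^sub>0" using False by (auto simp: complex_nonpos_Reals_iff complex_eq_iff)
    then consider "w \<notin> \<real>\<^sub>\<le>\<^sub>0" | "- w \<notin> \<real>\<^sub>\<le>\<^sub>0" by blast
    then show ?thesis
    proof cases
      case 1
      have "isCont (\<lambda>w. norm w * P (Arg w)) w"
        by (intro continuous_intros isCont_o2[OF continuous_at_Arg[OF 1] P])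
      then show ?thesis by (simp add: tension_def[abs_def])
    next
      case 2
      have eq: "P (Arg w) = P (Arg (- w) + pi)" if "w \<noteq> 0" for w
      proof (rule P_cis_cong)
        have "cis (Arg (- w) + pi) = - cis (Arg (- w))" by (simp add: complex_eq_iff)
        then show "cis (Arg w) = cis (Arg (- w) + pi)" using that by (simp add: cis_Arg sgn_div_norm)
      qed
      have "isCont (\<lambda>w. Arg (- w)) w" by (rule isCont_o2[of w uminus Arg, OF _ continuous_at_Arg[OF 2]]) (auto intro!: continuous_intros)
      then have "isCont (\<lambda>w. norm w * P (Arg (- w) + pi)) w"
        by (intro continuous_intros isCont_o2[of w "\<lambda>w. Arg (- w) + pi" P, OF _ P])
      moreover have "tension = (\<lambda>w. norm w * P (Arg (- w) + pi))"
        using eq by (auto simp: tension_def fun_eq_iff)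
      ultimately show ?thesis by simp
    qed
  qed
  then show ?thesis by (simp add: continuous_at_imp_continuous_on)
qed

lemma minkowski_Omega: "minkowski (Omega P) w = tension w"
proof -
  have "{r. r > 0 \<and> w \<in> (\<lambda>z. r *\<^sub>R z) ` Omega P} = {r. r > 0 \<and> tension w \<le> r}"
  proof (rule Collect_cong, rule conj_cong[OF refl])
    fix r :: real assume r: "r > 0"
    have "w \<in> (\<lambda>z. r *\<^sub>R z) ` Omega P \<longleftrightarrow> (1 / r) *\<^sub>R w \<in> Omega P"
      using r by (auto intro!: image_eqI[of _ _ "(1 / r) *\<^sub>R w"])
    also have "\<dots> \<longleftrightarrow> tension ((1 / r) *\<^sub>R w) \<le> 1" by (simp add: Omega_def tension_def)
    also have "\<dots> \<longleftrightarrow> tension w \<le> r" using r by (subst tension_scale) (auto simp: field_simps)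
    finally show "w \<in> (\<lambda>z. r *\<^sub>R z) ` Omega P \<longleftrightarrow> tension w \<le> r" .
  qed
  moreover have "Inf {r. r > 0 \<and> tension w \<le> r} = tension w"
  proof (rule cInf_eq_non_empty)
    show "{r. r > 0 \<and> tension w \<le> r} \<noteq> {}" using tension_nonneg[of w] by (auto intro!: exI[of _ "tension w + 1"])
    fix y assume y: "\<And>x. x \<in> {r. r > 0 \<and> tension w \<le> r} \<Longrightarrow> y \<le> x"
    show "y \<le> tension w"
    proof (rule field_le_epsilon)
      fix e :: real assume "0 < e"
      then show "y \<le> tension w + e" using y[of "tension w + e"] tension_nonneg[of w] by auto
    qed
  qed auto
  ultimately show ?thesis by (simp add: minkowski_def)
qed

lemma polar_eq_wulff: "polar_set (convex hull (Omega P)) = wulff"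
proof (intro equalityI subsetI)
  fix x assume x: "x \<in> polar_set (convex hull (Omega P))"
  then have le1: "x \<bullet> w \<le> 1" if "tension w \<le> 1" for w
    using hull_inc[of w "Omega P"] that by (auto simp: polar_set_def Omega_def tension_def)
  have "x \<bullet> w \<le> tension w" for w
  proof (rule field_le_epsilon)
    fix e :: real assume e: "0 < e"
    let ?k = "tension w + e"
    have k: "0 < ?k" using e tension_nonneg[of w] by simp
    have "tension ((1 / ?k) *\<^sub>R w) \<le> 1" using k e by (subst tension_scale) (auto simp: field_simps)
    from le1[OF this] show "x \<bullet> w \<le> tension w + e" using k by (simp add: field_simps)
  qed
  then show "x \<in> wulff" by (simp add: wulff_def)
next
  fix x assume x: "x \<in> wulff"
  have "Omega P \<subseteq> {w. x \<bullet> w \<le> 1}"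
  proof
    fix w assume "w \<in> Omega P"
    then have "tension w \<le> 1" by (simp add: Omega_def tension_def)
    moreover have "x \<bullet> w \<le> tension w" using x by (simp add: wulff_def)
    ultimately show "w \<in> {w. x \<bullet> w \<le> 1}" by simp
  qed
  then have "convex hull (Omega P) \<subseteq> {w. x \<bullet> w \<le> 1}" by (rule hull_minimal) (rule convex_halfspace_le)
  then show "x \<in> polar_set (convex hull (Omega P))" by (auto simp: polar_set_def)
qed

text \<open>By compactness of the unit circle the inequality holds with a margin \<open>d\<close>, and then on the ball of
  radius \<open>d\<close> around \<open>x\<close>.\<close>

lemma wulff_interiorI:
  assumes "\<And>w. norm w = 1 \<Longrightarrow> x \<bullet> w < tension w"
  shows "x \<in> interior wulff"
proof -
  have "\<exists>w\<in>sphere (0::complex) 1. \<forall>y\<in>sphere 0 1. tension w - x \<bullet> w \<le> tension y - x \<bullet> y"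
    by (intro continuous_attains_inf continuous_intros continuous_on_subset[OF tension_continuous]) (auto intro: exI[of _ 1])
  then obtain w0 where w0: "norm w0 = 1" "\<And>y. norm y = 1 \<Longrightarrow> tension w0 - x \<bullet> w0 \<le> tension y - x \<bullet> y" by auto
  define d where "d = tension w0 - x \<bullet> w0"
  have d: "0 < d" using assms w0 by (simp add: d_def)
  have "ball x d \<subseteq> wulff"
  proof
    fix z assume z: "z \<in> ball x d"
    have "z \<bullet> w \<le> tension w" for w
    proof (cases "w = 0")
      case False
      define y where "y = w /\<^sub>R norm w"
      have y: "norm y = 1" "w = norm w *\<^sub>R y" using False by (auto simp: y_def)
      have "(z - x) \<bullet> y \<le> norm (z - x)" using norm_cauchy_schwarz[of "z - x" y] y by simp
      also have "\<dots> \<le> d" using z by (simp add: dist_norm norm_minus_commute)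
      finally have "z \<bullet> y \<le> tension y" using w0(2)[OF y(1)] by (simp add: d_def inner_diff_left)
      then have "norm w * (z \<bullet> y) \<le> norm w * tension y" by (simp add: mult_left_mono)
      moreover have "z \<bullet> w = norm w * (z \<bullet> y)" using arg_cong[OF y(2), of "\<lambda>u. z \<bullet> u"] by simp
      moreover have "tension w = norm w * tension y" using tension_scale[of "norm w" y] y(2)[symmetric] by simp
      ultimately show ?thesis by simp
    qed (simp add: tension_nonneg)
    then show "z \<in> wulff" by (simp add: wulff_def)
  qed
  then show ?thesis using d by (meson mem_interior)
qed

lemma wulff_compact: "compact wulff"
proof -
  have "wulff = (\<Inter>w. {x. w \<bullet> x \<le> tension w})" by (auto simp: wulff_def inner_commute)
  then have "closed wulff" by (simp add: closed_INT closed_halfspace_le)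
  moreover obtain M where M: "\<And>w. tension w \<le> M * norm w" using tension_bound by blast
  have "norm x \<le> M" if "x \<in> wulff" for x
  proof (cases "x = 0")
    case True
    then show ?thesis using M[of 1] tension_nonneg[of 1] by simp
  next
    case False
    have "x \<bullet> x \<le> M * norm x" using that M[of x] by (force simp: wulff_def intro: order_trans)
    then show ?thesis using False by (simp add: power2_norm_eq_inner[symmetric] power2_eq_square)
  qed
  then have "bounded wulff" by (rule boundedI)
  ultimately show ?thesis by (simp add: compact_eq_bounded_closed)
qed

lemma wulff_contact:
  assumes "x \<in> frontier wulff"
  obtains w where "norm w = 1" "x \<bullet> w = tension w" "x \<in> wulff"
proof -
  have cl: "closed wulff" by (rule compact_imp_closed[OF wulff_compact])
  have x: "x \<in> wulff" "x \<notin> interior wulff" using assms cl by (auto simp: frontier_def closure_closed)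
  then obtain w where "norm w = 1" "\<not> x \<bullet> w < tension w" using wulff_interiorI by blast
  moreover have "x \<bullet> w \<le> tension w" using x by (simp add: wulff_def)
  ultimately show ?thesis using that x(1) by force
qed

lemma wulff_convex: "convex wulff"
proof -
  have "wulff = (\<Inter>w. {x. w \<bullet> x \<le> tension w})" by (auto simp: wulff_def inner_commute)
  then show ?thesis by (simp add: convex_INT convex_halfspace_le)
qed

text \<open>If \<open>m\<close> is the middle of the given interval, a small positive multiple of \<open>cis m\<close> is interior: in
  the closed half plane of directions around \<open>m\<close> the tension has a positive lower bound, and in the
  other directions the inner product with \<open>cis m\<close> is negative.\<close>

lemma wulff_interior: "interior wulff \<noteq> {}"
proof -
  obtain a b where ab: "b - a > pi" "\<And>\<theta>. \<theta> \<in> {a<..<b} \<Longrightarrow> 0 < P \<theta>" using large by blast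
  define m where "m = (a + b) / 2"
  have pos: "0 < P \<theta>" if "\<theta> \<in> {m - pi/2..m + pi/2}" for \<theta> using that ab(1) by (intro ab(2)) (auto simp: m_def field_simps)
  have "\<exists>x\<in>{m - pi/2..m + pi/2}. \<forall>y\<in>{m - pi/2..m + pi/2}. P x \<le> P y"
    by (intro continuous_attains_inf compact_Icc continuous_on_subset[OF cont]) auto
  then obtain \<theta>0 where \<theta>0: "\<theta>0 \<in> {m - pi/2..m + pi/2}" "\<And>y. y \<in> {m - pi/2..m + pi/2} \<Longrightarrow> P \<theta>0 \<le> P y" by blast
  define e where "e = P \<theta>0 / 2"
  have e: "0 < e" using pos[OF \<theta>0(1)] by (simp add: e_def)
  have "e *\<^sub>R cis m \<in> interior wulff"
  proof (rule wulff_interiorI)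
    fix w :: complex assume w: "norm w = 1"
    obtain k :: int where k: "m - pi \<le> Arg w + 2 * pi * k" "Arg w + 2 * pi * k < m - pi + 2 * pi" by (rule angle_normalize)
    define \<phi> where "\<phi> = Arg w + 2 * pi * k"
    have "cis \<phi> = cis (Arg w)" unfolding \<phi>_def cis_eq_cis_iff by blast
    moreover have "w \<noteq> 0" using w by auto
    then have "cis (Arg w) = w" using w by (simp add: cis_Arg sgn_div_norm)
    ultimately have wc: "w = cis \<phi>" by simp
    have T: "tension w = P \<phi>" unfolding wc using tension_cis[of 1 \<phi>] by simp
    have I: "(e *\<^sub>R cis m) \<bullet> w = e * cos (\<phi> - m)" unfolding wc by (simp add: inner_complex_def cos_diff algebra_simps)
    show "(e *\<^sub>R cis m) \<bullet> w < tension w"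
    proof (cases "\<bar>\<phi> - m\<bar> \<le> pi / 2")
      case True
      have "\<phi> \<in> {m - pi/2..m + pi/2}" using abs_le_D1[OF True] abs_le_D2[OF True] by auto
      from \<theta>0(2)[OF this] have "2 * e \<le> P \<phi>" by (simp add: e_def)
      moreover have "e * cos (\<phi> - m) \<le> e * 1" using e by (intro mult_left_mono) auto
      ultimately show ?thesis unfolding T I using e by linarith
    next
      case False
      moreover have "\<bar>\<phi> - m\<bar> \<le> pi" using k by (auto simp: \<phi>_def abs_le_iff)
      ultimately have "cos \<bar>\<phi> - m\<bar> < cos (pi / 2)" by (intro cos_monotone_0_pi) auto
      then have "cos (\<phi> - m) < 0" by simp
      then have "e * cos (\<phi> - m) < 0" using e by (simp add: mult_pos_neg)
      then show ?thesis unfolding T I using nonneg[of \<phi>] by linarith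
    qed
  qed
  then show ?thesis by blast
qed

lemma wulff_nonempty: "wulff \<noteq> {}" using wulff_interior interior_subset by blast

lemma supp_wulff_le: "supp wulff w \<le> tension w"
  by (rule supp_least[OF wulff_compact wulff_nonempty]) (simp add: wulff_def)

end

section \<open>Optimal curves and optimal bodies\<close>

lemma reparametrization_surj:
  assumes "reparametrization_of \<gamma> \<beta>"
  shows "\<gamma> ` {0..1} = \<beta> ` {0..1}"
proof -
  obtain \<phi> :: "real \<Rightarrow> real" where \<phi>: "continuous_on {0..1} \<phi>" "mono_on {0..1} \<phi>" "\<phi> 0 = 0" "\<phi> 1 = 1"
    and eq: "\<And>t. t \<in> {0..1} \<Longrightarrow> \<gamma> t = \<beta> (\<phi> t)"
    using assms unfolding reparametrization_of_def by blast
  have 01: "\<phi> t \<in> {0..1}" if "t \<in> {0..1}" for t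
  proof -
    have "\<phi> 0 \<le> \<phi> t" "\<phi> t \<le> \<phi> 1" using \<phi>(2) that by (auto simp: mono_on_def)
    then show ?thesis using \<phi>(3,4) by simp
  qed
  have hit: "\<exists>t\<in>{0..1}. \<phi> t = s" if "s \<in> {0..1}" for s
    using IVT'[of \<phi> 0 s 1] \<phi> that by auto
  show ?thesis
  proof (intro equalityI subsetI)
    fix z assume "z \<in> \<gamma> ` {0..1}" then show "z \<in> \<beta> ` {0..1}" using eq 01 by auto
  next
    fix z assume "z \<in> \<beta> ` {0..1}"
    then obtain s where s: "s \<in> {0..1}" "z = \<beta> s" by blast
    with hit obtain t where t: "t \<in> {0..1}" "\<phi> t = s" by blast
    then have "z = \<gamma> t" using eq[OF t(1)] s by simp
    with t(1) show "z \<in> \<gamma> ` {0..1}" by blast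
  qed
qed

lemma boundary_curve_unique:
  assumes "boundary_curve \<gamma> B" "boundary_curve \<gamma> B'"
  shows "B = B'"
proof -
  have "frontier X = \<gamma> ` {0..1}" if "boundary_curve \<gamma> X" for X
    using that reparametrization_surj unfolding boundary_curve_def simple_boundary_loop_def path_image_def by metis
  with assms have "frontier B = frontier B'" by simp
  then show ?thesis using assms unfolding boundary_curve_def by metis
qed

lemma winds_once_boundary_curve:
  fixes K :: "complex set"
  assumes K: "compact K" "convex K" "c \<in> interior K" and w: "winds_once c K \<gamma>"
    and \<gamma>: "closed_lipschitz_curve \<gamma>" and pos: "0 < signed_area \<gamma>"
  shows "boundary_curve \<gamma> K"
proof -
  have "inside (frontier K) = interior K"
    by (rule inside_frontier_eq_interior[OF compact_imp_bounded[OF K(1)] K(2)])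
  moreover have "K = frontier K \<union> interior K"
    using closure_closed[OF compact_imp_closed[OF K(1)]] interior_subset[of K] by (auto simp: frontier_def)
  ultimately show ?thesis
    using winds_once_reparametrization[OF K w] \<gamma> pos unfolding boundary_curve_def by simp
qed

text \<open>The reversed curve cannot wind once around \<open>K\<close>, because then its signed area would be the measure
  of \<open>K\<close> and that of \<open>\<gamma>\<close> would not be positive.\<close>

lemma boundary_curve_winds_once:
  fixes K :: "complex set"
  assumes K: "compact K" "convex K" "c \<in> interior K" and b: "boundary_curve \<gamma> K" and v: "has_velocity \<gamma> v"
  shows "winds_once c K \<gamma>"
proof -
  have cl: "\<gamma> 0 = \<gamma> 1" and pos: "0 < signed_area \<gamma>" using b by (auto simp: boundary_curve_def closed_lipschitz_curve_def)
  have "winds_once c K \<gamma> \<or> winds_once c K (\<lambda>t. \<gamma> (1 - t))"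
    using b reparametrization_winds_once[OF K] unfolding boundary_curve_def by blast
  moreover have "\<not> winds_once c K (\<lambda>t. \<gamma> (1 - t))"
  proof
    assume "winds_once c K (\<lambda>t. \<gamma> (1 - t))"
    then have "signed_area (\<lambda>t. \<gamma> (1 - t)) = measure lebesgue K"
      by (rule winds_once_area[OF K _ has_velocity_reverse[OF v]]) (use cl in simp)
    then show False using signed_area_reverse[OF v] pos measure_nonneg[of lebesgue K] by linarith
  qed
  ultimately show ?thesis by blast
qed

context anisotropy
begin

lemma tension_integrable:
  assumes v: "has_velocity \<gamma> v"
  shows "(\<lambda>t. tension (- \<i> * v t)) integrable_on {0..1}"
proof (rule velocity_integrable[where \<gamma>="\<lambda>_. 0" and F="\<lambda>_ w. tension (- \<i> * w)"])
  show "continuous_on UNIV (\<lambda>z. tension (- \<i> * snd z))"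
    by (rule continuous_on_compose2[OF tension_continuous]) (auto intro!: continuous_intros)
qed (use has_velocityD[OF v] in auto)

lemma curve_energy_tension:
  assumes v: "has_velocity \<gamma> v"
  shows "curve_energy (Omega P) \<gamma> = integral {0..1} (\<lambda>t. tension (- \<i> * v t))"
  using curve_energy_velocity[OF v] by (simp only: minkowski_Omega)

lemma length_in_wulff_le:
  assumes v: "has_velocity \<gamma> v"
  shows "length_in wulff v \<le> curve_energy (Omega P) \<gamma>"
  unfolding curve_energy_tension[OF v] length_in_def
  by (rule integral_le[OF supp_integrable[OF wulff_compact wulff_nonempty] tension_integrable[OF v] supp_wulff_le])
     (use has_velocityD[OF v] in auto)

definition wulff_area :: real where "wulff_area = measure lebesgue wulff"

text \<open>The scaling factor is the one that gives the copy the area \<open>A\<close>.\<close>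

definition wulff_copy :: "real \<Rightarrow> complex \<Rightarrow> complex set" where
  "wulff_copy A c = (\<lambda>p. c + sqrt (A / wulff_area) *\<^sub>R p) ` wulff"

lemma wulff_area_pos: "0 < wulff_area"
  unfolding wulff_area_def by (rule measure_convex_pos[OF wulff_compact wulff_convex wulff_interior])

lemma wulff_copy_eq: "wulff_copy A c = (+) c ` (\<lambda>p. sqrt (A / wulff_area) *\<^sub>R p) ` wulff"
  by (simp add: wulff_copy_def image_image)

lemma wulff_copy_compact: "compact (wulff_copy A c)" and wulff_copy_convex: "convex (wulff_copy A c)"
  unfolding wulff_copy_eq
  by (intro compact_translation compact_scaling wulff_compact convex_translation convex_scaling wulff_convex)+

lemma
  assumes A: "0 < A"
  shows wulff_copy_measure: "measure lebesgue (wulff_copy A c) = A"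
    and wulff_copy_frontier: "frontier (wulff_copy A c) = (\<lambda>p. c + sqrt (A / wulff_area) *\<^sub>R p) ` frontier wulff"
    and wulff_copy_interior: "interior (wulff_copy A c) \<noteq> {}"
    and wulff_copy_supp: "supp (wulff_copy A c) u = c \<bullet> u + sqrt (A / wulff_area) * supp wulff u"
proof -
  define l where "l = sqrt (A / wulff_area)"
  have l: "0 < l" "l\<^sup>2 * wulff_area = A" using A wulff_area_pos by (auto simp: l_def)
  have eq: "wulff_copy A c = (+) c ` (\<lambda>p. l *\<^sub>R p) ` wulff" by (simp add: wulff_copy_eq l_def)
  show m: "measure lebesgue (wulff_copy A c) = A"
  proof -
    have "wulff_copy A c = (\<lambda>x. l *\<^sub>R x + c) ` wulff" by (simp add: wulff_copy_def l_def add.commute)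
    then show ?thesis using measure_lebesgue_affine[of l c wulff] l(2) by (simp add: wulff_area_def)
  qed
  have "closed (wulff_copy A c)" "closed wulff" using compact_imp_closed wulff_copy_compact wulff_compact by blast+
  have inj: "inj (\<lambda>p::complex. l *\<^sub>R p)" by (rule injI) (use l in simp)
  have lin: "linear (\<lambda>p::complex. l *\<^sub>R p)" by (rule linear_scaleR)
  show "frontier (wulff_copy A c) = (\<lambda>p. c + sqrt (A / wulff_area) *\<^sub>R p) ` frontier wulff"
  proof -
    have "bij (\<lambda>p::complex. l *\<^sub>R p)"
      using l by (intro bijI inj surjI[of _ "\<lambda>p. (1 / l) *\<^sub>R p"]) auto
    then have "frontier ((\<lambda>p. l *\<^sub>R p) ` wulff) = (\<lambda>p. l *\<^sub>R p) ` frontier wulff"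
      by (simp add: frontier_def closure_injective_linear_image[OF lin inj] interior_bijective_linear_image[OF lin] image_set_diff[OF inj])
    then show ?thesis unfolding eq frontier_translation by (simp add: image_image l_def)
  qed
  show "interior (wulff_copy A c) \<noteq> {}"
    using m A negligible_convex_interior[OF wulff_copy_convex] negligible_imp_measure0 by force
  show "supp (wulff_copy A c) u = c \<bullet> u + sqrt (A / wulff_area) * supp wulff u"
  proof (rule antisym)
    have ne: "wulff_copy A c \<noteq> {}" using wulff_nonempty by (simp add: wulff_copy_def)
    show "supp (wulff_copy A c) u \<le> c \<bullet> u + sqrt (A / wulff_area) * supp wulff u"
      using l(1) by (intro supp_least[OF wulff_copy_compact ne])
        (auto simp: wulff_copy_def inner_add_left l_def[symmetric] intro!: mult_left_mono supp_upper[OF wulff_compact wulff_nonempty])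
    obtain x where x: "x \<in> wulff" "x \<bullet> u = supp wulff u" using supp_attained[OF wulff_compact wulff_nonempty] by blast
    have "c + l *\<^sub>R x \<in> wulff_copy A c" using x(1) by (auto simp: wulff_copy_def l_def)
    from supp_upper[OF wulff_copy_compact ne this, of u] x(2)
    show "c \<bullet> u + sqrt (A / wulff_area) * supp wulff u \<le> supp (wulff_copy A c) u" by (simp add: inner_add_left l_def)
  qed
qed

definition least_energy :: "real \<Rightarrow> real" where
  "least_energy A = 2 * sqrt (A * wulff_area)"

lemma curve_energy_lower_bound:
  assumes \<gamma>: "closed_lipschitz_curve \<gamma>" and A: "signed_area \<gamma> = A" "0 < A"
  shows "least_energy A \<le> curve_energy (Omega P) \<gamma>"
proof -
  obtain v where v: "has_velocity \<gamma> v" using \<gamma> lipschitz_has_velocity unfolding closed_lipschitz_curve_def by blast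
  have "least_energy A \<le> length_in wulff v"
    unfolding least_energy_def A(1)[symmetric] wulff_area_def
    by (rule isoperimetric_inequality[OF wulff_compact wulff_convex wulff_interior v])
       (use \<gamma> A in \<open>auto simp: closed_lipschitz_curve_def\<close>)
  then show ?thesis using length_in_wulff_le[OF v] by linarith
qed

text \<open>The curve lies in a copy of the Wulff shape.  The support function of this copy at the normal
  dominates \<open>\<gamma> \<bullet> u\<close>, and both have the integral \<open>2 * A\<close>, so they agree almost everywhere.\<close>

lemma least_energy_curve:
  assumes \<gamma>: "closed_lipschitz_curve \<gamma>" and A: "signed_area \<gamma> = A" "0 < A"
    and E: "curve_energy (Omega P) \<gamma> = least_energy A"
  obtains c where "boundary_curve \<gamma> (wulff_copy A c)"
proof -
  obtain v where v: "has_velocity \<gamma> v" using \<gamma> lipschitz_has_velocity unfolding closed_lipschitz_curve_def by blast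
  have cl: "\<gamma> 0 = \<gamma> 1" using \<gamma> by (simp add: closed_lipschitz_curve_def)
  note W = wulff_compact wulff_convex wulff_interior
  have pos: "0 < signed_area \<gamma>" using A by simp
  have len: "length_in wulff v = 2 * sqrt (signed_area \<gamma> * measure lebesgue wulff)"
    using isoperimetric_inequality[OF W v cl pos] length_in_wulff_le[OF v] E
    by (simp add: least_energy_def A(1) wulff_area_def)
  obtain c where "\<And>t. t \<in> {0..1} \<Longrightarrow> \<gamma> t - c \<in> (\<lambda>x. sqrt (signed_area \<gamma> / measure lebesgue wulff) *\<^sub>R x) ` wulff"
    by (rule isoperimetric_equality_inscribed[OF W v cl pos len]) blast
  then have inK: "\<gamma> t \<in> wulff_copy A c" if "t \<in> {0..1}" for t
    using that unfolding A(1) wulff_area_def[symmetric] wulff_copy_def by (force simp: algebra_simps)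
  let ?K = "wulff_copy A c"
  note K = wulff_copy_compact[of A c] wulff_copy_convex[of A c]
  have Kne: "?K \<noteq> {}" using wulff_nonempty by (simp add: wulff_copy_def)
  have I1: "((\<lambda>t. cross2 (\<gamma> t) (v t)) has_integral 2 * A) {0..1}"
    using signed_area_has_integral[OF v] A(1) by simp
  have I2: "((\<lambda>t. supp wulff (- \<i> * v t)) has_integral 2 * sqrt (A * wulff_area)) {0..1}"
    using len supp_integrable[OF wulff_compact wulff_nonempty has_velocityD(2,3)[OF v], of 0 1]
    by (simp add: has_integral_iff length_in_def A(1) wulff_area_def)
  have "sqrt (A / wulff_area) * (2 * sqrt (A * wulff_area)) = 2 * A"
  proof -
    have "sqrt (A / wulff_area) * sqrt (A * wulff_area) = sqrt (A * A)"
      using wulff_area_pos by (simp add: real_sqrt_mult[symmetric])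
    then show ?thesis using A by simp
  qed
  with has_integral_diff[OF has_integral_add[OF velocity_integral_zero[OF v cl, of c] has_integral_mult_right[OF I2, of "sqrt (A / wulff_area)"]] I1]
  have "((\<lambda>t. (cross2 c (v t) + sqrt (A / wulff_area) * supp wulff (- \<i> * v t)) - cross2 (\<gamma> t) (v t)) has_integral (0 + 2 * A) - 2 * A) {0..1}"
    by (simp only:)
  then have zero: "((\<lambda>t. supp ?K (- \<i> * v t) - cross2 (\<gamma> t) (v t)) has_integral 0) {0..1}"
    unfolding wulff_copy_supp[OF A(2)] cross2_inner by simp
  have "negligible {t\<in>{0..1}. supp ?K (- \<i> * v t) - cross2 (\<gamma> t) (v t) \<noteq> 0}"
  proof (rule has_integral_zero_ae[OF zero])
    fix t :: real assume "t \<in> {0..1}"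
    from supp_upper[OF K(1) Kne inK[OF this], of "- \<i> * v t"]
    show "0 \<le> supp ?K (- \<i> * v t) - cross2 (\<gamma> t) (v t)" by (simp only: cross2_inner)
  qed
  moreover obtain k where k: "k \<in> interior ?K" using wulff_copy_interior[OF A(2)] by blast
  ultimately have "winds_once k ?K \<gamma>"
    by (intro tangential_curve_winds_once[OF K k v cl inK]) (auto simp: A(1) wulff_copy_measure[OF A(2)])
  then have "boundary_curve \<gamma> ?K"
    by (rule winds_once_boundary_curve[OF K k _ \<gamma> pos])
  then show ?thesis by (rule that)
qed

text \<open>At almost all times the normal is unique, so it is the direction in which the boundary point
  attains the tension.  Hence the integrand of the energy is that of twice the area, up to the
  translation, which does not change the integral, and the scaling factor.\<close>

lemma wulff_copy_boundary_curve:
  assumes A: "0 < A" and b: "boundary_curve \<gamma> (wulff_copy A c)"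
  shows "signed_area \<gamma> = A" "curve_energy (Omega P) \<gamma> = least_energy A"
proof -
  let ?K = "wulff_copy A c"
  define l where "l = sqrt (A / wulff_area)"
  have l: "0 < l" using A wulff_area_pos by (simp add: l_def)
  note K = wulff_copy_compact[of A c] wulff_copy_convex[of A c]
  obtain k where k: "k \<in> interior ?K" using wulff_copy_interior[OF A] by blast
  obtain v where v: "has_velocity \<gamma> v"
    using b lipschitz_has_velocity unfolding boundary_curve_def closed_lipschitz_curve_def by blast
  have cl: "\<gamma> 0 = \<gamma> 1" using b by (auto simp: boundary_curve_def closed_lipschitz_curve_def)
  have w: "winds_once k ?K \<gamma>" by (rule boundary_curve_winds_once[OF K k b v])
  show area: "signed_area \<gamma> = A"
    using winds_once_area[OF K k w v cl] wulff_copy_measure[OF A] by simp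
  have I1: "((\<lambda>t. cross2 (\<gamma> t) (v t)) has_integral 2 * A) {0..1}"
    using signed_area_has_integral[OF v] area by simp
  have "((\<lambda>t. (1 / l) * (cross2 (\<gamma> t) (v t) - cross2 c (v t))) has_integral (1 / l) * (2 * A - 0)) {0..1}"
    by (intro has_integral_mult_right has_integral_diff I1 velocity_integral_zero[OF v cl])
  then have "((\<lambda>t. tension (- \<i> * v t)) has_integral (1 / l) * (2 * A - 0)) {0..1}"
  proof (rule has_integral_spike[rotated 2])
    show "negligible ({t\<in>{0<..<1}. \<not> (\<gamma> has_vector_derivative v t) (at t)} \<union> {0,1})"
      using has_velocityD(4)[OF v] by (simp add: negligible_Un)
    fix t assume "t \<in> {0..1} - ({t\<in>{0<..<1}. \<not> (\<gamma> has_vector_derivative v t) (at t)} \<union> {0,1})"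
    then have t: "t \<in> {0<..<1}" "t \<in> {0..1}" "(\<gamma> has_vector_derivative v t) (at t)" by auto
    show "tension (- \<i> * v t) = (1 / l) * (cross2 (\<gamma> t) (v t) - cross2 c (v t))"
    proof (cases "v t = 0")
      case True
      then show ?thesis by (simp add: tension_def cross2.zero_right)
    next
      case False
      have "\<gamma> t \<in> frontier ?K" using w t(2) unfolding winds_once_def by blast
      then obtain x where x: "x \<in> frontier wulff" "\<gamma> t = c + l *\<^sub>R x"
        unfolding wulff_copy_frontier[OF A] l_def by blast
      obtain n where n: "norm n = 1" "x \<bullet> n = tension n" by (rule wulff_contact[OF x(1)])
      have "n = (- \<i> * v t) /\<^sub>R norm (v t)"
      proof (rule winds_once_normal(3)[OF K k w t(1,3) False n(1)])
        fix y assume "y \<in> ?K"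
        then obtain p where p: "p \<in> wulff" "y = c + l *\<^sub>R p" unfolding wulff_copy_def l_def by blast
        have "p \<bullet> n \<le> x \<bullet> n" using p(1) n(2) by (simp add: wulff_def)
        then show "(y - \<gamma> t) \<bullet> n \<le> 0" using l by (simp add: p x inner_diff_left)
      qed
      then have u: "- \<i> * v t = norm (v t) *\<^sub>R n" using False by simp
      have "tension (- \<i> * v t) = norm (v t) * tension n" unfolding u by (rule tension_scale) simp
      also have "\<dots> = x \<bullet> (- \<i> * v t)" unfolding u by (simp add: n(2))
      also have "\<dots> = cross2 x (v t)" by (rule cross2_inner)
      also have "\<dots> = (1 / l) * (cross2 (\<gamma> t) (v t) - cross2 c (v t))"
        using l by (simp add: x cross2.add_left cross2.scaleR_left)
      finally show ?thesis .
    qed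
  qed
  then have "curve_energy (Omega P) \<gamma> = (1 / l) * (2 * A)"
    unfolding curve_energy_tension[OF v] by (simp add: has_integral_iff)
  also have "\<dots> = least_energy A"
    using A wulff_area_pos by (simp add: least_energy_def l_def real_sqrt_divide real_sqrt_mult field_simps)
  finally show "curve_energy (Omega P) \<gamma> = least_energy A" .
qed

text \<open>The loop chosen in the definition of the boundary integral, or its reversal, winds once
  counterclockwise, and its normals are the outward normals of the body.\<close>

lemma body_energy_boundary_curve:
  assumes B: "convex_body B" "measure lebesgue B = A" and A: "0 < A"
  obtains \<gamma> where "boundary_curve \<gamma> B" "signed_area \<gamma> = A" "curve_energy (Omega P) \<gamma> = body_energy P B"
proof -
  have K: "compact B" "convex B" using B by (auto simp: convex_body_def)
  have "interior B \<noteq> {}"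
    using B A negligible_convex_interior[OF K(2)] negligible_imp_measure0 by force
  then obtain c where c: "c \<in> interior B" by blast
  define \<beta> where "\<beta> = (SOME \<gamma>. simple_boundary_loop \<gamma> B)"
  have "\<exists>\<gamma>. simple_boundary_loop \<gamma> B" using standard_boundary_loop[OF K c, of 0] by metis
  then have sb: "simple_boundary_loop \<beta> B" unfolding \<beta>_def by (rule someI_ex)
  let ?f = "\<lambda>\<xi>. P (Arg (outward_normal B \<xi>))"
  have energy: "((\<lambda>t. ?f (\<gamma> t) * norm (v t)) has_integral curve_energy (Omega P) \<gamma>) {0..1}"
    if w: "winds_once c B \<gamma>" and v: "has_velocity \<gamma> v" for \<gamma> v
  proof (rule has_integral_spike)
    show "((\<lambda>t. tension (- \<i> * v t)) has_integral curve_energy (Omega P) \<gamma>) {0..1}"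
      unfolding curve_energy_tension[OF v] by (rule integrable_integral[OF tension_integrable[OF v]])
    show "negligible ({t\<in>{0<..<1}. \<not> (\<gamma> has_vector_derivative v t) (at t)} \<union> {0,1})"
      using has_velocityD(4)[OF v] by (simp add: negligible_Un)
    fix t assume "t \<in> {0..1} - ({t\<in>{0<..<1}. \<not> (\<gamma> has_vector_derivative v t) (at t)} \<union> {0,1})"
    then have t: "t \<in> {0<..<1}" "(\<gamma> has_vector_derivative v t) (at t)" by auto
    show "?f (\<gamma> t) * norm (v t) = tension (- \<i> * v t)"
    proof (cases "v t = 0")
      case False
      then have u: "- \<i> * v t = norm (v t) *\<^sub>R outward_normal B (\<gamma> t)"
        using winds_once_normal(2)[OF K c w t] by simp
      have n1: "norm (outward_normal B (\<gamma> t)) = 1"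
        using winds_once_normal(2)[OF K c w t False] False by (simp add: norm_mult)
      have "tension (- \<i> * v t) = norm (v t) * tension (outward_normal B (\<gamma> t))"
        unfolding u by (rule tension_scale) simp
      then show ?thesis by (simp add: tension_def n1)
    qed (simp add: tension_def)
  qed
  obtain v where v: "has_velocity \<beta> v"
    using sb lipschitz_has_velocity unfolding simple_boundary_loop_def closed_lipschitz_curve_def by blast
  have cl: "\<beta> 0 = \<beta> 1" using sb by (auto simp: simple_boundary_loop_def closed_lipschitz_curve_def)
  have be: "body_energy P B = integral {0..1} (\<lambda>t. ?f (\<beta> t) * norm (v t))"
    unfolding body_energy_def boundary_integral_def line_integral_def \<beta>_def[symmetric]
    using integral_vector_derivative_eq[OF v, of "\<lambda>t w. ?f (\<beta> t) * norm w"] by simp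
  obtain \<gamma> w where \<gamma>: "winds_once c B \<gamma>" "has_velocity \<gamma> w" "\<gamma> 0 = \<gamma> 1" "curve_energy (Omega P) \<gamma> = body_energy P B"
    using simple_loop_winds_once[OF K c sb]
  proof
    assume w: "winds_once c B \<beta>"
    show ?thesis by (rule that[OF w v cl]) (use energy[OF w v] be in \<open>simp add: has_integral_iff\<close>)
  next
    assume w: "winds_once c B (\<lambda>t. \<beta> (1 - t))"
    have "((\<lambda>t. ?f (\<beta> t) * norm (v t)) has_integral curve_energy (Omega P) (\<lambda>t. \<beta> (1 - t))) {0..1}"
      using has_integral_reverse[OF energy[OF w has_velocity_reverse[OF v]]] by simp
    then show ?thesis
      by (intro that[OF w has_velocity_reverse[OF v]]) (use be cl in \<open>simp_all add: has_integral_iff\<close>)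
  qed
  have area: "signed_area \<gamma> = A" using winds_once_area[OF K c \<gamma>(1-3)] B(2) by simp
  have "closed_lipschitz_curve \<gamma>" using has_velocityD(1)[OF \<gamma>(2)] \<gamma>(3) by (simp add: closed_lipschitz_curve_def)
  then have "boundary_curve \<gamma> B"
    by (rule winds_once_boundary_curve[OF K c \<gamma>(1)]) (use area A in simp)
  then show ?thesis using that area \<gamma>(4) by blast
qed

lemma boundary_curve_closed: "boundary_curve \<gamma> B \<Longrightarrow> closed_lipschitz_curve \<gamma>"
  by (simp add: boundary_curve_def)

lemma wulff_copy_body:
  assumes A: "0 < A"
  shows "convex_body (wulff_copy A c)" "measure lebesgue (wulff_copy A c) = A" "body_energy P (wulff_copy A c) = least_energy A"
proof -
  show B: "convex_body (wulff_copy A c)" using wulff_copy_compact wulff_copy_convex by (simp add: convex_body_def)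
  show m: "measure lebesgue (wulff_copy A c) = A" by (rule wulff_copy_measure[OF A])
  obtain \<gamma> where "boundary_curve \<gamma> (wulff_copy A c)" "curve_energy (Omega P) \<gamma> = body_energy P (wulff_copy A c)"
    by (rule body_energy_boundary_curve[OF B m A])
  then show "body_energy P (wulff_copy A c) = least_energy A" using wulff_copy_boundary_curve(2)[OF A] by metis
qed

lemma optimal_curve_iff:
  assumes A: "0 < A"
  shows "optimal_curve P A \<gamma> \<longleftrightarrow>
    closed_lipschitz_curve \<gamma> \<and> signed_area \<gamma> = A \<and> curve_energy (Omega P) \<gamma> = least_energy A"
proof -
  obtain \<gamma>0 where \<gamma>0: "boundary_curve \<gamma>0 (wulff_copy A 0)" "signed_area \<gamma>0 = A" "curve_energy (Omega P) \<gamma>0 = body_energy P (wulff_copy A 0)"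
    by (rule body_energy_boundary_curve[OF wulff_copy_body(1,2)[OF A] A])
  then have "closed_lipschitz_curve \<gamma>0" "curve_energy (Omega P) \<gamma>0 = least_energy A"
    using boundary_curve_closed wulff_copy_body(3)[OF A] by auto
  note \<gamma>0 = \<gamma>0(2) this
  show ?thesis
  proof
    assume "optimal_curve P A \<gamma>"
    then have \<gamma>: "closed_lipschitz_curve \<gamma>" "signed_area \<gamma> = A" "curve_energy (Omega P) \<gamma> \<le> curve_energy (Omega P) \<gamma>0"
      using \<gamma>0(1,2) unfolding optimal_curve_def by blast+
    then show "closed_lipschitz_curve \<gamma> \<and> signed_area \<gamma> = A \<and> curve_energy (Omega P) \<gamma> = least_energy A"
      using curve_energy_lower_bound[OF \<gamma>(1,2) A] \<gamma>0(3) by simp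
  qed (use curve_energy_lower_bound[OF _ _ A] in \<open>auto simp: optimal_curve_def\<close>)
qed

lemma optimal_body_iff:
  assumes A: "0 < A"
  shows "optimal_body P A B \<longleftrightarrow> convex_body B \<and> measure lebesgue B = A \<and> body_energy P B = least_energy A"
proof -
  have lower: "least_energy A \<le> body_energy P B" if B: "convex_body B" "measure lebesgue B = A" for B
  proof -
    obtain \<gamma> where "boundary_curve \<gamma> B" "signed_area \<gamma> = A" "curve_energy (Omega P) \<gamma> = body_energy P B"
      by (rule body_energy_boundary_curve[OF B A])
    then show ?thesis using curve_energy_lower_bound[OF boundary_curve_closed _ A] by metis
  qed
  show ?thesis
  proof
    assume "optimal_body P A B"
    then have B: "convex_body B" "measure lebesgue B = A" "body_energy P B \<le> body_energy P (wulff_copy A 0)"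
      using wulff_copy_body(1,2)[OF A, of 0] unfolding optimal_body_def by blast+
    then show "convex_body B \<and> measure lebesgue B = A \<and> body_energy P B = least_energy A"
      using lower[OF B(1,2)] wulff_copy_body(3)[OF A, of 0] by simp
  qed (use lower in \<open>auto simp: optimal_body_def\<close>)
qed

lemma optimal_body_iff_wulff_copy:
  assumes A: "0 < A"
  shows "optimal_body P A B \<longleftrightarrow> (\<exists>c. B = wulff_copy A c)"
proof
  assume "optimal_body P A B"
  then have B: "convex_body B" "measure lebesgue B = A" "body_energy P B = least_energy A"
    using optimal_body_iff[OF A] by auto
  obtain \<gamma> where \<gamma>: "boundary_curve \<gamma> B" "signed_area \<gamma> = A" "curve_energy (Omega P) \<gamma> = body_energy P B"
    by (rule body_energy_boundary_curve[OF B(1,2) A])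
  obtain c where "boundary_curve \<gamma> (wulff_copy A c)"
    by (rule least_energy_curve[OF boundary_curve_closed[OF \<gamma>(1)] \<gamma>(2) A]) (use \<gamma>(3) B(3) in auto)
  then show "\<exists>c. B = wulff_copy A c" using boundary_curve_unique[OF \<gamma>(1)] by blast
next
  assume "\<exists>c. B = wulff_copy A c"
  then show "optimal_body P A B" using optimal_body_iff[OF A] wulff_copy_body[OF A] by blast
qed

lemma optimal_curve_iff_boundary_curve:
  assumes A: "0 < A"
  shows "optimal_curve P A \<gamma> \<longleftrightarrow> (\<exists>B. optimal_body P A B \<and> boundary_curve \<gamma> B)"
proof
  assume "optimal_curve P A \<gamma>"
  then have \<gamma>: "closed_lipschitz_curve \<gamma>" "signed_area \<gamma> = A" "curve_energy (Omega P) \<gamma> = least_energy A"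
    using optimal_curve_iff[OF A] by auto
  obtain c where "boundary_curve \<gamma> (wulff_copy A c)" by (rule least_energy_curve[OF \<gamma>(1,2) A \<gamma>(3)])
  moreover have "optimal_body P A (wulff_copy A c)" unfolding optimal_body_iff_wulff_copy[OF A] by blast
  ultimately show "\<exists>B. optimal_body P A B \<and> boundary_curve \<gamma> B" by blast
next
  assume "\<exists>B. optimal_body P A B \<and> boundary_curve \<gamma> B"
  then obtain B where B: "optimal_body P A B" "boundary_curve \<gamma> B" by blast
  obtain c where "B = wulff_copy A c" using B(1) unfolding optimal_body_iff_wulff_copy[OF A] by blast
  with B(2) have b: "boundary_curve \<gamma> (wulff_copy A c)" by simp
  show "optimal_curve P A \<gamma>"
    unfolding optimal_curve_iff[OF A] using boundary_curve_closed[OF b] wulff_copy_boundary_curve[OF A b] by blast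
qed

lemma optimal_body_iff_optimal_curve:
  assumes A: "0 < A"
  shows "optimal_body P A B \<longleftrightarrow> (\<exists>\<gamma>. optimal_curve P A \<gamma> \<and> boundary_curve \<gamma> B)"
proof
  assume opt: "optimal_body P A B"
  then have B: "convex_body B" "measure lebesgue B = A" using optimal_body_iff[OF A] by blast+
  obtain \<gamma> where "boundary_curve \<gamma> B" by (rule body_energy_boundary_curve[OF B A])
  then show "\<exists>\<gamma>. optimal_curve P A \<gamma> \<and> boundary_curve \<gamma> B"
    using opt unfolding optimal_curve_iff_boundary_curve[OF A] by blast
next
  assume "\<exists>\<gamma>. optimal_curve P A \<gamma> \<and> boundary_curve \<gamma> B"
  then obtain \<gamma> where \<gamma>: "optimal_curve P A \<gamma>" "boundary_curve \<gamma> B" by blast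
  obtain B' where B': "optimal_body P A B'" "boundary_curve \<gamma> B'"
    using \<gamma>(1) unfolding optimal_curve_iff_boundary_curve[OF A] by blast
  then show "optimal_body P A B" using boundary_curve_unique[OF \<gamma>(2) B'(2)] by simp
qed

end

theorem mainTheorem3:
  fixes P :: "real \<Rightarrow> real"
  assumes "continuous_on UNIV P"
    and "\<And>\<theta>. P (\<theta> + 2 * pi) = P \<theta>"
    and "\<And>\<theta>. 0 \<le> P \<theta>"
    and "\<exists>a b. b - a > pi \<and> (\<forall>\<theta>\<in>{a<..<b}. 0 < P \<theta>)"
  shows "\<exists>c>0. \<forall>A>0.
    (\<forall>B. optimal_body P A B \<longleftrightarrow> (\<exists>\<gamma>. optimal_curve P A \<gamma> \<and> boundary_curve \<gamma> B)) \<and>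
    (\<forall>\<gamma>. optimal_curve P A \<gamma> \<longleftrightarrow> (\<exists>B. optimal_body P A B \<and> boundary_curve \<gamma> B)) \<and>
    (\<forall>B. optimal_body P A B \<longleftrightarrow>
       (\<exists>v. B = (\<lambda>p. v + (c * sqrt A) *\<^sub>R p) ` polar_set (convex hull (Omega P))))"
proof -
  interpret anisotropy P by unfold_locales (use assms in auto)
  have copy: "(\<lambda>p. v + (1 / sqrt wulff_area * sqrt A) *\<^sub>R p) ` polar_set (convex hull (Omega P)) = wulff_copy A v" for v A
    by (simp add: wulff_copy_def polar_eq_wulff real_sqrt_divide)
  show ?thesis
  proof (intro exI[of _ "1 / sqrt wulff_area"] conjI allI impI)
    show "0 < 1 / sqrt wulff_area" using wulff_area_pos by simp
    fix A :: real assume A: "0 < A"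
    show "optimal_body P A B \<longleftrightarrow> (\<exists>\<gamma>. optimal_curve P A \<gamma> \<and> boundary_curve \<gamma> B)" for B
      by (rule optimal_body_iff_optimal_curve[OF A])
    show "optimal_curve P A \<gamma> \<longleftrightarrow> (\<exists>B. optimal_body P A B \<and> boundary_curve \<gamma> B)" for \<gamma>
      by (rule optimal_curve_iff_boundary_curve[OF A])
    show "optimal_body P A B \<longleftrightarrow>
        (\<exists>v. B = (\<lambda>p. v + (1 / sqrt wulff_area * sqrt A) *\<^sub>R p) ` polar_set (convex hull (Omega P)))" for B
      unfolding copy by (rule optimal_body_iff_wulff_copy[OF A])
  qed
qed


end
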